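(* Let $2\le p<\infty$, $N\in\mathbb{N}=\{1,2,\dots\}$ and $\omega\in\widehat{\mathcal{D}}$, and let $\nu$ be a radial weight. Then there exists a constant $C=C(\omega,\nu,p,N)>0$ such that $$\int_{\mathbb{D}}\left|(1-\overline{z}\zeta)^NB^\omega_z(\zeta)\right|^p\nu(\zeta)\,dA(\zeta)\le C\left(\int_0^{|z|}\frac{\widehat{\nu}(t)}{\widehat{\omega}(t)^p(1-t)^{p(1-N)}}\,dt+1\right),\quad z\in\mathbb{D}.$$ Moreover, if $\nu\in\mathcal{D}$, then $$\int_{\mathbb{D}}\left|(1-\overline{z}\zeta)^NB^\omega_z(\zeta)\right|^p\nu(\zeta)\,dA(\zeta)\asymp\int_0^{|z|}\frac{\widehat{\nu}(t)}{\widehat{\omega}(t)^p(1-t)^{p(1-N)}}\,dt+1,\quad z\in\mathbb{D},$$ where the constants of comparison do not depend on $z$.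
   Context: $\mathbb{D}$ is the open unit disc and $dA(z)=\frac{dx\,dy}{\pi}$. A radial weight is a non-negative function $\omega\in L^1([0,1))$ extended to $\mathbb{D}$ by $\omega(z)=\omega(|z|)$; it is always assumed that $\widehat{\omega}(z)=\int_{|z|}^1\omega(s)\,ds>0$ for all $z\in\mathbb{D}$. Moments: $\omega_x=\int_0^1r^x\omega(r)\,dr$. Classes: $\omega\in\widehat{\mathcal{D}}$ if there is $C>1$ with $\widehat{\omega}(r)\le C\widehat{\omega}\left(\frac{1+r}{2}\right)$ for all $0\le r<1$; $\omega\in\mathcal{M}$ if there are $C>1$, $K>1$ with $\omega_x\ge C\omega_{Kx}$ for all $x\ge1$; $\omega\in\check{\mathcal{D}}$ if there are $K>1$, $C>1$ with $\widehat{\omega}(r)\ge C\widehat{\omega}\left(1-\frac{1-r}{K}\right)$ for all $0\le r<1$. Then $\mathcal{D}=\widehat{\mathcal{D}}\cap\mathcal{M}=\widehat{\mathcal{D}}\cap\check{\mathcal{D}}$ (the equality is known). $B^\omega_z(\zeta)=\sum_{n=0}^\infty\frac{(\overline{z}\zeta)^n}{2\omega_{2n+1}}$ are the reproducing kernels of the weighted Bergman space $A^2_\omega$ of analytic functions in $L^2(\mathbb{D},\omega\,dA)$. $a\asymp b$ means that each of $a,b$ is at most a constant multiple of the other. *)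

theory Defs
  imports "HOL-Analysis.Analysis"
begin

(* A radial weight is given by its profile on [0,1); the weight on the unit disc is
   z \<mapsto> \<omega> (cmod z).  Values of the profile outside [0,1) never matter. *)

definition weight_tail :: "(real \<Rightarrow> real) \<Rightarrow> real \<Rightarrow> real" where
  "weight_tail \<omega> r = (LINT s:{r..<1}|lebesgue. \<omega> s)"

definition radial_weight :: "(real \<Rightarrow> real) \<Rightarrow> bool" where
  "radial_weight \<omega> \<longleftrightarrow>
     (\<forall>r\<in>{0..<1}. 0 \<le> \<omega> r) \<and>
     set_integrable lebesgue {0..<1} \<omega> \<and>
     (\<forall>r\<in>{0..<1}. 0 < weight_tail \<omega> r)"

definition weight_moment :: "(real \<Rightarrow> real) \<Rightarrow> real \<Rightarrow> real" where
  "weight_moment \<omega> x = (LINT r:{0..<1}|lebesgue. r powr x * \<omega> r)"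

definition class_D_hat :: "(real \<Rightarrow> real) set" where
  "class_D_hat = {\<omega>. radial_weight \<omega> \<and>
     (\<exists>C>1. \<forall>r\<in>{0..<1}. weight_tail \<omega> r \<le> C * weight_tail \<omega> ((1 + r) / 2))}"

definition class_M :: "(real \<Rightarrow> real) set" where
  "class_M = {\<omega>. radial_weight \<omega> \<and>
     (\<exists>C>1. \<exists>K>1. \<forall>x\<ge>1. weight_moment \<omega> x \<ge> C * weight_moment \<omega> (K * x))}"

definition class_D :: "(real \<Rightarrow> real) set" where
  "class_D = class_D_hat \<inter> class_M"

(* Normalised so that the unit disc has area 1. *)
definition area_measure :: "complex measure" where
  "area_measure = scale_measure (ennreal (1 / pi)) lebesgue"

(* The monomials are orthogonal in the Bergman space with weight \<omega>, and the squared norm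
   of \<zeta>^n is 2 * weight_moment \<omega> (2 * n + 1); hence the coefficients of the kernel. *)
definition bergman_kernel :: "(real \<Rightarrow> real) \<Rightarrow> complex \<Rightarrow> complex \<Rightarrow> complex" where
  "bergman_kernel \<omega> z \<zeta> =
     (\<Sum>n. (cnj z * \<zeta>) ^ n / complex_of_real (2 * weight_moment \<omega> (2 * real n + 1)))"

definition comparable_on :: "'a set \<Rightarrow> ('a \<Rightarrow> ennreal) \<Rightarrow> ('a \<Rightarrow> ennreal) \<Rightarrow> bool" where
  "comparable_on S a b \<longleftrightarrow>
     (\<exists>C::real>0. \<forall>x\<in>S. a x \<le> ennreal C * b x) \<and>
     (\<exists>C::real>0. \<forall>x\<in>S. b x \<le> ennreal C * a x)"

end

theory Submission
  imports Defs
begin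

text \<open>
  Put \<open>d = \<bar>1 - w\<bar>\<close> and \<open>K w = (\<Sum>n. w ^ n / (2 \<omega>\<^bsub>2n+1\<^esub>))\<close>. Doubling of the tail makes the moments behave
  like a symbol: the \<open>j\<close>-th difference of \<open>1 / \<omega>\<^bsub>2n+1\<^esub>\<close> is \<open>O(n\<^sup>-\<^sup>j / \<omega>\<^bsub>2n+1\<^esub>)\<close>. Cutting the series
  at \<open>n \<approx> 1/d\<close> and summing the remainder by parts sufficiently often gives the pointwise bound
  \<open>K w = O(1 / (d \<cdot> tail (1 - d/2)))\<close>, and this bound is attained in a Stolz angle around the positive
  radius, where \<open>K\<close> is compared with its values on that radius. Integrating over circles
  bounds the means of \<open>\<bar>(1 - w)\<^sup>N K w\<bar>\<^sup>p\<close> on \<open>\<bar>w\<bar> = u\<close> from above by \<open>1 + \<integral>\<^sub>0\<^sup>u g\<close> and from below by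
  \<open>(1 - u) g u\<close>, where \<open>g t = ((1 - t)\<^bsup>N-1\<^esup> / tail t)\<^sup>p\<close>. Fubini turns the former into the upper
  estimate; for the latter, \<open>\<nu> \<in> D\<close> says that a fixed proportion of the mass of \<open>\<nu>\<close> beyond \<open>t\<close> sits at
  distance comparable to \<open>1 - t\<close> from \<open>1\<close>, which gives the lower estimate.
\<close>

section \<open>Finite differences of symbol type\<close>

text \<open>Why doubling gives symbol bounds: the \<open>j\<close>-th difference of the moments
  inserts \<open>(1 - r\<^sup>2) ^ j\<close> under the integral, and \<open>r ^ n\<close> confines
  \<open>1 - r\<close> to size \<open>1 / n\<close>; on dyadic layers further from \<open>1\<close>
  the decay of \<open>r ^ n\<close>, available to any polynomial order, beats the factor
  \<open>C\<close> that doubling loses per layer. Reciprocals are then handled algebraically. Each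
  summation by parts gains a factor \<open>1 / (n d)\<close>, so the number required is dictated by
  the polynomial growth of the coefficients. The factor \<open>1 - u\<close> in the lower estimate
  is, up to a constant, the length of the arc cut out by the Stolz angle. On a single circle the two
  estimates do not match: \<open>(1 - u) * g u\<close> can be far smaller than \<open>1\<close> plus
  the integral of \<open>g\<close>. They are reconciled only by the exchange of integrals against
  \<nu>: a radius \<open>r\<close> has to serve only those \<open>t\<close> with
  \<open>1 - t\<close> between \<open>1 - r\<close> and \<open>K * (1 - r)\<close>, an interval of
  length \<open>O(1 - r)\<close>, and there \<open>g t\<close> is controlled by
  \<open>g (r * x)\<close>.\<close>

definition fdiff :: "(nat \<Rightarrow> real) \<Rightarrow> nat \<Rightarrow> real" where
  "fdiff f n = f (Suc n) - f n"

text \<open>Discrete analogue of a symbol class: every difference costs one power of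
  \<open>n\<close>, relative to the size \<phi>. \<open>Suc n\<close> in place of \<open>n\<close>
  makes the bound meaningful at \<open>0\<close>. The constants may depend on \<open>j\<close>, and
  their sign is left free.\<close>

definition symbol_bound :: "nat \<Rightarrow> (nat \<Rightarrow> real) \<Rightarrow> (nat \<Rightarrow> real) \<Rightarrow> bool" where
  "symbol_bound k \<phi> f \<longleftrightarrow> (\<forall>j\<le>k. \<exists>C. \<forall>n. \<bar>(fdiff ^^ j) f n\<bar> \<le> C * \<phi> n / real (Suc n) ^ j)"

lemma symbol_boundD:
  assumes "symbol_bound k \<phi> f" "j \<le> k" "\<And>n. 0 \<le> \<phi> n"
  obtains C where "C > 0" "\<And>n. \<bar>(fdiff ^^ j) f n\<bar> \<le> C * \<phi> n / real (Suc n) ^ j"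
proof -
  obtain C where C: "\<And>n. \<bar>(fdiff ^^ j) f n\<bar> \<le> C * \<phi> n / real (Suc n) ^ j"
    using assms unfolding symbol_bound_def by blast
  show thesis
  proof (rule that[of "max C 1"])
    fix n
    have "C * \<phi> n / real (Suc n) ^ j \<le> max C 1 * \<phi> n / real (Suc n) ^ j"
      using assms(3)[of n] by (intro divide_right_mono mult_right_mono) auto
    then show "\<bar>(fdiff ^^ j) f n\<bar> \<le> max C 1 * \<phi> n / real (Suc n) ^ j"
      using C[of n] by linarith
  qed simp
qed

lemma symbol_bound_mono: "symbol_bound k \<phi> f \<Longrightarrow> j \<le> k \<Longrightarrow> symbol_bound j \<phi> f"
  by (auto simp: symbol_bound_def)

lemma symbol_bound_0: "symbol_bound 0 \<phi> f \<longleftrightarrow> (\<exists>C. \<forall>n. \<bar>f n\<bar> \<le> C * \<phi> n)"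
  by (simp add: symbol_bound_def)

text \<open>The recursion behind the inductions for products and reciprocals: \<open>fdiff f\<close>
  is again a symbol, of one order less and of the smaller size
  \<open>\<phi> n / real (Suc n)\<close>.\<close>

lemma symbol_bound_Suc:
  "symbol_bound (Suc k) \<phi> f \<longleftrightarrow>
     (\<exists>C. \<forall>n. \<bar>f n\<bar> \<le> C * \<phi> n) \<and> symbol_bound k (\<lambda>n. \<phi> n / real (Suc n)) (fdiff f)"
proof -
  have "(\<forall>j\<le>Suc k. P j) \<longleftrightarrow> P 0 \<and> (\<forall>j\<le>k. P (Suc j))" for P
    by (metis Suc_le_mono le0 not0_implies_Suc)
  then show ?thesis
    unfolding symbol_bound_def
    by (simp add: funpow_Suc_right field_simps del: funpow.simps of_nat_Suc)
qed

lemma funpow_fdiff_add: "(fdiff ^^ j) (\<lambda>n. f n + g n) = (\<lambda>n. (fdiff ^^ j) f n + (fdiff ^^ j) g n)"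
  by (induction j) (auto simp: fdiff_def fun_eq_iff)

lemma funpow_fdiff_minus: "(fdiff ^^ j) (\<lambda>n. - f n) = (\<lambda>n. - (fdiff ^^ j) f n)"
  by (induction j) (auto simp: fdiff_def fun_eq_iff)

lemma funpow_fdiff_shift: "(fdiff ^^ j) (\<lambda>n. f (n + m)) = (\<lambda>n. (fdiff ^^ j) f (n + m))"
  by (induction j) (auto simp: fdiff_def fun_eq_iff)

lemma symbol_bound_add:
  assumes "symbol_bound k \<phi> f" "symbol_bound k \<phi> g"
  shows "symbol_bound k \<phi> (\<lambda>n. f n + g n)"
  unfolding symbol_bound_def
proof (intro allI impI)
  fix j assume "j \<le> k"
  obtain C where C: "\<And>n. \<bar>(fdiff ^^ j) f n\<bar> \<le> C * \<phi> n / real (Suc n) ^ j"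
    using assms(1) \<open>j \<le> k\<close> unfolding symbol_bound_def by blast
  obtain D where D: "\<And>n. \<bar>(fdiff ^^ j) g n\<bar> \<le> D * \<phi> n / real (Suc n) ^ j"
    using assms(2) \<open>j \<le> k\<close> unfolding symbol_bound_def by blast
  have "\<bar>(fdiff ^^ j) (\<lambda>n. f n + g n) n\<bar> \<le> (C + D) * \<phi> n / real (Suc n) ^ j" for n
    using C[of n] D[of n] unfolding funpow_fdiff_add
    by (simp add: distrib_right add_divide_distrib del: of_nat_Suc)
  then show "\<exists>C. \<forall>n. \<bar>(fdiff ^^ j) (\<lambda>n. f n + g n) n\<bar> \<le> C * \<phi> n / real (Suc n) ^ j" by blast
qed

lemma symbol_bound_minus: "symbol_bound k \<phi> f \<Longrightarrow> symbol_bound k \<phi> (\<lambda>n. - f n)"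
  by (simp add: symbol_bound_def funpow_fdiff_minus)

lemma symbol_bound_shift:
  assumes "symbol_bound k \<phi> f" "\<And>n. 0 \<le> \<phi> n" "\<And>n. \<phi> (Suc n) \<le> B * \<phi> n"
  shows "symbol_bound k \<phi> (\<lambda>n. f (Suc n))"
  unfolding symbol_bound_def
proof (intro allI impI)
  fix j assume "j \<le> k"
  obtain C where C: "C > 0" "\<And>n. \<bar>(fdiff ^^ j) f n\<bar> \<le> C * \<phi> n / real (Suc n) ^ j"
    using symbol_boundD[OF assms(1) \<open>j \<le> k\<close> assms(2)] by blast
  have "\<bar>(fdiff ^^ j) (\<lambda>n. f (Suc n)) n\<bar> \<le> (C * B) * \<phi> n / real (Suc n) ^ j" for n
  proof -
    have "\<bar>(fdiff ^^ j) (\<lambda>n. f (Suc n)) n\<bar> \<le> C * \<phi> (Suc n) / real (Suc (Suc n)) ^ j"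
      using C(2)[of "Suc n"] funpow_fdiff_shift[of j f 1] by simp
    also have "\<dots> \<le> C * \<phi> (Suc n) / real (Suc n) ^ j"
      using C(1) assms(2)[of "Suc n"] by (intro divide_left_mono power_mono mult_pos_pos) auto
    also have "\<dots> \<le> C * B * \<phi> n / real (Suc n) ^ j"
      using C(1) assms(3)[of n] by (intro divide_right_mono) (auto simp: mult.assoc)
    finally show ?thesis .
  qed
  then show "\<exists>C. \<forall>n. \<bar>(fdiff ^^ j) (\<lambda>n. f (Suc n)) n\<bar> \<le> C * \<phi> n / real (Suc n) ^ j" by blast
qed

text \<open>Discrete Leibniz rule: the difference of \<open>f * g\<close> is
  \<open>fdiff f n * g (Suc n) + f n * fdiff g n\<close>. The shifted factor
  \<open>g (Suc n)\<close> is why \<psi> must not grow by more than a factor \<open>B\<close> per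
  step.\<close>

lemma symbol_bound_mult:
  assumes "symbol_bound k \<phi> f" "symbol_bound k \<psi> g"
    and "\<And>n. 0 \<le> \<phi> n" "\<And>n. 0 \<le> \<psi> n" "\<And>n. \<psi> (Suc n) \<le> B * \<psi> n"
  shows "symbol_bound k (\<lambda>n. \<phi> n * \<psi> n) (\<lambda>n. f n * g n)"
  using assms
proof (induction k arbitrary: f g \<phi> \<psi> B)
  case 0
  obtain C where C: "C > 0" "\<And>n. \<bar>f n\<bar> \<le> C * \<phi> n"
    using symbol_boundD[OF "0.prems"(1) order_refl "0.prems"(3)] by auto
  obtain D where D: "D > 0" "\<And>n. \<bar>g n\<bar> \<le> D * \<psi> n"
    using symbol_boundD[OF "0.prems"(2) order_refl "0.prems"(4)] by auto
  have "\<bar>f n * g n\<bar> \<le> (C * D) * (\<phi> n * \<psi> n)" for n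
    using mult_mono[OF C(2)[of n] D(2)[of n]] C(1) "0.prems"(3)[of n]
    by (simp add: abs_mult mult_ac)
  then show ?case by (auto simp: symbol_bound_0)
next
  case (Suc k)
  have f1: "symbol_bound k (\<lambda>n. \<phi> n / real (Suc n)) (fdiff f)"
    and g1: "symbol_bound k (\<lambda>n. \<psi> n / real (Suc n)) (fdiff g)"
    using Suc.prems by (auto simp: symbol_bound_Suc)
  have f0: "symbol_bound k \<phi> f" and g0: "symbol_bound k \<psi> g"
    using Suc.prems by (auto intro: symbol_bound_mono)
  have gS: "symbol_bound k \<psi> (\<lambda>n. g (Suc n))"
    using symbol_bound_shift[OF g0 Suc.prems(4,5)] .
  have 1: "symbol_bound k (\<lambda>n. \<phi> n / real (Suc n) * \<psi> n) (\<lambda>n. fdiff f n * g (Suc n))"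
    by (rule Suc.IH[OF f1 gS _ Suc.prems(4,5)]) (auto simp: Suc.prems)
  \<comment> \<open>The size of \<open>fdiff g\<close> inherits the same growth factor, so the
    induction hypothesis applies to it as well.\<close>
  have shift: "\<psi> (Suc n) / real (Suc (Suc n)) \<le> B * (\<psi> n / real (Suc n))" for n
  proof -
    have "\<psi> (Suc n) / real (Suc (Suc n)) \<le> \<psi> (Suc n) / real (Suc n)"
      using Suc.prems(4)[of "Suc n"] by (intro divide_left_mono) auto
    also have "\<dots> \<le> B * \<psi> n / real (Suc n)"
      using Suc.prems(5)[of n] by (intro divide_right_mono) auto
    finally show ?thesis by simp
  qed
  have 2: "symbol_bound k (\<lambda>n. \<phi> n * (\<psi> n / real (Suc n))) (\<lambda>n. f n * fdiff g n)"
    by (rule Suc.IH[OF f0 g1 Suc.prems(3) _ shift]) (auto simp: Suc.prems)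
  have "fdiff (\<lambda>n. f n * g n) = (\<lambda>n. fdiff f n * g (Suc n) + f n * fdiff g n)"
    by (auto simp: fdiff_def fun_eq_iff algebra_simps)
  then have 3: "symbol_bound k (\<lambda>n. \<phi> n * \<psi> n / real (Suc n)) (fdiff (\<lambda>n. f n * g n))"
    using symbol_bound_add[of k "\<lambda>n. \<phi> n * \<psi> n / real (Suc n)"] 1 2 by simp
  obtain C where C: "C > 0" "\<And>n. \<bar>f n\<bar> \<le> C * \<phi> n"
    using symbol_boundD[OF f0 le0 Suc.prems(3)] by auto
  obtain D where D: "D > 0" "\<And>n. \<bar>g n\<bar> \<le> D * \<psi> n"
    using symbol_boundD[OF g0 le0 Suc.prems(4)] by auto
  have "\<bar>f n * g n\<bar> \<le> (C * D) * (\<phi> n * \<psi> n)" for n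
    using mult_mono[OF C(2)[of n] D(2)[of n]] C(1) Suc.prems(3)[of n]
    by (simp add: abs_mult mult_ac)
  with 3 show ?case unfolding symbol_bound_Suc by blast
qed

text \<open>The difference of \<open>1 / m\<close> is
  \<open>- fdiff m n / (m n * m (Suc n))\<close>. Hence order \<open>k + 1\<close> for the
  reciprocal follows from order \<open>k\<close> for the reciprocal and two applications of the
  product rule; the sizes multiply to \<open>1 / m n / real (Suc n)\<close>.\<close>

lemma symbol_bound_inverse:
  assumes "\<And>n. 0 < m n" "decseq m" "\<And>n. m n \<le> B * m (Suc n)" "symbol_bound k m m"
  shows "symbol_bound k (\<lambda>n. 1 / m n) (\<lambda>n. 1 / m n)"
  using assms(4)
proof (induction k)
  case 0
  show ?case using assms(1) by (auto simp: symbol_bound_0 less_imp_le intro: exI[of _ 1])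
next
  case (Suc k)
  let ?a = "\<lambda>n. 1 / m n"
  have a: "symbol_bound k ?a ?a"
    using Suc symbol_bound_mono by (metis le_SucI order_refl)
  have a0: "0 \<le> ?a n" for n using assms(1)[of n] by simp
  have aB: "?a (Suc n) \<le> B * ?a n" for n
    using assms(1)[of n] assms(1)[of "Suc n"] assms(3)[of n] by (simp add: field_simps)
  have aS: "symbol_bound k ?a (\<lambda>n. ?a (Suc n))"
    using symbol_bound_shift[OF a a0 aB] .
  have m1: "symbol_bound k (\<lambda>n. m n / real (Suc n)) (\<lambda>n. - fdiff m n)"
    using Suc.prems by (auto simp: symbol_bound_Suc intro: symbol_bound_minus)
  have "symbol_bound k (\<lambda>n. m n / real (Suc n) * ?a n) (\<lambda>n. - fdiff m n * ?a (Suc n))"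
    by (rule symbol_bound_mult[OF m1 aS _ a0 aB]) (use assms(1) in \<open>simp add: less_imp_le\<close>)
  from symbol_bound_mult[OF this a _ a0 aB]
  have "symbol_bound k (\<lambda>n. m n / real (Suc n) * ?a n * ?a n) (\<lambda>n. - fdiff m n * ?a (Suc n) * ?a n)"
    using assms(1) by (simp add: less_imp_le)
  moreover have "(\<lambda>n. m n / real (Suc n) * ?a n * ?a n) = (\<lambda>n. ?a n / real (Suc n))"
    using assms(1) by (auto simp: fun_eq_iff field_simps less_imp_neq[symmetric])
  moreover have "(\<lambda>n. - fdiff m n * ?a (Suc n) * ?a n) = fdiff ?a"
  proof
    fix n
    show "- fdiff m n * ?a (Suc n) * ?a n = fdiff ?a n"
      using assms(1)[of n] assms(1)[of "Suc n"] by (simp add: fdiff_def field_simps)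
  qed
  ultimately have "symbol_bound k (\<lambda>n. ?a n / real (Suc n)) (fdiff ?a)" by simp
  then show ?case
    unfolding symbol_bound_Suc using a0 by (auto intro!: exI[of _ 1])
qed

section \<open>Power series with coefficients of symbol type\<close>

text \<open>Turns \<open>M * (1 - u) \<le> 1\<close> into \<open>u ^ M \<ge> exp (- 2)\<close>; the
  lower bounds for series and for moments both rest on it.\<close>

lemma exp_minus_double_le:
  fixes x :: real
  assumes "1 / 2 \<le> x" "x \<le> 1"
  shows "exp (- 2 * (1 - x)) \<le> x"
proof -
  have "ln (1 / x) \<le> 1 / x - 1" using assms by (intro ln_le_minus_one) auto
  also have "\<dots> \<le> 2 * (1 - x)"
  proof -
    have "0 \<le> (1 - x) * (2 * x - 1)" using assms by (intro mult_nonneg_nonneg) auto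
    then show ?thesis using assms by (simp add: field_simps)
  qed
  finally have "- 2 * (1 - x) \<le> ln x" using assms by (simp add: ln_div)
  then show ?thesis using assms by (metis exp_le_cancel_iff exp_ln half_gt_zero_iff less_le_trans zero_less_one)
qed

lemma sum_inverse_squares_tail: "(\<Sum>n<k. 1 / real (Suc (n + M)) ^ 2) \<le> 2 / real (Suc M)"
proof -
  have "(\<Sum>n<k. 1 / real (Suc (n + M)) ^ 2) \<le> (\<Sum>n<k. 2 / real (Suc (n + M)) - 2 / real (Suc (Suc n + M)))"
  proof (rule sum_mono)
    fix n
    define x where "x = real (Suc (n + M))"
    have "x \<ge> 1" by (simp add: x_def)
    then have "2 / x - 2 / (x + 1) = 2 / (x * (x + 1))" "1 / x ^ 2 = 2 / (x * (2 * x))"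
      by (simp_all add: field_simps power2_eq_square)
    moreover have "2 / (x * (2 * x)) \<le> 2 / (x * (x + 1))"
      using \<open>x \<ge> 1\<close> by (intro divide_left_mono mult_left_mono mult_pos_pos) auto
    ultimately have "1 / x ^ 2 \<le> 2 / x - 2 / (x + 1)" by simp
    then show "1 / real (Suc (n + M)) ^ 2 \<le> 2 / real (Suc (n + M)) - 2 / real (Suc (Suc n + M))"
      by (simp add: x_def add_ac)
  qed
  also have "\<dots> = 2 / real (Suc M) - 2 / real (Suc (k + M))"
    using sum_lessThan_telescope'[of "\<lambda>n. 2 / real (Suc (n + M))" k] by simp
  also have "\<dots> \<le> 2 / real (Suc M)" by simp
  finally show ?thesis .
qed

text \<open>One summation by parts is the identity \<open>(1 - w) * (\<Sum>n. c n * w ^ n) = c 0 + w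
  * (\<Sum>n. fdiff c n * w ^ n)\<close>; the factor \<open>w\<close> is dropped since
  \<open>norm w < 1\<close>. The bound is its \<open>k\<close>-fold iterate.\<close>

lemma summation_by_parts_bound:
  fixes b :: "nat \<Rightarrow> real" and w :: complex
  assumes "\<And>j. summable (\<lambda>n. \<bar>(fdiff ^^ j) b n\<bar> * norm w ^ n)" "norm w < 1"
  shows "norm (\<Sum>n. of_real (b n) * w ^ n) \<le>
    (\<Sum>j<k. \<bar>(fdiff ^^ j) b 0\<bar> / norm (1 - w) ^ Suc j)
      + norm (\<Sum>n. of_real ((fdiff ^^ k) b n) * w ^ n) / norm (1 - w) ^ k"
proof (induction k)
  case 0
  show ?case by simp
next
  case (Suc k)
  have w: "norm (1 - w) > 0" using assms(2) by auto
  define c where "c = (fdiff ^^ k) b"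
  have c: "summable (\<lambda>n. of_real (c n) * w ^ n)"
    using assms(1)[of k] by (intro summable_norm_cancel[of "\<lambda>n. of_real (c n) * w ^ n"])
      (simp add: norm_mult norm_power c_def)
  have c': "summable (\<lambda>n. of_real (fdiff c n) * w ^ n)"
    using assms(1)[of "Suc k"] by (intro summable_norm_cancel[of "\<lambda>n. of_real (fdiff c n) * w ^ n"])
      (simp add: norm_mult norm_power c_def)
  have split: "(\<Sum>n. of_real (c n) * w ^ n) = of_real (c 0) + w * (\<Sum>n. of_real (c (Suc n)) * w ^ n)"
  proof -
    have "summable (\<lambda>n. w * (of_real (c (Suc n)) * w ^ n))"
      using summable_Suc_iff[of "\<lambda>n. of_real (c n) * w ^ n"] c by (simp add: mult_ac)
    then have "w * (\<Sum>n. of_real (c (Suc n)) * w ^ n) = (\<Sum>n. w * (of_real (c (Suc n)) * w ^ n))"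
      \<comment> \<open>Summability of the shifted series is recovered by cancelling
        \<open>w\<close>; for \<open>w = 0\<close> both sides vanish.\<close>
      by (cases "w = 0") (auto simp: suminf_mult dest: summable_mult_D)
    then show ?thesis using suminf_split_head[OF c] by (simp add: mult_ac)
  qed
  have cS: "(\<lambda>n. of_real (c (Suc n)) * w ^ n) = (\<lambda>n. of_real (c n) * w ^ n + of_real (fdiff c n) * w ^ n)"
    by (auto simp: fdiff_def algebra_simps)
  have "(\<Sum>n. of_real (c (Suc n)) * w ^ n) = (\<Sum>n. of_real (c n) * w ^ n) + (\<Sum>n. of_real (fdiff c n) * w ^ n)"
    unfolding cS by (rule suminf_add[OF c c', symmetric])
  then have "(1 - w) * (\<Sum>n. of_real (c n) * w ^ n) = of_real (c 0) + w * (\<Sum>n. of_real (fdiff c n) * w ^ n)"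
    using split by (simp add: algebra_simps)
  then have "norm (1 - w) * norm (\<Sum>n. of_real (c n) * w ^ n) = norm (of_real (c 0) + w * (\<Sum>n. of_real (fdiff c n) * w ^ n))"
    by (metis norm_mult)
  also have "\<dots> \<le> \<bar>c 0\<bar> + norm w * norm (\<Sum>n. of_real (fdiff c n) * w ^ n)"
    by (metis norm_triangle_ineq norm_mult norm_of_real)
  also have "\<dots> \<le> \<bar>c 0\<bar> + norm (\<Sum>n. of_real (fdiff c n) * w ^ n)"
    using mult_right_mono[of "norm w" 1] assms(2) by simp
  finally have "norm (\<Sum>n. of_real (c n) * w ^ n) \<le>
     (\<bar>c 0\<bar> + norm (\<Sum>n. of_real (fdiff c n) * w ^ n)) / norm (1 - w)"
    using w by (simp add: pos_le_divide_eq mult.commute)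
  then have "norm (\<Sum>n. of_real (c n) * w ^ n) / norm (1 - w) ^ k
     \<le> (\<bar>c 0\<bar> + norm (\<Sum>n. of_real (fdiff c n) * w ^ n)) / norm (1 - w) / norm (1 - w) ^ k"
    using w by (intro divide_right_mono) auto
  also have "\<dots> = \<bar>c 0\<bar> / norm (1 - w) ^ Suc k
     + norm (\<Sum>n. of_real (fdiff c n) * w ^ n) / norm (1 - w) ^ Suc k"
    using w by (simp add: add_divide_distrib)
  finally show ?case using Suc.IH by (simp add: c_def)
qed

section \<open>Power series whose coefficients are symbols of their own size\<close>

locale smooth_increasing =
  fixes a :: "nat \<Rightarrow> real"
  assumes pos: "0 < a n" and incseq: "incseq a" and symb: "symbol_bound k a a"
begin

text \<open>The first-order symbol bound and Bernoulli's inequality give \<open>a (Suc n) \<le> a n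
  * (real (Suc (Suc n)) / real (Suc n)) ^ \<beta>\<close>, so
  \<open>a n / real (Suc n) ^ \<beta>\<close> decreases. The exponent \<beta> later fixes the number
  of summations by parts.\<close>

lemma polynomial_growth:
  obtains \<beta> :: nat where "\<And>m n. m \<le> n \<Longrightarrow> a n \<le> a m * (real (Suc n) / real (Suc m)) ^ \<beta>"
proof -
  obtain C where C: "C > 0" "\<And>n. \<bar>fdiff a n\<bar> \<le> C * a n / real (Suc n)"
    using symbol_boundD[OF symb[of 1], of 1] pos[THEN less_imp_le] by auto
  obtain \<beta> :: nat where \<beta>: "C \<le> real \<beta>" using real_arch_simple by blast
  have step: "a (Suc n) / real (Suc (Suc n)) ^ \<beta> \<le> a n / real (Suc n) ^ \<beta>" for n
  proof -
    have "a (Suc n) \<le> a n * (1 + C / real (Suc n))"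
      using C(2)[of n] by (simp add: fdiff_def algebra_simps)
    also have "\<dots> \<le> a n * (1 + real \<beta> * (1 / real (Suc n)))"
      using \<beta> pos[of n] by (intro mult_left_mono add_left_mono) (auto intro: divide_right_mono)
    also have "\<dots> \<le> a n * (1 + 1 / real (Suc n)) ^ \<beta>"
      using pos[of n] by (intro mult_left_mono Bernoulli_inequality) (auto intro: order_trans[of _ 0])
    also have "1 + 1 / real (Suc n) = real (Suc (Suc n)) / real (Suc n)"
      by (simp add: field_simps)
    finally show ?thesis by (simp add: field_simps power_divide del: of_nat_Suc)
  qed
  have dec: "decseq (\<lambda>n. a n / real (Suc n) ^ \<beta>)"
    using step by (intro decseq_SucI) auto
  show thesis
  proof (rule that)
    fix m n :: nat assume "m \<le> n"
    then show "a n \<le> a m * (real (Suc n) / real (Suc m)) ^ \<beta>"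
      using decseqD[OF dec, of m n] by (simp add: field_simps power_divide del: of_nat_Suc)
  qed
qed

text \<open>Ratio test: once \<open>C / real (Suc n)\<close> is below \<open>(1 - x) / 2\<close>,
  the ratio of consecutive terms is at most \<open>(1 + x) / 2\<close>, by
  \<open>(1 - x)\<^sup>2 \<ge> 0\<close>.\<close>

lemma summable_geometric:
  assumes "0 \<le> x" "x < 1"
  shows "summable (\<lambda>n. a n * x ^ n)"
proof -
  obtain C where C: "C > 0" "\<And>n. \<bar>fdiff a n\<bar> \<le> C * a n / real (Suc n)"
    using symbol_boundD[OF symb[of 1], of 1] pos[THEN less_imp_le] by auto
  obtain N :: nat where N: "2 * C / (1 - x) \<le> real N" using real_arch_simple by blast
  show ?thesis
  proof (rule summable_ratio_test[of "(1 + x) / 2"])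
    show "(1 + x) / 2 < 1" using assms by simp
    fix n assume "N \<le> n"
    then have "2 * C / (1 - x) \<le> real (Suc n)" using N by linarith
    then have Cn: "C / real (Suc n) \<le> (1 - x) / 2"
      using assms C(1) by (simp add: field_simps)
    have "a (Suc n) \<le> a n * (1 + C / real (Suc n))"
      using C(2)[of n] by (simp add: fdiff_def algebra_simps)
    also have "\<dots> \<le> a n * (1 + (1 - x) / 2)"
      using Cn pos[of n] by (intro mult_left_mono) auto
    finally have "a (Suc n) * x \<le> a n * (1 + (1 - x) / 2) * x"
      using assms by (intro mult_right_mono)
    also have "\<dots> = a n * ((1 + (1 - x) / 2) * x)" by simp
    also have "\<dots> \<le> a n * ((1 + x) / 2)"
    proof -
      have "0 \<le> (1 - x) ^ 2" by simp
      then have "(1 + (1 - x) / 2) * x \<le> (1 + x) / 2" by (simp add: power2_eq_square field_simps)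
      then show ?thesis using pos[of n] by (intro mult_left_mono) auto
    qed
    finally have "a (Suc n) * x * x ^ n \<le> a n * ((1 + x) / 2) * x ^ n"
      using assms by (intro mult_right_mono) auto
    then show "norm (a (Suc n) * x ^ Suc n) \<le> (1 + x) / 2 * norm (a n * x ^ n)"
      using pos[of n] pos[of "Suc n"] assms by (simp add: abs_mult mult_ac)
  qed
qed

lemma summable_fdiff_geometric:
  assumes "0 \<le> x" "x < 1"
  shows "summable (\<lambda>n. \<bar>(fdiff ^^ j) a n\<bar> * x ^ n)"
proof -
  obtain C where C: "C > 0" "\<And>n. \<bar>(fdiff ^^ j) a n\<bar> \<le> C * a n / real (Suc n) ^ j"
    using symbol_boundD[OF symb order_refl] pos[THEN less_imp_le] by blast
  show ?thesis
  proof (rule summable_comparison_test')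
    show "summable (\<lambda>n. C * (a n * x ^ n))" by (intro summable_mult summable_geometric assms)
    fix n
    have "C * a n / real (Suc n) ^ j \<le> C * a n / 1"
      using C(1) pos[of n] by (intro divide_left_mono one_le_power mult_pos_pos) auto
    then have "\<bar>(fdiff ^^ j) a n\<bar> \<le> C * a n" using C(2)[of n] by simp
    then show "norm (\<bar>(fdiff ^^ j) a n\<bar> * x ^ n) \<le> C * (a n * x ^ n)"
      using assms by (simp add: abs_mult mult_right_mono flip: mult.assoc)
  qed
qed

definition series :: "complex \<Rightarrow> complex" where
  "series w = (\<Sum>n. of_real (a n) * w ^ n)"

lemma summable_series: "norm (w :: complex) < 1 \<Longrightarrow> summable (\<lambda>n. of_real (a n) * w ^ n)"
  using summable_geometric[of "norm w"] pos[THEN less_imp_le]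
  by (intro summable_norm_cancel[of "\<lambda>n. of_real (a n) * w ^ n"])
     (simp add: norm_mult norm_power)

lemma series_of_real:
  assumes "0 \<le> x" "x < 1"
  shows "series (of_real x) = of_real (\<Sum>n. a n * x ^ n)"
proof -
  have "(\<lambda>n. complex_of_real (a n * x ^ n)) sums of_real (\<Sum>n. a n * x ^ n)"
    by (rule sums_of_real[OF summable_sums[OF summable_geometric[OF assms]]])
  then show ?thesis unfolding series_def by (simp add: sums_iff)
qed

text \<open>With \<open>d = norm (1 - w)\<close> the cut is at \<open>M\<close>, the integer part of
  \<open>1 / d\<close>. The head has \<open>M \<le> 1 / d\<close> terms of size at most
  \<open>a M\<close>. In the remainder each summation by parts yields a boundary term with an extra
  \<open>1 / (real (Suc M) * d) ^ j\<close>, which is at most \<open>1\<close>.\<close>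

theorem series_upper:
  obtains C where "C > 0" "\<And>w. norm w < 1 \<Longrightarrow>
    norm (series w) \<le> C * a (nat \<lfloor>1 / norm (1 - w)\<rfloor>) / norm (1 - w)"
proof -
  obtain \<beta> :: nat where \<beta>: "\<And>m n. m \<le> n \<Longrightarrow> a n \<le> a m * (real (Suc n) / real (Suc m)) ^ \<beta>"
    using polynomial_growth by blast
  \<comment> \<open>\<beta> differences cancel the growth of \<open>a\<close>; two more leave the
    summable factor \<open>1 / n\<^sup>2\<close>.\<close>
  define k where "k = \<beta> + 2"
  have "\<forall>j. \<exists>C>0. \<forall>n. \<bar>(fdiff ^^ j) a n\<bar> \<le> C * a n / real (Suc n) ^ j"
    using symbol_boundD[OF symb order_refl] pos[THEN less_imp_le] by metis
  then obtain C where C: "\<And>j. C j > 0" "\<And>j n. \<bar>(fdiff ^^ j) a n\<bar> \<le> C j * a n / real (Suc n) ^ j"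
    by metis
  \<comment> \<open>The summands pay for the head, the boundary terms and the final remainder; the
    \<open>2\<close> is that of \<open>sum_inverse_squares_tail\<close>.\<close>
  define C0 where "C0 = 1 + (\<Sum>j<k. C j) + 2 * C k"
  show thesis
  proof (rule that)
    show "C0 > 0" using C(1)[of k] sum_nonneg[of "{..<k}" C] C(1)[THEN less_imp_le] by (simp add: C0_def)
    fix w :: complex assume w: "norm w < 1"
    define d where "d = norm (1 - w)"
    have d: "d > 0" using w by (auto simp: d_def)
    define M where "M = nat \<lfloor>1 / d\<rfloor>"
    have M: "real M \<le> 1 / d" "1 / d \<le> real (Suc M)" using d by (auto simp: M_def) linarith+
    have M': "real M * d \<le> 1" "1 \<le> real (Suc M) * d" using M d by (auto simp: field_simps)
    define b where "b n = a (n + M)" for n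
    have fb: "(fdiff ^^ j) b = (\<lambda>n. (fdiff ^^ j) a (n + M))" for j
      by (simp add: b_def[abs_def] funpow_fdiff_shift)
    have split: "series w = (\<Sum>n. of_real (b n) * w ^ n) * w ^ M + (\<Sum>n<M. of_real (a n) * w ^ n)"
    proof -
      have s: "summable (\<lambda>n. of_real (b n) * w ^ n * w ^ M)"
        using summable_ignore_initial_segment[OF summable_series[OF w], of M]
        by (simp add: b_def power_add mult_ac)
      have "series w = (\<Sum>n. of_real (b n) * w ^ n * w ^ M) + (\<Sum>n<M. of_real (a n) * w ^ n)"
        unfolding series_def using suminf_split_initial_segment[OF summable_series[OF w], of M]
        by (simp add: b_def power_add mult_ac)
      also have "(\<Sum>n. of_real (b n) * w ^ n * w ^ M) = (\<Sum>n. of_real (b n) * w ^ n) * w ^ M"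
      \<comment> \<open>Cancelling \<open>w ^ M\<close> gives summability of the unscaled series; if
        the power vanishes, both sides are zero.\<close>
      proof (cases "w ^ M = 0")
        case False
        then have "summable (\<lambda>n. of_real (b n) * w ^ n)"
          using summable_mult2[OF s, of "inverse (w ^ M)"] by (simp add: mult.assoc)
        then show ?thesis by (rule suminf_mult2[symmetric])
      next
        case True
        show ?thesis by (simp only: True mult_zero_right suminf_zero)
      qed
      finally show ?thesis .
    qed
    have head: "norm (\<Sum>n<M. of_real (a n) * w ^ n) \<le> a M / d"
    proof -
      have "norm (\<Sum>n<M. of_real (a n) * w ^ n) \<le> (\<Sum>n<M. a M)"
      proof (rule sum_norm_le)
        fix n assume "n \<in> {..<M}"
        then have "a n \<le> a M" using incseqD[OF incseq] by auto
        moreover have "norm w ^ n \<le> 1" using w by (intro power_le_one) auto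
        ultimately have "a n * norm w ^ n \<le> a M * 1"
          using pos[of M] by (intro mult_mono) (auto simp: less_imp_le)
        then show "norm (of_real (a n) * w ^ n) \<le> a M"
          using pos[of n] by (simp add: norm_mult norm_power)
      qed
      also have "\<dots> \<le> a M / d" using M'(1) pos[of M] d by (simp add: field_simps)
      finally show ?thesis .
    qed
    have sb: "summable (\<lambda>n. \<bar>(fdiff ^^ j) b n\<bar> * norm w ^ n)" for j
    proof (cases "w = 0")
      case True
      then show ?thesis by (intro summable_finite[of "{0}"]) auto
    next
      case False
      have "summable (\<lambda>n. \<bar>(fdiff ^^ j) b n\<bar> * norm w ^ n * norm w ^ M)"
        using summable_ignore_initial_segment[OF summable_fdiff_geometric[of "norm w" j], of M] w
        by (simp add: fb power_add mult_ac)
      from summable_mult2[OF this, of "inverse (norm w ^ M)"]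
      show ?thesis using False by (simp add: mult.assoc)
    qed
    have first: "(\<Sum>j<k. \<bar>(fdiff ^^ j) b 0\<bar> / d ^ Suc j) \<le> (\<Sum>j<k. C j) * a M / d"
      unfolding sum_distrib_right sum_divide_distrib
    proof (rule sum_mono)
      fix j
      have "1 \<le> (real (Suc M) * d) ^ j" using M' by (intro one_le_power) auto
      then have "1 / (real (Suc M) * d) ^ j \<le> 1" by (simp add: divide_le_eq_1)
      then have "C j * a M / d * (1 / (real (Suc M) * d) ^ j) \<le> C j * a M / d * 1"
        using C(1)[of j] pos[of M] d by (intro mult_left_mono) auto
      moreover have "\<bar>(fdiff ^^ j) b 0\<bar> / d ^ Suc j \<le> (C j * a M / real (Suc M) ^ j) / d ^ Suc j"
        using C(2)[of j M] d by (intro divide_right_mono) (auto simp: fb)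
      moreover have "(C j * a M / real (Suc M) ^ j) / d ^ Suc j = C j * a M / d * (1 / (real (Suc M) * d) ^ j)"
        by (simp add: power_mult_distrib)
      ultimately show "\<bar>(fdiff ^^ j) b 0\<bar> / d ^ Suc j \<le> C j * a M / d" by linarith
    qed
    have termb: "\<bar>(fdiff ^^ k) b n\<bar> \<le> C k * a M / real (Suc M) ^ \<beta> * (1 / real (Suc (n + M)) ^ 2)" for n
    proof -
      have "\<bar>(fdiff ^^ k) b n\<bar> \<le> C k * a (n + M) / real (Suc (n + M)) ^ k"
        using C(2)[of k "n + M"] by (simp add: fb)
      also have "\<dots> \<le> C k * (a M * (real (Suc (n + M)) / real (Suc M)) ^ \<beta>) / real (Suc (n + M)) ^ k"
        using C(1)[of k] \<beta>[of M "n + M"] by (intro divide_right_mono mult_left_mono) auto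
      also have "\<dots> = C k * a M / real (Suc M) ^ \<beta> * (1 / real (Suc (n + M)) ^ 2)"
        by (simp add: k_def power_add power_divide power2_eq_square del: of_nat_Suc)
      finally show ?thesis .
    qed
    have "norm (\<Sum>n. of_real ((fdiff ^^ k) b n) * w ^ n) \<le> (\<Sum>n. \<bar>(fdiff ^^ k) b n\<bar> * norm w ^ n)"
      using summable_norm[of "\<lambda>n. of_real ((fdiff ^^ k) b n) * w ^ n"] sb[of k]
      by (simp add: norm_mult norm_power)
    also have "\<dots> \<le> C k * a M / real (Suc M) ^ \<beta> * (2 / real (Suc M))"
    proof (rule suminf_le_const[OF sb])
      fix n
      have "(\<Sum>i<n. \<bar>(fdiff ^^ k) b i\<bar> * norm w ^ i) \<le>
          (\<Sum>i<n. C k * a M / real (Suc M) ^ \<beta> * (1 / real (Suc (i + M)) ^ 2))"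
      proof (rule sum_mono)
        fix i
        have "\<bar>(fdiff ^^ k) b i\<bar> * norm w ^ i \<le> \<bar>(fdiff ^^ k) b i\<bar> * 1"
          using w by (intro mult_left_mono power_le_one) auto
        then show "\<bar>(fdiff ^^ k) b i\<bar> * norm w ^ i \<le> C k * a M / real (Suc M) ^ \<beta> * (1 / real (Suc (i + M)) ^ 2)"
          using termb[of i] by linarith
      qed
      also have "\<dots> \<le> C k * a M / real (Suc M) ^ \<beta> * (2 / real (Suc M))"
        unfolding sum_distrib_left[symmetric] using C(1)[of k] pos[of M]
        by (intro mult_left_mono sum_inverse_squares_tail) auto
      finally show "(\<Sum>i<n. \<bar>(fdiff ^^ k) b i\<bar> * norm w ^ i) \<le> C k * a M / real (Suc M) ^ \<beta> * (2 / real (Suc M))" .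
    qed
    finally have "norm (\<Sum>n. of_real ((fdiff ^^ k) b n) * w ^ n) / d ^ k \<le> C k * a M / real (Suc M) ^ \<beta> * (2 / real (Suc M)) / d ^ k"
      using d by (intro divide_right_mono) auto
    \<comment> \<open>Of the \<open>\<beta> + 2\<close> factors \<open>1 / d\<close>, all but one
      pair with a factor \<open>1 / real (Suc M)\<close>.\<close>
    also have "\<dots> = 2 * C k * a M / d * (1 / (real (Suc M) * d) ^ Suc \<beta>)"
      by (simp add: k_def power_mult_distrib mult_ac)
    also have "\<dots> \<le> 2 * C k * a M / d * 1"
    proof -
      have "1 \<le> (real (Suc M) * d) ^ Suc \<beta>" using M' by (intro one_le_power) auto
      then have "1 / (real (Suc M) * d) ^ Suc \<beta> \<le> 1" by (simp add: divide_le_eq_1 del: of_nat_Suc power_Suc)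
      then show ?thesis using C(1)[of k] pos[of M] d by (intro mult_left_mono) auto
    qed
    finally have "norm (\<Sum>n. of_real (b n) * w ^ n) \<le> (\<Sum>j<k. C j) * a M / d + 2 * C k * a M / d"
      using summation_by_parts_bound[OF sb w, of k] first by (simp add: d_def)
    moreover have "norm ((\<Sum>n. of_real (b n) * w ^ n) * w ^ M) \<le> norm (\<Sum>n. of_real (b n) * w ^ n)"
      using w by (simp add: norm_mult norm_power mult_left_le power_le_one)
    ultimately have "norm (series w) \<le> (\<Sum>j<k. C j) * a M / d + 2 * C k * a M / d + a M / d"
      unfolding split using head norm_triangle_ineq order_trans by (smt (verit))
    also have "\<dots> = C0 * a M / d" by (simp add: C0_def algebra_simps add_divide_distrib)
    finally show "norm (series w) \<le> C0 * a (nat \<lfloor>1 / norm (1 - w)\<rfloor>) / norm (1 - w)"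
      by (simp add: M_def d_def)
  qed
qed

text \<open>On the positive radius all terms are positive and there is no cancellation. Off the
  radius the change is at most \<open>norm (e - 1) * (\<Sum>n. real n * a n * u ^ n)\<close>, and
  the derivative-like sum is estimated by \<open>series_upper\<close> at a point halfway to
  \<open>1\<close>. For small \<epsilon> the change is at most half of the value on the
  radius.\<close>

theorem series_lower:
  obtains c \<epsilon> where "c > 0" "\<epsilon> > 0" "\<And>u e. 0 \<le> u \<Longrightarrow> u < 1 \<Longrightarrow> norm e = 1 \<Longrightarrow> norm (e - 1) \<le> \<epsilon> * (1 - u) \<Longrightarrow>
    c * a (nat \<lfloor>1 / (1 - u)\<rfloor>) / (1 - u) \<le> norm (series (of_real u * e))"
proof -
  obtain \<beta> :: nat where \<beta>: "\<And>m n. m \<le> n \<Longrightarrow> a n \<le> a m * (real (Suc n) / real (Suc m)) ^ \<beta>"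
    using polynomial_growth by blast
  obtain C where C: "C > 0" "\<And>w. norm w < 1 \<Longrightarrow>
    norm (series w) \<le> C * a (nat \<lfloor>1 / norm (1 - w)\<rfloor>) / norm (1 - w)"
    using series_upper by blast
  \<comment> \<open>\<open>exp (-2)\<close> serves radii \<open>u \<ge> 1 / 2\<close>; the other
    entry serves \<open>u < 1 / 2\<close>, where only the term \<open>a 0\<close> is kept.\<close>
  define c0 :: real where "c0 = min (exp (-2)) (1 / (2 * 2 ^ \<beta>))"
  have c0: "c0 > 0" "c0 \<le> exp (-2)" "c0 \<le> 1 / (2 * 2 ^ \<beta>)" by (auto simp: c0_def)
  \<comment> \<open>Chosen so that the perturbation \<open>4 * \<epsilon> * C * 2 ^ \<beta>\<close>
    equals \<open>c0 / 2\<close>.\<close>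
  define \<epsilon> where "\<epsilon> = c0 / (8 * C * 2 ^ \<beta>)"
  have \<epsilon>: "\<epsilon> > 0" using c0 C by (simp add: \<epsilon>_def)
  show thesis
  proof (rule that[of "c0 / 2" \<epsilon>])
    show "c0 / 2 > 0" "\<epsilon> > 0" using c0 \<epsilon> by auto
    fix u :: real and e :: complex
    assume u: "0 \<le> u" "u < 1" and e: "norm e = 1" "norm (e - 1) \<le> \<epsilon> * (1 - u)"
    define M where "M = nat \<lfloor>1 / (1 - u)\<rfloor>"
    have M: "real M \<le> 1 / (1 - u)" "1 / (1 - u) < real (Suc M)"
      using u by (auto simp: M_def) linarith+
    have su: "summable (\<lambda>n. a n * u ^ n)" using u by (rule summable_geometric)
    have main: "c0 * a M / (1 - u) \<le> (\<Sum>n. a n * u ^ n)"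
    proof (cases "u < 1/2")
      case True
      then have "1 / (1 - u) < 2" using u by (simp add: field_simps)
      then have "M \<le> 1" using M(1) by linarith
      then have "a M \<le> a 1" using incseqD[OF incseq] by auto
      also have "\<dots> \<le> a 0 * 2 ^ \<beta>" using \<beta>[of 0 1] by simp
      finally have "c0 * a M / (1 - u) \<le> (1 / (2 * 2 ^ \<beta>)) * (a 0 * 2 ^ \<beta>) / (1 - u)"
        using u c0 pos[of M] by (intro divide_right_mono mult_mono) auto
      also have "\<dots> \<le> (1 / (2 * 2 ^ \<beta>)) * (a 0 * 2 ^ \<beta>) / (1 / 2)"
        using u True pos[of 0] by (intro divide_left_mono) auto
      also have "\<dots> = (\<Sum>n<1. a n * u ^ n)" by simp
      also have "\<dots> \<le> (\<Sum>n. a n * u ^ n)"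
        using su u pos[THEN less_imp_le] by (intro sum_le_suminf) auto
      finally show ?thesis .
    next
      case False
      \<comment> \<open>Only the terms from \<open>M\<close> on are kept: there the coefficients are
        at least \<open>a M\<close>, and the geometric series supplies
        \<open>u ^ M / (1 - u)\<close> with \<open>u ^ M\<close> bounded below.\<close>
      have "- 2 \<le> real M * (- 2 * (1 - u))" using M(1) u by (simp add: field_simps)
      then have "exp (- 2) \<le> exp (real M * (- 2 * (1 - u)))" by simp
      also have "\<dots> = exp (- 2 * (1 - u)) ^ M" by (rule exp_of_nat_mult)
      also have "\<dots> \<le> u ^ M" using False u by (intro power_mono exp_minus_double_le) auto
      finally have uM: "exp (- 2) \<le> u ^ M" .
      have "c0 * a M / (1 - u) \<le> u ^ M * a M / (1 - u)"
        using uM c0 u pos[of M] by (intro divide_right_mono mult_right_mono) auto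
      also have "\<dots> = (\<Sum>n. a M * u ^ M * u ^ n)"
        using u by (subst suminf_mult) (auto simp: suminf_geometric)
      also have "\<dots> \<le> (\<Sum>n. a (n + M) * u ^ (n + M))"
      proof (rule suminf_le)
        show "a M * u ^ M * u ^ n \<le> a (n + M) * u ^ (n + M)" for n
          using mult_right_mono[OF incseqD[OF incseq, of M "n + M"], of "u ^ (n + M)"] u
          by (simp add: power_add mult_ac)
        show "summable (\<lambda>n. a M * u ^ M * u ^ n)" using u by (intro summable_mult) simp
        show "summable (\<lambda>n. a (n + M) * u ^ (n + M))"
          using su by (rule summable_ignore_initial_segment)
      qed
      also have "\<dots> \<le> (\<Sum>n. a n * u ^ n)"
        using suminf_split_initial_segment[OF su, of M] u pos[THEN less_imp_le]
        by (simp add: sum_nonneg)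
      finally show ?thesis .
    qed
    \<comment> \<open>Moving from \<open>u\<close> to the midpoint \<open>v\<close> absorbs the
      factor \<open>n\<close> at the price of \<open>2 / (1 - u)\<close>, while \<open>1 - v\<close>
      stays comparable to \<open>1 - u\<close>.\<close>
    define v where "v = (1 + u) / 2"
    have v: "0 \<le> v" "v < 1" "u \<le> v" "1 - v = (1 - u) / 2" "v - u = (1 - u) / 2" using u by (auto simp: v_def field_simps)
    have sv: "summable (\<lambda>n. a n * v ^ n)" using v by (intro summable_geometric)
    have vb: "(\<Sum>n. a n * v ^ n) \<le> 2 * C * 2 ^ \<beta> * a M / (1 - u)"
    proof -
      have "series (of_real v) = of_real (\<Sum>n. a n * v ^ n)"
        using v by (intro series_of_real) auto
      then have "(\<Sum>n. a n * v ^ n) \<le> norm (series (of_real v))" by (simp only: norm_of_real abs_ge_self)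
      also have "\<dots> \<le> C * a (nat \<lfloor>1 / norm (1 - complex_of_real v)\<rfloor>) / norm (1 - complex_of_real v)"
        using v by (intro C(2)) simp
      also have "norm (1 - complex_of_real v) = (1 - u) / 2"
        using v by (metis norm_of_real abs_of_pos diff_gt_0_iff_gt of_real_1 of_real_diff)
      also have "C * a (nat \<lfloor>1 / ((1 - u) / 2)\<rfloor>) / ((1 - u) / 2) \<le> C * (a M * 2 ^ \<beta>) / ((1 - u) / 2)"
      proof -
        have floor: "nat \<lfloor>y\<rfloor> \<le> j" if "y < real (Suc j)" for y j using that by linarith
        \<comment> \<open>Halving the distance moves the index at most to \<open>2 * M + 1\<close>,
          where the growth quotient is exactly \<open>2\<close>.\<close>
        have "1 / ((1 - u) / 2) < real (Suc (2 * M + 1))" using M(2) by simp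
        then have "nat \<lfloor>1 / ((1 - u) / 2)\<rfloor> \<le> 2 * M + 1" by (rule floor)
        then have "a (nat \<lfloor>1 / ((1 - u) / 2)\<rfloor>) \<le> a (2 * M + 1)" by (rule incseqD[OF incseq])
        also have "\<dots> \<le> a M * (real (Suc (2 * M + 1)) / real (Suc M)) ^ \<beta>" by (rule \<beta>) simp
        also have "real (Suc (2 * M + 1)) / real (Suc M) = 2" by (simp add: field_simps)
        finally show ?thesis using u C(1) by (intro divide_right_mono mult_left_mono) auto
      qed
      finally show ?thesis by (simp add: mult_ac)
    qed
    have nu: "real n * u ^ n \<le> 2 / (1 - u) * v ^ n" for n
    proof -
      have "(v - u) * (real n * u ^ n) \<le> v ^ n"
      proof (induction n)
        case (Suc n)
        have "(v - u) * (real (Suc n) * u ^ Suc n) = u * ((v - u) * (real n * u ^ n)) + (v - u) * u ^ n * u"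
          by (simp add: algebra_simps)
        also have "\<dots> \<le> u * v ^ n + (v - u) * u ^ n * 1"
          using Suc u v(1,3) by (intro add_mono mult_left_mono) auto
        also have "\<dots> \<le> u * v ^ n + (v - u) * v ^ n"
          using u v(1,3) by (intro add_left_mono) (auto intro!: mult_left_mono power_mono)
        finally show ?case by (simp add: algebra_simps)
      qed simp
      then show ?thesis using u unfolding v(5) by (simp add: field_simps)
    qed
    have pw: "norm (e ^ n - 1) \<le> real n * norm (e - 1)" for n
      using norm_power_diff[of e 1 n] e by simp
    have s1: "summable (\<lambda>n. complex_of_real (a n) * (of_real u * e) ^ n)"
      using u e by (intro summable_series) (simp add: norm_mult)
    have s2: "summable (\<lambda>n. complex_of_real (a n) * of_real u ^ n)"
      using u by (intro summable_series) simp
    have termwise: "norm (of_real (a n) * (of_real u * e) ^ n - of_real (a n) * of_real u ^ n)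
        \<le> norm (e - 1) * (2 / (1 - u)) * (a n * v ^ n)" for n
    proof -
      have "of_real (a n) * (of_real u * e) ^ n - of_real (a n) * of_real u ^ n =
          of_real (a n) * of_real u ^ n * (e ^ n - 1)"
        by (simp add: power_mult_distrib algebra_simps)
      then have "norm (of_real (a n) * (of_real u * e) ^ n - of_real (a n) * of_real u ^ n) = a n * u ^ n * norm (e ^ n - 1)"
        using pos[of n] u by (simp add: norm_mult norm_power)
      also have "\<dots> \<le> a n * u ^ n * (real n * norm (e - 1))"
        using pos[of n] u by (intro mult_left_mono pw) auto
      also have "\<dots> = a n * norm (e - 1) * (real n * u ^ n)" by simp
      also have "\<dots> \<le> a n * norm (e - 1) * (2 / (1 - u) * v ^ n)"
        using pos[of n] by (intro mult_left_mono nu) auto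
      finally show ?thesis by (simp add: mult_ac)
    qed
    have "norm (series (of_real u * e) - series (of_real u))
        \<le> (\<Sum>n. norm (e - 1) * (2 / (1 - u)) * (a n * v ^ n))"
      unfolding series_def suminf_diff[OF s1 s2] by (intro norm_suminf_le termwise summable_mult sv)
    also have "\<dots> = norm (e - 1) * (2 / (1 - u)) * (\<Sum>n. a n * v ^ n)"
      using sv by (rule suminf_mult)
    also have "\<dots> \<le> \<epsilon> * (1 - u) * (2 / (1 - u)) * (2 * C * 2 ^ \<beta> * a M / (1 - u))"
      using u \<epsilon> e vb pos[THEN less_imp_le] v by (intro mult_mono) (auto intro!: suminf_nonneg sv)
    also have "\<epsilon> * (1 - u) * (2 / (1 - u)) = 2 * \<epsilon>" using u by simp
    also have "2 * \<epsilon> * (2 * C * 2 ^ \<beta> * a M / (1 - u)) = c0 / 2 * a M / (1 - u)"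
      using C(1) by (simp add: \<epsilon>_def)
    finally have diff: "norm (series (of_real u * e) - series (of_real u)) \<le> c0 / 2 * a M / (1 - u)" .
    have "series (of_real u) = of_real (\<Sum>n. a n * u ^ n)"
      using u by (intro series_of_real) auto
    then have "(\<Sum>n. a n * u ^ n) \<le> norm (series (of_real u))" by (simp only: norm_of_real abs_ge_self)
    then have "c0 * a M / (1 - u) - c0 / 2 * a M / (1 - u) \<le> norm (series (of_real u * e))"
      using main diff norm_triangle_ineq3[of "series (of_real u)" "series (of_real u * e)"]
      by (simp add: norm_minus_commute)
    moreover have "c0 / 2 * a M / (1 - u) = c0 * a M / (1 - u) / 2" by simp
    ultimately have "c0 / 2 * a M / (1 - u) \<le> norm (series (of_real u * e))" by linarith
    then show "c0 / 2 * a (nat \<lfloor>1 / (1 - u)\<rfloor>) / (1 - u) \<le> norm (series (of_real u * e))"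
      by (simp only: M_def)
  qed
qed

end

section \<open>Moments of measures with doubling tail\<close>

lemma power_le_fact_exp: "0 \<le> (s::real) \<Longrightarrow> s ^ q \<le> fact q * exp s"
proof -
  assume s: "0 \<le> s"
  have "(\<Sum>n\<in>{q}. s ^ n /\<^sub>R fact n) \<le> (\<Sum>n. s ^ n /\<^sub>R fact n)"
    using s by (intro sum_le_suminf summable_exp_generic) auto
  then show ?thesis by (simp add: exp_def field_simps)
qed

lemma exp_minus_le_decay:
  fixes y :: real
  assumes "0 \<le> y"
  shows "exp (- y) \<le> fact q * exp 1 * (1 / (1 + y)) ^ q"
proof -
  have "(1 + y) ^ q \<le> fact q * exp 1 * exp y"
    using power_le_fact_exp[of "1 + y" q] assms by (simp add: exp_add)
  then show ?thesis
    using assms by (simp add: exp_minus power_divide field_simps)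
qed

text \<open>From \<open>r \<le> exp (r - 1)\<close>. Trading the exponential for polynomial decay of
  arbitrary order \<open>q\<close> lets powers of \<open>1 - r\<close> be absorbed later.\<close>

lemma powr_le_decay:
  fixes r x :: real
  assumes "0 \<le> r" "r \<le> 1" "0 \<le> x"
  shows "r powr x \<le> fact q * exp 1 * (1 / (1 + x * (1 - r))) ^ q"
proof -
  have "r \<le> exp (r - 1)" using exp_ge_add_one_self[of "r - 1"] by simp
  then have "r powr x \<le> exp (r - 1) powr x" using assms by (intro powr_mono2)
  also have "\<dots> = exp (- (x * (1 - r)))" by (simp add: exp_powr_real algebra_simps)
  also have "\<dots> \<le> fact q * exp 1 * (1 / (1 + x * (1 - r))) ^ q"
    using assms by (intro exp_minus_le_decay) auto
  finally show ?thesis .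
qed

section \<open>Tails and moments of a finite measure on the unit interval\<close>

locale radial_measure = finite_measure \<mu> for \<mu> :: "real measure" +
  assumes sets_eq [measurable_cong]: "sets \<mu> = sets borel"
    and AE_unit: "AE r in \<mu>. 0 \<le> r \<and> r < 1"
    and tail_pos': "\<And>t. 0 \<le> t \<Longrightarrow> t < 1 \<Longrightarrow> 0 < measure \<mu> {t..}"
begin

definition tail :: "real \<Rightarrow> real" where "tail t = measure \<mu> {t..}"

lemma space_eq [simp]: "space \<mu> = UNIV"
  using sets_eq_imp_space_eq[OF sets_eq] by simp

lemma AE_unitI: "(\<And>r. 0 \<le> r \<Longrightarrow> r < 1 \<Longrightarrow> P r) \<Longrightarrow> AE r in \<mu>. P r"
  using eventually_mono[OF AE_unit] by blast

lemma tail_antimono: "s \<le> t \<Longrightarrow> tail t \<le> tail s"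
  unfolding tail_def by (rule finite_measure_mono) (auto simp: sets_eq)

lemma tail_nonneg [simp]: "0 \<le> tail t" by (simp add: tail_def)

text \<open>Gives \<open>tail\<close> its meaning at arguments such as
  \<open>1 - 2 ^ k * \<delta>\<close>, which may be negative.\<close>

lemma tail_neg: "t \<le> 0 \<Longrightarrow> tail t = tail 0"
  unfolding tail_def
  by (rule finite_measure_eq_AE) (auto simp: sets_eq intro: AE_unitI)

lemma tail_pos: "t < 1 \<Longrightarrow> 0 < tail t"
  using tail_pos'[of t] tail_pos'[of 0] tail_neg[of t] by (cases "0 \<le> t") (auto simp: tail_def)

lemma integrable_bounded:
  fixes f :: "real \<Rightarrow> real"
  assumes [measurable]: "f \<in> borel_measurable borel" and "\<And>r. 0 \<le> r \<Longrightarrow> r < 1 \<Longrightarrow> \<bar>f r\<bar> \<le> B"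
  shows "integrable \<mu> f"
  by (rule integrable_const_bound[of _ B]) (auto intro: AE_unitI assms(2))

lemma integral_mono_unit:
  fixes f g :: "real \<Rightarrow> real"
  assumes "integrable \<mu> f" "integrable \<mu> g" "\<And>r. 0 \<le> r \<Longrightarrow> r < 1 \<Longrightarrow> f r \<le> g r"
  shows "integral\<^sup>L \<mu> f \<le> integral\<^sup>L \<mu> g"
  by (rule integral_mono_AE) (auto intro: AE_unitI assms)

definition moment :: "real \<Rightarrow> real" where
  "moment x = (\<integral>r. r powr x \<partial>\<mu>)"

lemma integrable_powr: "0 \<le> x \<Longrightarrow> integrable \<mu> (\<lambda>r. r powr x)"
  by (rule integrable_bounded[of _ 1]) (auto intro: powr_le1)

lemma integrable_tail: "integrable \<mu> (indicator {t..} :: real \<Rightarrow> real)"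
  by (rule integrable_bounded[of _ 1]) auto

lemma moment_antimono: "0 \<le> x \<Longrightarrow> x \<le> y \<Longrightarrow> moment y \<le> moment x"
  unfolding moment_def
  by (rule integral_mono_unit) (auto intro!: integrable_powr powr_mono_both' powr_mono')

text \<open>For \<open>r \<ge> 1 - 1 / x\<close> the integrand is at least
  \<open>(1 - 1 / x) powr x \<ge> exp (- 2)\<close>; \<open>x \<ge> 2\<close> keeps
  \<open>1 - 1 / x\<close> in the range of \<open>exp_minus_double_le\<close>.\<close>

lemma moment_ge_tail:
  assumes "2 \<le> x"
  shows "exp (- 2) * tail (1 - 1 / x) \<le> moment x"
proof -
  have "(\<integral>r. exp (- 2 :: real) * indicator {1 - 1 / x..} r \<partial>\<mu>) \<le> moment x"
    unfolding moment_def
  proof (rule integral_mono_unit)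
    show "integrable \<mu> (\<lambda>r. r powr x)" using assms by (intro integrable_powr) auto
    show "integrable \<mu> (\<lambda>r. exp (- 2 :: real) * indicator {1 - 1 / x..} r)"
      by (intro integrable_mult_right integrable_tail)
    fix r :: real assume r: "0 \<le> r" "r < 1"
    show "exp (- 2) * indicator {1 - 1 / x..} r \<le> r powr x"
    proof (cases "1 - 1 / x \<le> r")
      case True
      have x: "1 / x \<le> 1 / 2" using assms by (simp add: field_simps)
      have "exp (- 2) = exp (- 2 * (1 - (1 - 1 / x))) powr x"
        using assms by (simp add: exp_powr_real)
      also have "\<dots> \<le> (1 - 1 / x) powr x"
        using assms x by (intro powr_mono2 exp_minus_double_le) auto
      also have "\<dots> \<le> r powr x" using True assms x by (intro powr_mono2) auto
      finally show ?thesis using True by simp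
    qed simp
  qed
  then show ?thesis by (simp add: tail_def)
qed

text \<open>The denominators of the kernel coefficients, written with integer powers so that
  differences can be taken under the integral.\<close>

definition odd_moment :: "nat \<Rightarrow> real" where
  "odd_moment n = 2 * (\<integral>r. r ^ (2 * n + 1) \<partial>\<mu>)"

lemma odd_moment_eq: "odd_moment n = 2 * moment (2 * real n + 1)"
proof -
  have "(\<integral>r. r ^ (2 * n + 1) \<partial>\<mu>) = moment (2 * real n + 1)"
    unfolding moment_def
  proof (rule integral_cong_AE)
    show "AE r in \<mu>. r ^ (2 * n + 1) = r powr (2 * real n + 1)"
      using AE_unit
    proof eventually_elim
      fix r :: real assume r: "0 \<le> r \<and> r < 1"
      show "r ^ (2 * n + 1) = r powr (2 * real n + 1)"
      proof (cases "r = 0")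
        case False
        then have "r powr real (2 * n + 1) = r ^ (2 * n + 1)" using r by (intro powr_realpow) auto
        then show ?thesis by (simp add: add.commute)
      qed simp
    qed
  qed auto
  then show ?thesis by (simp add: odd_moment_def)
qed

text \<open>Passing from \<open>n\<close> to \<open>Suc n\<close> multiplies the integrand by
  \<open>r\<^sup>2\<close>, so each difference inserts the factor
  \<open>r\<^sup>2 - 1\<close>.\<close>

lemma fdiff_odd_moment:
  "(fdiff ^^ j) odd_moment n = 2 * (- 1) ^ j * (\<integral>r. r ^ (2 * n + 1) * (1 - r\<^sup>2) ^ j \<partial>\<mu>)"
proof (induction j arbitrary: n)
  case (Suc j)
  have int: "integrable \<mu> (\<lambda>r. r ^ m * (1 - r\<^sup>2) ^ j)" for m
  proof (rule integrable_bounded[of _ 1])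
    fix r :: real assume "0 \<le> r" "r < 1"
    then show "\<bar>r ^ m * (1 - r\<^sup>2) ^ j\<bar> \<le> 1"
      by (simp add: abs_mult power_abs mult_le_one power_le_one abs_le_iff)
  qed simp
  have "(fdiff ^^ Suc j) odd_moment n = (fdiff ^^ j) odd_moment (Suc n) - (fdiff ^^ j) odd_moment n"
    by (simp add: fdiff_def)
  also have "\<dots> = 2 * (- 1) ^ j * ((\<integral>r. r ^ (2 * Suc n + 1) * (1 - r\<^sup>2) ^ j \<partial>\<mu>) - (\<integral>r. r ^ (2 * n + 1) * (1 - r\<^sup>2) ^ j \<partial>\<mu>))"
    unfolding Suc.IH by (simp only: right_diff_distrib)
  also have "(\<integral>r. r ^ (2 * Suc n + 1) * (1 - r\<^sup>2) ^ j \<partial>\<mu>) - (\<integral>r. r ^ (2 * n + 1) * (1 - r\<^sup>2) ^ j \<partial>\<mu>)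
     = (\<integral>r. r ^ (2 * Suc n + 1) * (1 - r\<^sup>2) ^ j - r ^ (2 * n + 1) * (1 - r\<^sup>2) ^ j \<partial>\<mu>)"
    by (rule Bochner_Integration.integral_diff[symmetric]) (rule int)+
  also have "\<dots> = (\<integral>r. - (r ^ (2 * n + 1) * (1 - r\<^sup>2) ^ Suc j) \<partial>\<mu>)"
    by (rule Bochner_Integration.integral_cong) (auto simp: algebra_simps power2_eq_square)
  finally show ?case by simp
qed (simp add: odd_moment_def)

end

section \<open>Moments and kernel of a measure with doubling tail\<close>

locale doubling_measure = radial_measure +
  fixes C :: real
  assumes doubling': "\<And>t. 0 \<le> t \<Longrightarrow> t < 1 \<Longrightarrow> tail t \<le> C * tail ((1 + t) / 2)"
begin

lemma C_ge_1: "1 \<le> C"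
proof -
  have "tail (1/2) \<le> tail 0" by (rule tail_antimono) simp
  also have "\<dots> \<le> C * tail (1/2)" using doubling'[of 0] by simp
  finally show ?thesis using tail_pos[of "1/2"] by simp
qed

lemma doubling: "t < 1 \<Longrightarrow> tail t \<le> C * tail ((1 + t) / 2)"
proof (cases "0 \<le> t")
  case False
  have "tail t \<le> C * tail (1/2)" using False tail_neg[of t] doubling'[of 0] by simp
  also have "\<dots> \<le> C * tail ((1 + t) / 2)" using False C_ge_1 by (intro mult_left_mono tail_antimono) auto
  finally show ?thesis .
qed (rule doubling')

lemma doubling_power: "\<delta> > 0 \<Longrightarrow> tail (1 - 2 ^ k * \<delta>) \<le> C ^ k * tail (1 - \<delta>)"
proof (induction k)
  case (Suc k)
  have "tail (1 - 2 ^ Suc k * \<delta>) \<le> C * tail ((1 + (1 - 2 ^ Suc k * \<delta>)) / 2)"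
    using Suc.prems by (intro doubling) simp
  also have "(1 + (1 - 2 ^ Suc k * \<delta>)) / 2 = 1 - 2 ^ k * \<delta>" by (simp add: field_simps)
  also have "C * tail (1 - 2 ^ k * \<delta>) \<le> C * (C ^ k * tail (1 - \<delta>))"
    using Suc C_ge_1 by (intro mult_left_mono) auto
  finally show ?case by (simp add: mult_ac)
qed simp

lemma integrable_decay: "1 \<le> X \<Longrightarrow> integrable \<mu> (\<lambda>r. (1 / (1 + X * (1 - r))) ^ q)"
  by (rule integrable_bounded[of _ 1])
     (auto intro!: power_le_one simp: power_abs divide_le_eq_1 add_nonneg_nonneg add_pos_nonneg)

text \<open>Dyadic layers: where \<open>X * (1 - r)\<close> is about \<open>2 ^ k\<close> the
  integrand is about \<open>2 ^ (- k * q)\<close>, while doubling bounds the mass by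
  \<open>C ^ k * tail (1 - 1 / X)\<close>.\<close>

lemma decay_integral:
  obtains q D where "D > 0" "\<And>X. 1 \<le> X \<Longrightarrow> (\<integral>r. (1 / (1 + X * (1 - r))) ^ q \<partial>\<mu>) \<le> D * tail (1 - 1 / X)"
proof -
  \<comment> \<open>Makes \<open>C / 2 ^ q\<close> at most \<open>1 / 2\<close>, the ratio of the
    geometric series over the layers.\<close>
  obtain q where q: "2 * C < 2 ^ q" using real_arch_pow[of 2 "2 * C"] by auto
  show thesis
  proof (rule that[of "2 * 2 ^ q" q])
    fix X :: real assume X: "1 \<le> X"
    \<comment> \<open>Since \<open>X * (1 - r) \<le> X\<close>, finitely many layers suffice and the
      sum can be integrated termwise; the final bound is independent of \<open>K\<close>.\<close>
    obtain K where K: "X < 2 ^ K" using real_arch_pow[of 2 X] by auto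
    have "(\<integral>r. (1 / (1 + X * (1 - r))) ^ q \<partial>\<mu>) \<le> (\<integral>r. (\<Sum>k\<le>K. (2::real) ^ q * (1 / 2 ^ q) ^ k * indicator {1 - 2 ^ k * (1 / X)..} r) \<partial>\<mu>)"
    proof (rule integral_mono_unit)
      show "integrable \<mu> (\<lambda>r. (1 / (1 + X * (1 - r))) ^ q)" using X by (rule integrable_decay)
      show "integrable \<mu> (\<lambda>r. \<Sum>k\<le>K. (2::real) ^ q * (1 / 2 ^ q) ^ k * indicator {1 - 2 ^ k * (1 / X)..} r)"
        by (intro Bochner_Integration.integrable_sum integrable_mult_right integrable_tail)
      fix r :: real assume r: "0 \<le> r" "r < 1"
      \<comment> \<open>Minimality only gives \<open>X * (1 - r) > 2 ^ (k - 1)\<close>; this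
        off-by-one is the source of the factor \<open>2 ^ q\<close>.\<close>
      define k where "k = (LEAST k. X * (1 - r) \<le> 2 ^ k)"
      have "X * (1 - r) \<le> X * 1" using r X by (intro mult_left_mono) auto
      then have P: "X * (1 - r) \<le> 2 ^ K" using K by simp
      have k: "X * (1 - r) \<le> 2 ^ k" "k \<le> K"
        unfolding k_def by (rule LeastI[of _ K], rule P) (rule Least_le, rule P)
      have "(1 / (1 + X * (1 - r))) ^ q \<le> 2 ^ q * (1 / 2 ^ q) ^ k"
      proof (cases k)
        case 0
        have "(1 / (1 + X * (1 - r))) ^ q \<le> 1" using r X by (intro power_le_one) (auto simp: add_pos_nonneg)
        also have "(1::real) \<le> 2 ^ q" by simp
        finally show ?thesis using 0 by simp
      next
        case (Suc i)
        then have "\<not> X * (1 - r) \<le> 2 ^ i" using not_less_Least[of i "\<lambda>k. X * (1 - r) \<le> 2 ^ k"] by (simp add: k_def)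
        moreover have "0 \<le> X * (1 - r)" using r X by simp
        ultimately have "1 / (1 + X * (1 - r)) \<le> 1 / 2 ^ i" by (intro divide_left_mono) auto
        then have "(1 / (1 + X * (1 - r))) ^ q \<le> (1 / 2 ^ i) ^ q" using r X by (intro power_mono) auto
        also have "\<dots> = 2 ^ q * (1 / 2 ^ q) ^ k" by (simp add: Suc power_divide mult.commute flip: power_mult)
        finally show ?thesis .
      qed
      also have "\<dots> = (\<Sum>k\<in>{k}. 2 ^ q * (1 / 2 ^ q) ^ k * indicator {1 - 2 ^ k * (1 / X)..} r)"
        using k(1) X by (simp add: indicator_def field_simps)
      also have "\<dots> \<le> (\<Sum>k\<le>K. 2 ^ q * (1 / 2 ^ q) ^ k * indicator {1 - 2 ^ k * (1 / X)..} r)"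
        using k(2) by (intro sum_mono2) auto
      finally show "(1 / (1 + X * (1 - r))) ^ q \<le> (\<Sum>k\<le>K. 2 ^ q * (1 / 2 ^ q) ^ k * indicator {1 - 2 ^ k * (1 / X)..} r)" .
    qed
    also have "\<dots> = (\<Sum>k\<le>K. 2 ^ q * (1 / 2 ^ q) ^ k * tail (1 - 2 ^ k * (1 / X)))"
      by (subst Bochner_Integration.integral_sum) (auto simp: tail_def intro!: integrable_mult_right integrable_tail)
    also have "\<dots> \<le> (\<Sum>k\<le>K. 2 ^ q * tail (1 - 1 / X) * (1 / 2) ^ k)"
    proof (rule sum_mono)
      fix k
      have "2 ^ q * (1 / 2 ^ q) ^ k * tail (1 - 2 ^ k * (1 / X)) \<le> 2 ^ q * (1 / 2 ^ q) ^ k * (C ^ k * tail (1 - 1 / X))"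
        using X by (intro mult_left_mono doubling_power) auto
      also have "\<dots> = 2 ^ q * tail (1 - 1 / X) * (C / 2 ^ q) ^ k" by (simp add: power_divide)
      also have "\<dots> \<le> 2 ^ q * tail (1 - 1 / X) * (1 / 2) ^ k"
        using q C_ge_1 by (intro mult_left_mono power_mono) (auto simp: field_simps)
      finally show "2 ^ q * (1 / 2 ^ q) ^ k * tail (1 - 2 ^ k * (1 / X)) \<le> 2 ^ q * tail (1 - 1 / X) * (1 / 2) ^ k" .
    qed
    also have "\<dots> = 2 ^ q * tail (1 - 1 / X) * (\<Sum>k\<le>K. (1 / 2) ^ k)" by (simp only: sum_distrib_left)
    also have "\<dots> \<le> 2 ^ q * tail (1 - 1 / X) * 2"
      by (intro mult_left_mono) (auto simp: sum_gp0)
    finally show "(\<integral>r. (1 / (1 + X * (1 - r))) ^ q \<partial>\<mu>) \<le> 2 * 2 ^ q * tail (1 - 1 / X)" by simp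
  qed simp
qed

lemma moment_le_tail:
  obtains D where "D > 0" "\<And>x. 1 \<le> x \<Longrightarrow> moment x \<le> D * tail (1 - 1 / x)"
proof -
  obtain q D where D: "D > 0" "\<And>X. 1 \<le> X \<Longrightarrow> (\<integral>r. (1 / (1 + X * (1 - r))) ^ q \<partial>\<mu>) \<le> D * tail (1 - 1 / X)"
    using decay_integral by blast
  show thesis
  proof (rule that[of "fact q * exp 1 * D"])
    fix x :: real assume x: "1 \<le> x"
    have "moment x \<le> (\<integral>r. fact q * exp 1 * (1 / (1 + x * (1 - r))) ^ q \<partial>\<mu>)"
      unfolding moment_def
      by (rule integral_mono_unit) (use x in \<open>auto intro!: integrable_powr integrable_mult_right integrable_decay powr_le_decay\<close>)
    also have "\<dots> \<le> fact q * exp 1 * (D * tail (1 - 1 / x))"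
      using D(2)[OF x] by simp
    finally show "moment x \<le> fact q * exp 1 * D * tail (1 - 1 / x)" by (simp add: mult_ac)
  qed (use D in auto)
qed

text \<open>\<open>moment_ge_tail\<close> at exponent \<open>2 * n + 2\<close> sees the tail at
  \<open>1 - 1 / (2 * n + 2)\<close>; one doubling step brings it back to
  \<open>1 - 1 / (n + 1)\<close>.\<close>

lemma odd_moment_ge_tail: "exp (- 2) / C * tail (1 - 1 / real (Suc n)) \<le> odd_moment n"
proof -
  have "tail (1 - 1 / real (Suc n)) \<le> C * tail ((1 + (1 - 1 / real (Suc n))) / 2)" by (rule doubling) simp
  also have "(1 + (1 - 1 / real (Suc n))) / 2 = 1 - 1 / (2 * real (Suc n))" by (simp add: field_simps)
  finally have "exp (- 2) / C * tail (1 - 1 / real (Suc n)) \<le> exp (- 2) / C * (C * tail (1 - 1 / (2 * real (Suc n))))"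
    using C_ge_1 by (intro mult_left_mono) auto
  also have "\<dots> = exp (- 2) * tail (1 - 1 / (2 * real (Suc n)))" using C_ge_1 by simp
  also have "\<dots> \<le> moment (2 * real (Suc n))" by (rule moment_ge_tail) simp
  also have "\<dots> \<le> moment (2 * real n + 1)" by (rule moment_antimono) auto
  also have "\<dots> \<le> odd_moment n" unfolding odd_moment_eq by (simp add: moment_def)
  finally show ?thesis .
qed

lemma odd_moment_pos: "0 < odd_moment n"
proof -
  have "0 < exp (- 2) / C * tail (1 - 1 / real (Suc n))"
    using C_ge_1 by (intro mult_pos_pos divide_pos_pos tail_pos) auto
  then show ?thesis using odd_moment_ge_tail[of n] by linarith
qed

text \<open>Decay of order \<open>q + j\<close> is spent in two portions: \<open>j\<close> powers
  absorb \<open>(1 - r\<^sup>2) ^ j\<close> and leave \<open>1 / X ^ j\<close>, the other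
  \<open>q\<close> feed \<open>decay_integral\<close>.\<close>

lemma fdiff_odd_moment_bound:
  obtains D where "D > 0" "\<And>n. \<bar>(fdiff ^^ j) odd_moment n\<bar> \<le> D * tail (1 - 1 / real (Suc n)) / real (Suc n) ^ j"
proof -
  obtain q D where D: "D > 0" "\<And>X. 1 \<le> X \<Longrightarrow> (\<integral>r. (1 / (1 + X * (1 - r))) ^ q \<partial>\<mu>) \<le> D * tail (1 - 1 / X)"
    using decay_integral by blast
  define A :: real where "A = fact (q + j) * exp 1"
  show thesis
  proof (rule that[of "2 * A * 2 ^ j * D"])
    fix n
    define X where "X = real (Suc n)"
    have X: "1 \<le> X" by (simp add: X_def)
    have nonneg: "0 \<le> (\<integral>r. r ^ (2 * n + 1) * (1 - r\<^sup>2) ^ j \<partial>\<mu>)"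
      by (rule integral_nonneg_AE, rule AE_unitI) (simp add: power_le_one)
    have "(\<integral>r. r ^ (2 * n + 1) * (1 - r\<^sup>2) ^ j \<partial>\<mu>) \<le> (\<integral>r. A * 2 ^ j / X ^ j * (1 / (1 + X * (1 - r))) ^ q \<partial>\<mu>)"
    proof (rule integral_mono_unit)
      show "integrable \<mu> (\<lambda>r. r ^ (2 * n + 1) * (1 - r\<^sup>2) ^ j)"
        by (rule integrable_bounded[of _ 1]) (auto simp: abs_mult power_abs mult_le_one power_le_one abs_le_iff)
      show "integrable \<mu> (\<lambda>r. A * 2 ^ j / X ^ j * (1 / (1 + X * (1 - r))) ^ q)"
        using X by (intro integrable_mult_right integrable_decay)
      fix r :: real assume r: "0 \<le> r" "r < 1"
      define y where "y = X * (1 - r)"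
      have y: "0 \<le> y" using r X by (simp add: y_def)
      have "r ^ (2 * n + 1) \<le> r ^ Suc n" using r by (intro power_decreasing) auto
      also have "r ^ Suc n = r powr X"
        using r by (cases "r = 0") (auto simp: X_def powr_realpow simp del: of_nat_Suc power_Suc)
      also have "\<dots> \<le> A * (1 / (1 + y)) ^ (q + j)"
        unfolding A_def y_def using r X by (intro powr_le_decay) auto
      finally have 1: "r ^ (2 * n + 1) \<le> A * (1 / (1 + y)) ^ (q + j)" .
      have "1 - r\<^sup>2 = (1 - r) * (1 + r)" by (simp add: power2_eq_square algebra_simps)
      also have "\<dots> \<le> (1 - r) * 2" using r by (intro mult_left_mono) auto
      also have "\<dots> = 2 / X * y" using X by (simp add: y_def)
      also have "\<dots> \<le> 2 / X * (1 + y)" using X by (intro mult_left_mono) auto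
      finally have 2: "(1 - r\<^sup>2) ^ j \<le> (2 / X * (1 + y)) ^ j"
        using r by (intro power_mono) (auto simp: power_le_one)
      have "r ^ (2 * n + 1) * (1 - r\<^sup>2) ^ j \<le> A * (1 / (1 + y)) ^ (q + j) * (2 / X * (1 + y)) ^ j"
        using r X y by (intro mult_mono 1 2) (auto simp: power_le_one A_def)
      also have "\<dots> = A * 2 ^ j / X ^ j * (1 / (1 + y)) ^ q"
      proof -
        define z where "z = 1 + y"
        have "z > 0" using y by (simp add: z_def)
        then have "A * (1 / z) ^ (q + j) * (2 / X * z) ^ j = A * 2 ^ j / X ^ j * (1 / z) ^ q"
          by (simp add: power_add power_mult_distrib power_divide)
        then show ?thesis by (simp only: z_def)
      qed
      finally show "r ^ (2 * n + 1) * (1 - r\<^sup>2) ^ j \<le> A * 2 ^ j / X ^ j * (1 / (1 + X * (1 - r))) ^ q"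
        by (simp only: y_def)
    qed
    also have "\<dots> \<le> A * 2 ^ j / X ^ j * (D * tail (1 - 1 / X))"
      unfolding integral_mult_right_zero using D(2)[OF X] X by (intro mult_left_mono) (auto simp: A_def)
    finally have "(\<integral>r. r ^ (2 * n + 1) * (1 - r\<^sup>2) ^ j \<partial>\<mu>) \<le> A * 2 ^ j / X ^ j * (D * tail (1 - 1 / X))" .
    then show "\<bar>(fdiff ^^ j) odd_moment n\<bar> \<le> 2 * A * 2 ^ j * D * tail (1 - 1 / real (Suc n)) / real (Suc n) ^ j"
      using nonneg by (simp add: fdiff_odd_moment abs_mult X_def del: of_nat_Suc)
  qed (use D in \<open>simp add: A_def\<close>)
qed

text \<open>Since \<open>odd_moment n\<close> is comparable to
  \<open>tail (1 - 1 / real (Suc n))\<close>, the bounds for its differences are symbol bounds of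
  its own size, and \<open>symbol_bound_inverse\<close> passes them to the reciprocal.
  \<open>kernel.series\<close> is the function \<open>K\<close> of the overview.\<close>

sublocale kernel: smooth_increasing "\<lambda>n. 1 / odd_moment n"
proof
  show "0 < 1 / odd_moment n" for n using odd_moment_pos[of n] by simp
  have dec: "decseq odd_moment"
    unfolding decseq_def odd_moment_eq by (auto intro!: moment_antimono)
  then show "incseq (\<lambda>n. 1 / odd_moment n)"
    by (auto simp: incseq_def decseq_def intro!: divide_left_mono odd_moment_pos mult_pos_pos)
  have ge: "tail (1 - 1 / real (Suc n)) \<le> C * exp 2 * odd_moment n" for n
    using odd_moment_ge_tail[of n] C_ge_1 by (simp add: exp_minus field_simps)
  have B: "\<exists>B. \<forall>n. odd_moment n \<le> B * odd_moment (Suc n)"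
  proof -
    obtain D where D: "D > 0" "\<And>n. \<bar>odd_moment n\<bar> \<le> D * tail (1 - 1 / real (Suc n))"
      using fdiff_odd_moment_bound[of 0] by auto
    have "odd_moment n \<le> D * C * C * exp 2 * odd_moment (Suc n)" for n
    proof -
      have "odd_moment n \<le> D * tail (1 - 1 / real (Suc n))" using D(2)[of n] by linarith
      also have "\<dots> \<le> D * (C * tail ((1 + (1 - 1 / real (Suc n))) / 2))"
        using D(1) by (intro mult_left_mono doubling) auto
      \<comment> \<open>One doubling step reaches \<open>1 - 1 / (2 * n + 2)\<close>, which already
        lies beyond \<open>1 - 1 / (n + 2)\<close>.\<close>
      also have "\<dots> \<le> D * (C * tail (1 - 1 / real (Suc (Suc n))))"
        using D(1) C_ge_1 by (intro mult_left_mono tail_antimono) (auto simp: field_simps)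
      also have "\<dots> \<le> D * (C * (C * exp 2 * odd_moment (Suc n)))"
        using D(1) C_ge_1 by (intro mult_left_mono ge) auto
      finally show ?thesis by (simp add: mult_ac)
    qed
    then show ?thesis by blast
  qed
  then obtain B where B: "\<And>n. odd_moment n \<le> B * odd_moment (Suc n)" by blast
  fix k
  have "symbol_bound k odd_moment odd_moment"
    unfolding symbol_bound_def
  proof (intro allI impI)
    fix j
    obtain D where D: "D > 0" "\<And>n. \<bar>(fdiff ^^ j) odd_moment n\<bar> \<le> D * tail (1 - 1 / real (Suc n)) / real (Suc n) ^ j"
      using fdiff_odd_moment_bound by blast
    have "\<bar>(fdiff ^^ j) odd_moment n\<bar> \<le> (D * (C * exp 2)) * odd_moment n / real (Suc n) ^ j" for n
    proof -
      have "D * tail (1 - 1 / real (Suc n)) / real (Suc n) ^ j \<le> D * (C * exp 2 * odd_moment n) / real (Suc n) ^ j"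
        using D(1) by (intro divide_right_mono mult_left_mono ge) auto
      then show ?thesis using D(2)[of n] by (simp add: mult_ac)
    qed
    then show "\<exists>C. \<forall>n. \<bar>(fdiff ^^ j) odd_moment n\<bar> \<le> C * odd_moment n / real (Suc n) ^ j" by blast
  qed
  then show "symbol_bound k (\<lambda>n. 1 / odd_moment n) (\<lambda>n. 1 / odd_moment n)"
    using odd_moment_pos dec B by (intro symbol_bound_inverse) auto
qed

text \<open>The integer part \<open>M\<close> of \<open>1 / d\<close> satisfies
  \<open>real (Suc M) \<le> 2 / d\<close>, whence the argument \<open>1 - d / 2\<close>. Since
  \<open>d < 2\<close>, halving also keeps this argument in the open unit interval.\<close>

theorem kernel_upper:
  obtains D where "D > 0" "\<And>w. norm w < 1 \<Longrightarrow>
    norm (kernel.series w) \<le> D / (norm (1 - w) * tail (1 - norm (1 - w) / 2))"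
proof -
  obtain D where D: "D > 0" "\<And>w. norm w < 1 \<Longrightarrow>
    norm (kernel.series w) \<le> D * (1 / odd_moment (nat \<lfloor>1 / norm (1 - w)\<rfloor>)) / norm (1 - w)"
    using kernel.series_upper by blast
  show thesis
  proof (rule that[of "D * C * exp 2"])
    show "D * C * exp 2 > 0" using D C_ge_1 by simp
    fix w :: complex assume w: "norm w < 1"
    define d where "d = norm (1 - w)"
    have d: "d > 0" "d < 2" using w norm_triangle_ineq4[of 1 w] by (auto simp: d_def)
    define M where "M = nat \<lfloor>1 / d\<rfloor>"
    have "real M \<le> 1 / d" using d by (auto simp: M_def)
    have "real (Suc M) \<le> 2 / d"
    proof (cases M)
      case 0
      then show ?thesis using d by (simp add: field_simps)
    next
      case (Suc m)
      then have "real (Suc M) \<le> 2 * real M" by simp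
      also have "\<dots> \<le> 2 * (1 / d)" using \<open>real M \<le> 1 / d\<close> by (intro mult_left_mono) auto
      finally show ?thesis by simp
    qed
    then have "1 - 1 / real (Suc M) \<le> 1 - d / 2" using d by (simp add: field_simps)
    then have "tail (1 - d / 2) \<le> tail (1 - 1 / real (Suc M))" by (rule tail_antimono)
    also have "\<dots> \<le> C * exp 2 * odd_moment M"
      using odd_moment_ge_tail[of M] C_ge_1 by (simp add: exp_minus field_simps)
    finally have "1 / odd_moment M \<le> C * exp 2 / tail (1 - d / 2)"
      using tail_pos[of "1 - d / 2"] d odd_moment_pos[of M] by (simp add: field_simps)
    then have "D * (1 / odd_moment M) / d \<le> D * (C * exp 2 / tail (1 - d / 2)) / d"
      using D(1) d by (intro divide_right_mono mult_left_mono) auto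
    then show "norm (kernel.series w) \<le> D * C * exp 2 / (norm (1 - w) * tail (1 - norm (1 - w) / 2))"
      using D(2)[OF w] by (simp add: d_def M_def mult_ac)
  qed
qed

text \<open>Here \<open>1 / (1 - u) \<le> real (Suc M)\<close>, so \<open>tail u\<close> dominates
  the tail at \<open>1 - 1 / real (Suc M)\<close> and with it, up to \<open>D\<close>, the
  moment.\<close>

theorem kernel_lower:
  obtains c \<epsilon> where "c > 0" "\<epsilon> > 0"
    "\<And>u e. 0 \<le> u \<Longrightarrow> u < 1 \<Longrightarrow> norm e = 1 \<Longrightarrow> norm (e - 1) \<le> \<epsilon> * (1 - u) \<Longrightarrow>
      c / ((1 - u) * tail u) \<le> norm (kernel.series (of_real u * e))"
proof -
  obtain c \<epsilon> where c: "c > 0" "\<epsilon> > 0" "\<And>u e. 0 \<le> u \<Longrightarrow> u < 1 \<Longrightarrow> norm e = 1 \<Longrightarrow> norm (e - 1) \<le> \<epsilon> * (1 - u) \<Longrightarrow>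
    c * (1 / odd_moment (nat \<lfloor>1 / (1 - u)\<rfloor>)) / (1 - u) \<le> norm (kernel.series (of_real u * e))"
    using kernel.series_lower by metis
  obtain D where D: "D > 0" "\<And>n. \<bar>odd_moment n\<bar> \<le> D * tail (1 - 1 / real (Suc n))"
    using fdiff_odd_moment_bound[of 0] by auto
  show thesis
  proof (rule that[of "c / D" \<epsilon>])
    show "c / D > 0" using c D by simp
    fix u :: real and e :: complex
    assume u: "0 \<le> u" "u < 1" and e: "norm e = 1" "norm (e - 1) \<le> \<epsilon> * (1 - u)"
    define M where "M = nat \<lfloor>1 / (1 - u)\<rfloor>"
    have "1 / (1 - u) \<le> real (Suc M)" using u by (auto simp: M_def) linarith
    then have "u \<le> 1 - 1 / real (Suc M)" using u by (simp add: field_simps)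
    then have "tail (1 - 1 / real (Suc M)) \<le> tail u" by (rule tail_antimono)
    then have "odd_moment M \<le> D * tail u"
      using D(2)[of M] D(1) by (meson abs_le_D1 mult_left_mono less_imp_le order_trans)
    then have "1 / (D * tail u) \<le> 1 / odd_moment M"
      using odd_moment_pos[of M] D(1) by (intro divide_left_mono mult_pos_pos tail_pos u) auto
    then have "c * (1 / (D * tail u)) / (1 - u) \<le> c * (1 / odd_moment M) / (1 - u)"
      using c u by (intro divide_right_mono mult_left_mono) auto
    also have "\<dots> \<le> norm (kernel.series (of_real u * e))" unfolding M_def by (rule c(3)[OF u e])
    finally show "c / D / ((1 - u) * tail u) \<le> norm (kernel.series (of_real u * e))" by (simp add: mult_ac)
  qed (rule c)
qed

end

section \<open>Area integrals in polar form\<close>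

lemma measurable_Complex [measurable (raw)]:
  assumes [measurable]: "f \<in> borel_measurable M" "g \<in> borel_measurable M"
  shows "(\<lambda>x. Complex (f x) (g x)) \<in> borel_measurable M"
  unfolding Complex_eq by measurable

text \<open>Opens the plane to Fubini; agreement on boxes determines Lebesgue measure.\<close>

lemma lborel_complex_eq_distr:
  "lborel = distr (lborel \<Otimes>\<^sub>M lborel) borel (\<lambda>p. Complex (fst p) (snd p))"
proof (rule lborel_eqI)
  fix l u :: complex assume le: "\<And>b. b \<in> Basis \<Longrightarrow> l \<bullet> b \<le> u \<bullet> b"
  have le': "Re l \<le> Re u" "Im l \<le> Im u" using le[of 1] le[of \<i>] by (auto simp: Basis_complex_def)
  have "emeasure (distr (lborel \<Otimes>\<^sub>M lborel) borel (\<lambda>p. Complex (fst p) (snd p))) (box l u)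
     = emeasure (lborel \<Otimes>\<^sub>M lborel) ({Re l<..<Re u} \<times> {Im l<..<Im u})"
    by (subst emeasure_distr) (auto simp: in_box_complex_iff space_pair_measure intro!: arg_cong2[where f = emeasure])
  also have "\<dots> = ennreal (Re u - Re l) * ennreal (Im u - Im l)"
    using le' by (subst lborel.emeasure_pair_measure_Times) auto
  also have "\<dots> = ennreal (\<Prod>b\<in>Basis. (u - l) \<bullet> b)"
    using le' by (simp add: Basis_complex_def ennreal_mult'')
  finally show "emeasure (distr (lborel \<Otimes>\<^sub>M lborel) borel (\<lambda>p. Complex (fst p) (snd p))) (box l u)
     = ennreal (\<Prod>b\<in>Basis. (u - l) \<bullet> b)" .
qed simp

lemma nn_integral_complex:
  assumes [measurable]: "F \<in> borel_measurable borel"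
  shows "(\<integral>\<^sup>+\<zeta>. F \<zeta> \<partial>lborel) = (\<integral>\<^sup>+x. \<integral>\<^sup>+y. F (Complex x y) \<partial>lborel \<partial>lborel)"
  by (subst lborel_complex_eq_distr, subst nn_integral_distr, simp_all)
     (subst lborel.nn_integral_fst[symmetric], simp_all)

lemma nn_integral_shear_snd:
  assumes [measurable]: "case_prod F \<in> borel_measurable (borel \<Otimes>\<^sub>M borel)"
  shows "(\<integral>\<^sup>+x. \<integral>\<^sup>+y. F x (y + a * x) \<partial>lborel \<partial>lborel) = (\<integral>\<^sup>+x. \<integral>\<^sup>+y. F x y \<partial>lborel \<partial>(lborel :: real measure))"
proof (rule nn_integral_cong)
  fix x :: real
  have "(\<integral>\<^sup>+y. F x y \<partial>lborel) = ennreal \<bar>1\<bar> * (\<integral>\<^sup>+y. F x (a * x + 1 * y) \<partial>lborel)"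
    by (rule nn_integral_real_affine) auto
  then show "(\<integral>\<^sup>+y. F x (y + a * x) \<partial>lborel) = (\<integral>\<^sup>+y. F x y \<partial>lborel)" by (simp add: add.commute)
qed

lemma nn_integral_shear_fst:
  assumes [measurable]: "case_prod F \<in> borel_measurable (borel \<Otimes>\<^sub>M borel)"
  shows "(\<integral>\<^sup>+x. \<integral>\<^sup>+y. F (x + a * y) y \<partial>lborel \<partial>lborel) = (\<integral>\<^sup>+x. \<integral>\<^sup>+y. F x y \<partial>lborel \<partial>(lborel :: real measure))"
proof -
  have "(\<integral>\<^sup>+x. \<integral>\<^sup>+y. F (x + a * y) y \<partial>lborel \<partial>lborel) = (\<integral>\<^sup>+y. \<integral>\<^sup>+x. F (x + a * y) y \<partial>lborel \<partial>lborel)"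
    by (rule lborel_pair.Fubini') simp
  also have "\<dots> = (\<integral>\<^sup>+y. \<integral>\<^sup>+x. F x y \<partial>lborel \<partial>lborel)"
    by (rule nn_integral_shear_snd) simp
  also have "\<dots> = (\<integral>\<^sup>+x. \<integral>\<^sup>+y. F x y \<partial>lborel \<partial>lborel)"
    by (rule lborel_pair.Fubini') simp
  finally show ?thesis .
qed

lemma nn_integral_complex_uminus:
  fixes F :: "complex \<Rightarrow> ennreal"
  assumes [measurable]: "F \<in> borel_measurable borel"
  shows "(\<integral>\<^sup>+\<zeta>. F (- \<zeta>) \<partial>lborel) = (\<integral>\<^sup>+\<zeta>. F \<zeta> \<partial>lborel)"
proof -
  have "(\<integral>\<^sup>+\<zeta>. F \<zeta> \<partial>lborel) = (\<integral>\<^sup>+x. \<integral>\<^sup>+y. F (Complex x y) \<partial>lborel \<partial>lborel)"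
    by (rule nn_integral_complex) simp
  also have "\<dots> = (\<integral>\<^sup>+x. \<integral>\<^sup>+y. F (Complex (- x) y) \<partial>lborel \<partial>lborel)"
    by (subst nn_integral_real_affine[where c="-1" and t=0]) auto
  also have "\<dots> = (\<integral>\<^sup>+x. \<integral>\<^sup>+y. F (Complex (- x) (- y)) \<partial>lborel \<partial>lborel)"
  proof (rule nn_integral_cong)
    fix x :: real
    show "(\<integral>\<^sup>+y. F (Complex (- x) y) \<partial>lborel) = (\<integral>\<^sup>+y. F (Complex (- x) (- y)) \<partial>lborel)"
      by (subst nn_integral_real_affine[where c="-1" and t=0]) auto
  qed
  also have "\<dots> = (\<integral>\<^sup>+\<zeta>. F (- \<zeta>) \<partial>lborel)"
    by (subst nn_integral_complex) (simp_all add: complex_minus)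
  finally show ?thesis by simp
qed

text \<open>A rotation that is not \<open>\<plusminus>1\<close> is a product of three shears.\<close>

lemma nn_integral_complex_rotate:
  fixes e :: complex
  assumes [measurable]: "F \<in> borel_measurable borel" and e: "norm e = 1"
  shows "(\<integral>\<^sup>+\<zeta>. F (e * \<zeta>) \<partial>lborel) = (\<integral>\<^sup>+\<zeta>. F \<zeta> \<partial>lborel)"
proof (cases "Im e = 0")
  case True
  then have "e = 1 \<or> e = -1" using e by (auto simp: cmod_def complex_eq_iff abs_if split: if_splits)
  then show ?thesis using nn_integral_complex_uminus[of F] by auto
next
  case False
  \<comment> \<open>If \<open>e\<close> has argument \<theta>, then \<open>a\<close> is
    \<open>- tan (\<theta> / 2)\<close>; the shears have parameters \<open>a\<close>,
    \<open>s\<close>, \<open>a\<close>.\<close>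
  define c s a where "c = Re e" and "s = Im e" and "a = (c - 1) / s"
  have s: "s \<noteq> 0" using False by (simp add: s_def)
  have "c\<^sup>2 + s\<^sup>2 = 1" using e by (simp add: cmod_def c_def s_def)
  then have cs: "a * (1 + c) = - s" "1 + a * s = c"
    using s by (simp_all add: a_def field_simps power2_eq_square)
  have eq: "e * Complex x y = Complex (x + a * y + a * (y + s * (x + a * y))) (y + s * (x + a * y))" for x y
  proof -
    have "y + s * (x + a * y) = s * x + (1 + a * s) * y" by (simp add: algebra_simps)
    then have im: "y + s * (x + a * y) = s * x + c * y" by (simp only: cs)
    have "x + a * y + a * (s * x + c * y) = (1 + a * s) * x + (a * (1 + c)) * y" by (simp add: algebra_simps)
    then have re: "x + a * y + a * (s * x + c * y) = c * x - s * y" by (simp only: cs)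
    show ?thesis unfolding im re by (simp add: complex_eq_iff c_def s_def)
  qed
  have "(\<integral>\<^sup>+\<zeta>. F (e * \<zeta>) \<partial>lborel) = (\<integral>\<^sup>+x. \<integral>\<^sup>+y. F (e * Complex x y) \<partial>lborel \<partial>lborel)"
    by (rule nn_integral_complex) simp
  also have "\<dots> = (\<integral>\<^sup>+x. \<integral>\<^sup>+y. (\<lambda>x y. F (Complex (x + a * (y + s * x)) (y + s * x))) (x + a * y) y \<partial>lborel \<partial>lborel)"
    by (simp only: eq)
  also have "\<dots> = (\<integral>\<^sup>+x. \<integral>\<^sup>+y. (\<lambda>x y. F (Complex (x + a * y) y)) x (y + s * x) \<partial>lborel \<partial>lborel)"
    by (rule nn_integral_shear_fst) simp
  also have "\<dots> = (\<integral>\<^sup>+x. \<integral>\<^sup>+y. (\<lambda>x y. F (Complex x y)) (x + a * y) y \<partial>lborel \<partial>lborel)"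
    by (rule nn_integral_shear_snd) simp
  also have "\<dots> = (\<integral>\<^sup>+x. \<integral>\<^sup>+y. F (Complex x y) \<partial>lborel \<partial>lborel)"
    by (rule nn_integral_shear_fst) simp
  also have "\<dots> = (\<integral>\<^sup>+\<zeta>. F \<zeta> \<partial>lborel)"
    by (rule nn_integral_complex[symmetric]) simp
  finally show ?thesis .
qed

text \<open>The right half of the unit circle, parametrised by the slope \<open>\<tau>\<close>: in the coordinates \<open>(r, \<tau>)\<close> polar
  integration only needs linear substitutions, and the arc length is \<open>d\<tau> / (1 + \<tau>\<^sup>2)\<close>.\<close>

definition unit_dir :: "real \<Rightarrow> complex" where
  "unit_dir \<tau> = Complex (1 / sqrt (1 + \<tau>\<^sup>2)) (\<tau> / sqrt (1 + \<tau>\<^sup>2))"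

lemma one_plus_square_pos: "0 < 1 + (\<tau>::real)\<^sup>2"
  by (simp add: add_pos_nonneg)

lemma norm_unit_dir [simp]: "norm (unit_dir \<tau>) = 1"
  using one_plus_square_pos[of \<tau>]
  by (simp add: unit_dir_def cmod_def power_divide flip: add_divide_distrib)

lemma unit_dir_measurable [measurable]: "unit_dir \<in> borel_measurable borel"
  unfolding unit_dir_def[abs_def] by measurable

text \<open>Two linear substitutions: \<open>y = x * \<tau>\<close> at fixed \<open>x\<close> with
  Jacobian \<open>x\<close>, then \<open>x = q * r\<close> at fixed \<tau>, where \<open>q\<close>
  is the cosine of the direction. Together they give
  \<open>q * (q * r) = r / (1 + \<tau>\<^sup>2)\<close>.\<close>

lemma nn_integral_half_plane_polar:
  assumes [measurable]: "F \<in> borel_measurable borel"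
  shows "(\<integral>\<^sup>+\<zeta>. F \<zeta> * indicator {\<zeta>. 0 < Re \<zeta>} \<zeta> \<partial>lborel) =
    (\<integral>\<^sup>+r. \<integral>\<^sup>+\<tau>. ennreal (r / (1 + \<tau>\<^sup>2)) * F (of_real r * unit_dir \<tau>) * indicator {0<..} r \<partial>lborel \<partial>lborel)"
proof -
  have "(\<integral>\<^sup>+\<zeta>. F \<zeta> * indicator {\<zeta>. 0 < Re \<zeta>} \<zeta> \<partial>lborel)
      = (\<integral>\<^sup>+x. \<integral>\<^sup>+y. F (Complex x y) * indicator {0<..} x \<partial>lborel \<partial>lborel)"
    by (subst nn_integral_complex) (auto intro!: nn_integral_cong split: split_indicator)
  also have "\<dots> = (\<integral>\<^sup>+x. \<integral>\<^sup>+\<tau>. ennreal x * F (Complex x (x * \<tau>)) * indicator {0<..} x \<partial>lborel \<partial>lborel)"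
  proof (rule nn_integral_cong)
    fix x :: real
    show "(\<integral>\<^sup>+y. F (Complex x y) * indicator {0<..} x \<partial>lborel)
       = (\<integral>\<^sup>+\<tau>. ennreal x * F (Complex x (x * \<tau>)) * indicator {0<..} x \<partial>lborel)"
    proof (cases "0 < x")
      case True
      then show ?thesis
        by (subst nn_integral_real_affine[where c = x and t = 0]) (auto simp: nn_integral_cmult)
    qed simp
  qed
  also have "\<dots> = (\<integral>\<^sup>+\<tau>. \<integral>\<^sup>+x. ennreal x * F (Complex x (x * \<tau>)) * indicator {0<..} x \<partial>lborel \<partial>lborel)"
    by (rule lborel_pair.Fubini') simp
  also have "\<dots> = (\<integral>\<^sup>+\<tau>. \<integral>\<^sup>+r. ennreal (r / (1 + \<tau>\<^sup>2)) * F (of_real r * unit_dir \<tau>) * indicator {0<..} r \<partial>lborel \<partial>lborel)"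
  proof (rule nn_integral_cong)
    fix \<tau> :: real
    define q where "q = 1 / sqrt (1 + \<tau>\<^sup>2)"
    have q: "q > 0" "q * q = 1 / (1 + \<tau>\<^sup>2)" using one_plus_square_pos[of \<tau>] by (auto simp: q_def)
    have dir: "Complex (q * r) (q * r * \<tau>) = of_real r * unit_dir \<tau>" for r
      by (simp add: complex_eq_iff unit_dir_def q_def)
    have "(\<integral>\<^sup>+x. ennreal x * F (Complex x (x * \<tau>)) * indicator {0<..} x \<partial>lborel)
       = ennreal q * (\<integral>\<^sup>+r. ennreal (q * r) * F (Complex (q * r) (q * r * \<tau>)) * indicator {0<..} (q * r) \<partial>lborel)"
      using q(1) by (subst nn_integral_real_affine[where c = q and t = 0]) auto
    also have "\<dots> = (\<integral>\<^sup>+r. ennreal q * (ennreal (q * r) * F (Complex (q * r) (q * r * \<tau>)) * indicator {0<..} (q * r)) \<partial>lborel)"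
      by (rule nn_integral_cmult[symmetric]) simp
    also have "\<dots> = (\<integral>\<^sup>+r. ennreal (r / (1 + \<tau>\<^sup>2)) * F (of_real r * unit_dir \<tau>) * indicator {0<..} r \<partial>lborel)"
    proof (rule nn_integral_cong)
      fix r
      have "ennreal q * ennreal (q * r) = ennreal (r / (1 + \<tau>\<^sup>2))" if "r > 0"
        using q that by (simp add: mult.assoc[symmetric] flip: ennreal_mult)
      moreover have "0 < q * r \<longleftrightarrow> 0 < r" using q(1) by (simp add: zero_less_mult_iff)
      ultimately show "ennreal q * (ennreal (q * r) * F (Complex (q * r) (q * r * \<tau>)) * indicator {0<..} (q * r))
        = ennreal (r / (1 + \<tau>\<^sup>2)) * F (of_real r * unit_dir \<tau>) * indicator {0<..} r"
        by (auto simp: dir mult.assoc[symmetric] split: split_indicator)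
    qed
    finally show "(\<integral>\<^sup>+x. ennreal x * F (Complex x (x * \<tau>)) * indicator {0<..} x \<partial>lborel)
       = (\<integral>\<^sup>+r. ennreal (r / (1 + \<tau>\<^sup>2)) * F (of_real r * unit_dir \<tau>) * indicator {0<..} r \<partial>lborel)" .
  qed
  also have "\<dots> = (\<integral>\<^sup>+r. \<integral>\<^sup>+\<tau>. ennreal (r / (1 + \<tau>\<^sup>2)) * F (of_real r * unit_dir \<tau>) * indicator {0<..} r \<partial>lborel \<partial>lborel)"
    by (rule lborel_pair.Fubini') simp
  finally show ?thesis .
qed

lemma AE_lborel_Re_nonzero: "AE \<zeta> in lborel. Re \<zeta> \<noteq> 0"
proof (rule AE_I)
  show "{\<zeta> \<in> space lborel. \<not> Re \<zeta> \<noteq> 0} \<subseteq> {\<zeta>. Re \<zeta> = 0}" by auto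
  have "emeasure lborel {\<zeta>. Re \<zeta> = 0} = (\<integral>\<^sup>+\<zeta>. indicator {\<zeta>. Re \<zeta> = 0} \<zeta> \<partial>lborel)" by simp
  also have "\<dots> = (\<integral>\<^sup>+(x::real). \<integral>\<^sup>+y. indicator {0} x \<partial>(lborel::real measure) \<partial>lborel)"
    by (subst nn_integral_complex) (simp, simp only: indicator_def mem_Collect_eq complex.sel singleton_iff)
  also have "\<dots> = 0" by (simp add: nn_integral_multc mult.commute)
  finally show "emeasure lborel {\<zeta>. Re \<zeta> = 0} = 0" .
qed simp

text \<open>The imaginary axis is null, and the left half plane is carried to the right one by
  reflection in the origin; hence the two values of \<open>F\<close> per direction.\<close>

theorem nn_integral_polar:
  assumes [measurable]: "F \<in> borel_measurable borel"
  shows "(\<integral>\<^sup>+\<zeta>. F \<zeta> \<partial>lborel) =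
    (\<integral>\<^sup>+r. (\<integral>\<^sup>+\<tau>. ennreal (r / (1 + \<tau>\<^sup>2)) * (F (of_real r * unit_dir \<tau>) + F (- of_real r * unit_dir \<tau>)) \<partial>lborel)
       * indicator {0<..} r \<partial>lborel)"
proof -
  have "(\<integral>\<^sup>+\<zeta>. F \<zeta> \<partial>lborel) = (\<integral>\<^sup>+\<zeta>. F \<zeta> * indicator {\<zeta>. 0 < Re \<zeta>} \<zeta> + F \<zeta> * indicator {\<zeta>. Re \<zeta> < 0} \<zeta> \<partial>lborel)"
    by (intro nn_integral_cong_AE eventually_mono[OF AE_lborel_Re_nonzero]) (auto split: split_indicator)
  also have "\<dots> = (\<integral>\<^sup>+\<zeta>. F \<zeta> * indicator {\<zeta>. 0 < Re \<zeta>} \<zeta> \<partial>lborel) + (\<integral>\<^sup>+\<zeta>. F \<zeta> * indicator {\<zeta>. Re \<zeta> < 0} \<zeta> \<partial>lborel)"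
    by (rule nn_integral_add) simp_all
  also have "(\<integral>\<^sup>+\<zeta>. F \<zeta> * indicator {\<zeta>. Re \<zeta> < 0} \<zeta> \<partial>lborel) = (\<integral>\<^sup>+\<zeta>. F (- \<zeta>) * indicator {\<zeta>. 0 < Re \<zeta>} \<zeta> \<partial>lborel)"
    by (subst nn_integral_complex_uminus[symmetric]) (auto intro!: nn_integral_cong split: split_indicator)
  also have "(\<integral>\<^sup>+\<zeta>. F \<zeta> * indicator {\<zeta>. 0 < Re \<zeta>} \<zeta> \<partial>lborel) + \<dots> = (\<integral>\<^sup>+\<zeta>. (F \<zeta> + F (- \<zeta>)) * indicator {\<zeta>. 0 < Re \<zeta>} \<zeta> \<partial>lborel)"
    by (subst nn_integral_add[symmetric]) (auto simp: distrib_right)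
  also have "\<dots> = (\<integral>\<^sup>+r. \<integral>\<^sup>+\<tau>. ennreal (r / (1 + \<tau>\<^sup>2)) * (F (of_real r * unit_dir \<tau>) + F (- (of_real r * unit_dir \<tau>))) * indicator {0<..} r \<partial>lborel \<partial>lborel)"
    by (rule nn_integral_half_plane_polar) simp
  finally show ?thesis by (simp add: nn_integral_multc)
qed

section \<open>Integrals over circles\<close>

lemma nn_integral_inverse_one_plus_square: "(\<integral>\<^sup>+\<tau>. ennreal (1 / (1 + \<tau>\<^sup>2)) \<partial>lborel) = ennreal pi"
proof -
  have half: "(\<integral>\<^sup>+\<tau>. ennreal (1 / (1 + \<tau>\<^sup>2)) * indicator {0..} \<tau> \<partial>lborel) = ennreal (pi / 2)"
  proof -
    have "DERIV arctan x :> 1 / (1 + x\<^sup>2)" for x using DERIV_arctan[of x] by (simp add: inverse_eq_divide)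
    then show ?thesis
      using nn_integral_FTC_atLeast[of "\<lambda>\<tau>. 1 / (1 + \<tau>\<^sup>2)" 0 arctan "pi / 2"]
      by (simp add: tendsto_arctan_at_top)
  qed
  have "(\<integral>\<^sup>+\<tau>. ennreal (1 / (1 + \<tau>\<^sup>2)) \<partial>lborel) =
      (\<integral>\<^sup>+\<tau>. ennreal (1 / (1 + \<tau>\<^sup>2)) * indicator {0..} \<tau> + ennreal (1 / (1 + \<tau>\<^sup>2)) * indicator {..<0} \<tau> \<partial>lborel)"
    by (intro nn_integral_cong) (auto split: split_indicator)
  also have "\<dots> = ennreal (pi / 2) + (\<integral>\<^sup>+\<tau>. ennreal (1 / (1 + \<tau>\<^sup>2)) * indicator {..<0} \<tau> \<partial>lborel)"
    by (subst nn_integral_add) (auto simp: half)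
  also have "(\<integral>\<^sup>+\<tau>. ennreal (1 / (1 + \<tau>\<^sup>2)) * indicator {..<0} \<tau> \<partial>lborel)
      = (\<integral>\<^sup>+\<tau>. ennreal (1 / (1 + \<tau>\<^sup>2)) * indicator {0<..} \<tau> \<partial>lborel)"
    by (subst nn_integral_real_affine[where c = "-1" and t = 0])
       (auto intro!: nn_integral_cong split: split_indicator)
  also have "\<dots> = (\<integral>\<^sup>+\<tau>. ennreal (1 / (1 + \<tau>\<^sup>2)) * indicator {0..} \<tau> \<partial>lborel)"
    by (intro nn_integral_cong_AE eventually_mono[OF AE_lborel_singleton[of 0]]) (auto split: split_indicator)
  finally show ?thesis by (simp add: half flip: ennreal_plus)
qed

text \<open>The two halves of the interval each substitute
  \<open>t = u - \<bar>\<tau>\<bar>\<close>. The point \<open>0\<close> is counted twice, which an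
  upper bound may ignore.\<close>

lemma nn_integral_abs_reflect:
  fixes f :: "real \<Rightarrow> ennreal"
  assumes [measurable]: "f \<in> borel_measurable borel"
  shows "(\<integral>\<^sup>+\<tau>. f (u - \<bar>\<tau>\<bar>) * indicator {-u..u} \<tau> \<partial>lborel) \<le> 2 * (\<integral>\<^sup>+t. f t * indicator {0..u} t \<partial>lborel)"
proof -
  have "(\<integral>\<^sup>+\<tau>. f (u - \<bar>\<tau>\<bar>) * indicator {-u..u} \<tau> \<partial>lborel)
      \<le> (\<integral>\<^sup>+\<tau>. f (u - \<tau>) * indicator {0..u} (u - \<tau>) + f (u + \<tau>) * indicator {0..u} (u + \<tau>) \<partial>lborel)"
    by (intro nn_integral_mono) (auto split: split_indicator)
  also have "\<dots> = (\<integral>\<^sup>+\<tau>. f (u - \<tau>) * indicator {0..u} (u - \<tau>) \<partial>lborel) + (\<integral>\<^sup>+\<tau>. f (u + \<tau>) * indicator {0..u} (u + \<tau>) \<partial>lborel)"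
    by (rule nn_integral_add) simp_all
  also have "(\<integral>\<^sup>+\<tau>. f (u - \<tau>) * indicator {0..u} (u - \<tau>) \<partial>lborel) = (\<integral>\<^sup>+t. f t * indicator {0..u} t \<partial>lborel)"
    using nn_integral_real_affine[of "\<lambda>t. f t * indicator {0..u} t" "-1" u] by simp
  also have "(\<integral>\<^sup>+\<tau>. f (u + \<tau>) * indicator {0..u} (u + \<tau>) \<partial>lborel) = (\<integral>\<^sup>+t. f t * indicator {0..u} t \<partial>lborel)"
    using nn_integral_real_affine[of "\<lambda>t. f t * indicator {0..u} t" "1" u] by simp
  finally show ?thesis by (simp add: mult_2)
qed

section \<open>Distance from 1 to the points of a circle\<close>

lemma sqrt_one_plus_square_bounds: "1 \<le> sqrt (1 + \<tau>\<^sup>2)" "sqrt (1 + \<tau>\<^sup>2) \<le> 1 + (\<tau>::real)\<^sup>2 / 2"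
proof -
  show "1 \<le> sqrt (1 + \<tau>\<^sup>2)" by simp
  have "1 + \<tau>\<^sup>2 \<le> (1 + \<tau>\<^sup>2 / 2)\<^sup>2" by (simp add: power2_sum)
  then show "sqrt (1 + \<tau>\<^sup>2) \<le> 1 + \<tau>\<^sup>2 / 2" by (intro real_le_lsqrt) auto
qed

text \<open>With \<open>\<rho> = sqrt (1 + \<tau>\<^sup>2)\<close> the square of the left side is
  \<open>2 - 2 / \<rho> \<le> 2 * (\<rho> - 1) \<le> \<tau>\<^sup>2\<close>.\<close>

lemma norm_unit_dir_minus_one: "norm (unit_dir \<tau> - 1) \<le> \<bar>\<tau>\<bar>"
proof -
  define \<rho> where "\<rho> = sqrt (1 + \<tau>\<^sup>2)"
  have \<rho>: "1 \<le> \<rho>" "\<rho> \<le> 1 + \<tau>\<^sup>2 / 2" "\<rho>\<^sup>2 = 1 + \<tau>\<^sup>2"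
    using sqrt_one_plus_square_bounds[of \<tau>] one_plus_square_pos[of \<tau>] by (auto simp: \<rho>_def)
  have "(norm (unit_dir \<tau> - 1))\<^sup>2 = (1 / \<rho> - 1)\<^sup>2 + (\<tau> / \<rho>)\<^sup>2"
    by (simp add: unit_dir_def cmod_def \<rho>_def)
  also have "\<dots> = (1 + \<tau>\<^sup>2) / \<rho>\<^sup>2 + 1 - 2 / \<rho>"
    by (simp add: power2_diff power_divide add_divide_distrib)
  also have "\<dots> = 2 - 2 / \<rho>" using \<rho>(1) by (simp flip: \<rho>(3))
  also have "\<dots> \<le> 2 * (\<rho> - 1)"
  proof -
    have "0 \<le> (\<rho> - 1)\<^sup>2" by simp
    then have "2 * \<rho> - 2 \<le> 2 * (\<rho> - 1) * \<rho>" by (simp add: power2_eq_square algebra_simps)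
    then show ?thesis using \<rho>(1) by (simp add: field_simps)
  qed
  also have "\<dots> \<le> \<tau>\<^sup>2" using \<rho>(2) by simp
  finally show ?thesis by (rule abs_le_square_iff[THEN iffD2, of "norm (unit_dir \<tau> - 1)" \<tau>, simplified])
qed

lemma dist_unit_dir_upper:
  assumes "0 \<le> u" "u < 1"
  shows "norm (1 - of_real u * unit_dir \<tau>) \<le> 1 - u + \<bar>\<tau>\<bar>"
proof -
  have "1 - of_real u * unit_dir \<tau> = of_real (1 - u) - of_real u * (unit_dir \<tau> - 1)"
    by (simp add: algebra_simps)
  then have "norm (1 - of_real u * unit_dir \<tau>) \<le> norm (of_real (1 - u) :: complex) + norm (of_real u * (unit_dir \<tau> - 1))"
    using norm_triangle_ineq4 by metis
  also have "\<dots> = (1 - u) + u * norm (unit_dir \<tau> - 1)"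
    using assms by (simp add: norm_mult del: of_real_diff)
  also have "\<dots> \<le> (1 - u) + 1 * \<bar>\<tau>\<bar>"
    using assms norm_unit_dir_minus_one[of \<tau>] by (intro add_left_mono mult_mono) auto
  finally show ?thesis by simp
qed

lemma dist_unit_dir_ge:
  assumes "0 \<le> u" "u < 1"
  shows "1 - u \<le> norm (1 - of_real u * unit_dir \<tau>)"
  using norm_triangle_ineq2[of 1 "of_real u * unit_dir \<tau>"] assms by (simp add: norm_mult)

text \<open>For \<open>u \<ge> 1 / 2\<close> the constant is \<open>1 + 3\<close>: the distance
  dominates \<open>1 - u\<close>, and its imaginary part dominates
  \<open>\<bar>\<tau>\<bar> / 3\<close>. For smaller \<open>u\<close> the bound \<open>1 - u\<close>
  alone is enough. Restricting to \<open>\<bar>\<tau>\<bar> \<le> u\<close> keeps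
  \<open>u - \<bar>\<tau>\<bar>\<close> in the range of integration of \<open>g\<close>.\<close>

lemma dist_unit_dir_lower:
  assumes "0 \<le> u" "u < 1" "\<bar>\<tau>\<bar> \<le> u"
  shows "1 - u + \<bar>\<tau>\<bar> \<le> 4 * norm (1 - of_real u * unit_dir \<tau>)"
proof (cases "u < 1 / 2")
  case True
  then show ?thesis using dist_unit_dir_ge[OF assms(1,2), of \<tau>] assms by linarith
next
  case False
  define \<rho> where "\<rho> = sqrt (1 + \<tau>\<^sup>2)"
  have "\<tau>\<^sup>2 \<le> 1" using assms by (simp add: abs_square_le_1)
  then have \<rho>: "1 \<le> \<rho>" "\<rho> \<le> 3 / 2"
    using sqrt_one_plus_square_bounds[of \<tau>] by (auto simp: \<rho>_def)
  have "(1 / 2) * \<bar>\<tau>\<bar> / (3 / 2) \<le> u * \<bar>\<tau>\<bar> / \<rho>"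
    using False \<rho> by (intro frac_le mult_right_mono) auto
  also have "\<dots> = \<bar>Im (1 - of_real u * unit_dir \<tau>)\<bar>"
    using False \<rho> by (simp add: unit_dir_def \<rho>_def abs_mult)
  also have "\<dots> \<le> norm (1 - of_real u * unit_dir \<tau>)" by (rule abs_Im_le_cmod)
  finally show ?thesis using dist_unit_dir_ge[OF assms(1,2), of \<tau>] by simp
qed

lemma dist_unit_dir_far:
  assumes "0 \<le> u" "u < 1" "u < \<bar>\<tau>\<bar>"
  shows "1 / 10 \<le> norm (1 - of_real u * unit_dir \<tau>)"
proof (cases "u < 1 / 2")
  case True
  then show ?thesis using dist_unit_dir_ge[OF assms(1,2), of \<tau>] by linarith
next
  case False
  define \<rho> where "\<rho> = sqrt (1 + \<tau>\<^sup>2)"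
  have "(1 / 2)\<^sup>2 \<le> \<bar>\<tau>\<bar>\<^sup>2" using assms False by (intro power_mono) auto
  \<comment> \<open>\<open>100 / 81 < 5 / 4\<close>; hence the real part of
    \<open>u * unit_dir \<tau>\<close> is at most \<open>9 / 10\<close>.\<close>
  then have "(10 / 9)\<^sup>2 \<le> 1 + \<tau>\<^sup>2" by (simp add: power2_eq_square)
  then have \<rho>: "10 / 9 \<le> \<rho>" unfolding \<rho>_def by (rule real_le_rsqrt)
  have "u * (1 / \<rho>) \<le> 1 * (9 / 10)" using assms \<rho> by (intro mult_mono) (auto simp: field_simps)
  then have "1 / 10 \<le> Re (1 - of_real u * unit_dir \<tau>)"
    by (simp add: unit_dir_def \<rho>_def)
  then show ?thesis using complex_Re_le_cmod order_trans by blast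
qed

lemma dist_unit_dir_opposite:
  assumes "0 \<le> u" "u < 1"
  shows "1 / 10 \<le> norm (1 - (- of_real u * unit_dir \<tau>))"
proof -
  have "1 \<le> Re (1 - (- of_real u * unit_dir \<tau>))" using assms by (simp add: unit_dir_def)
  then show ?thesis using complex_Re_le_cmod[of "1 - (- of_real u * unit_dir \<tau>)"] by linarith
qed

section \<open>Circle means of the weighted kernel\<close>

locale kernel_setting = doubling_measure +
  fixes p :: real and N :: nat
  assumes p: "0 < p" and N: "1 \<le> N"
begin

definition g :: "real \<Rightarrow> real" where
  "g t = ((1 - t) ^ (N - 1) / tail t) powr p"

definition \<Phi> :: "complex \<Rightarrow> real" where
  "\<Phi> w = norm ((1 - w) ^ N * kernel.series w) powr p"

lemma \<Phi>_nonneg [simp]: "0 \<le> \<Phi> w" by (simp add: \<Phi>_def)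

lemma g_nonneg [simp]: "0 \<le> g t" by (simp add: g_def)

lemma tail_measurable [measurable]: "tail \<in> borel_measurable borel"
proof -
  have "(\<lambda>t. - tail t) \<in> borel_measurable borel"
    by (rule borel_measurable_mono) (auto simp: mono_def intro: tail_antimono)
  then show ?thesis by simp
qed

lemma g_measurable [measurable]: "g \<in> borel_measurable borel"
  unfolding g_def by measurable

lemma \<Phi>_measurable [measurable]: "\<Phi> \<in> borel_measurable borel"
  unfolding \<Phi>_def kernel.series_def by measurable

text \<open>The two distance hypotheses play different parts: the factor \<open>a\<close> compares
  the powers of the distance, while \<open>k\<close> doubling steps compare the tails.\<close>

lemma g_comparable:
  assumes "s < 1" "t < 1" "0 \<le> a" "1 - s \<le> a * (1 - t)" "1 - t \<le> 2 ^ k * (1 - s)"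
  shows "g s \<le> (a ^ (N - 1) * C ^ k) powr p * g t"
proof -
  have "(1 - s) ^ (N - 1) \<le> (a * (1 - t)) ^ (N - 1)" using assms by (intro power_mono) auto
  moreover have "tail t \<le> C ^ k * tail s"
  proof -
    have "tail t \<le> tail (1 - 2 ^ k * (1 - s))" using assms by (intro tail_antimono) auto
    also have "\<dots> \<le> C ^ k * tail (1 - (1 - s))" using assms by (intro doubling_power) auto
    finally show ?thesis by simp
  qed
  then have "1 / tail s \<le> C ^ k / tail t"
    using tail_pos[OF assms(1)] tail_pos[OF assms(2)] by (simp add: field_simps)
  ultimately have "(1 - s) ^ (N - 1) * (1 / tail s) \<le> (a * (1 - t)) ^ (N - 1) * (C ^ k / tail t)"
    using assms by (intro mult_mono) auto
  also have "\<dots> = (a ^ (N - 1) * C ^ k) * ((1 - t) ^ (N - 1) / tail t)"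
    by (simp add: power_mult_distrib)
  finally have "g s \<le> ((a ^ (N - 1) * C ^ k) * ((1 - t) ^ (N - 1) / tail t)) powr p"
    unfolding g_def using assms p tail_pos[OF assms(1)] by (intro powr_mono2) auto
  also have "\<dots> = (a ^ (N - 1) * C ^ k) powr p * g t"
    unfolding g_def by (rule powr_mult)
  finally show ?thesis .
qed

lemma g_bounded: "0 \<le> t \<Longrightarrow> t \<le> s \<Longrightarrow> s < 1 \<Longrightarrow> g t \<le> (1 / tail s) powr p"
  unfolding g_def using p
  by (intro powr_mono2 frac_le) (auto intro!: power_le_one tail_pos tail_antimono)

lemma \<Phi>_upper:
  obtains E where "E > 0" "\<And>w. norm w < 1 \<Longrightarrow> \<Phi> w \<le> E * g (1 - norm (1 - w) / 2)"
proof -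
  obtain D where D: "D > 0" "\<And>w. norm w < 1 \<Longrightarrow>
    norm (kernel.series w) \<le> D / (norm (1 - w) * tail (1 - norm (1 - w) / 2))"
    using kernel_upper by blast
  show thesis
  proof (rule that[of "(D * 2 ^ (N - 1)) powr p"])
    fix w :: complex assume w: "norm w < 1"
    define d where "d = norm (1 - w)"
    have d: "d > 0" using w by (auto simp: d_def)
    obtain M where M: "N = Suc M" using N by (cases N) auto
    have "norm ((1 - w) ^ N * kernel.series w) \<le> d ^ N * (D / (d * tail (1 - d / 2)))"
      unfolding norm_mult norm_power d_def using D(2)[OF w] by (intro mult_left_mono) auto
    also have "\<dots> = (D * 2 ^ (N - 1)) * ((1 - (1 - d / 2)) ^ (N - 1) / tail (1 - d / 2))"
      using d by (simp add: M power_divide)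
    finally have "\<Phi> w \<le> ((D * 2 ^ (N - 1)) * ((1 - (1 - d / 2)) ^ (N - 1) / tail (1 - d / 2))) powr p"
      unfolding \<Phi>_def using p by (intro powr_mono2) auto
    also have "\<dots> = (D * 2 ^ (N - 1)) powr p * g (1 - d / 2)"
      unfolding g_def by (rule powr_mult)
    finally show "\<Phi> w \<le> (D * 2 ^ (N - 1)) powr p * g (1 - norm (1 - w) / 2)" by (simp only: d_def)
  qed (use D in simp)
qed

text \<open>The integral of \<Phi> over the whole circle of radius \<open>u\<close> with respect to
  the angle, written in the slope coordinate with opposite points paired.\<close>

definition angular :: "real \<Rightarrow> ennreal" where
  "angular u = (\<integral>\<^sup>+\<tau>. ennreal (1 / (1 + \<tau>\<^sup>2)) *
     (ennreal (\<Phi> (of_real u * unit_dir \<tau>)) + ennreal (\<Phi> (- of_real u * unit_dir \<tau>))) \<partial>lborel)"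

lemma angular_measurable [measurable]: "angular \<in> borel_measurable borel"
  unfolding angular_def by measurable

text \<open>For \<open>\<bar>\<tau>\<bar> \<le> u\<close> the distance to \<open>1\<close> is
  comparable to \<open>1 - (u - \<bar>\<tau>\<bar>)\<close>, so the substitution
  \<open>t = u - \<bar>\<tau>\<bar>\<close> produces the integral of \<open>g\<close>. Elsewhere on
  the circle the distance is at least \<open>1 / 10\<close> and \<Phi> is bounded.\<close>

lemma angular_upper:
  obtains B where "B > 0" "\<And>u. 0 \<le> u \<Longrightarrow> u < 1 \<Longrightarrow>
    angular u \<le> ennreal B * (1 + (\<integral>\<^sup>+t. ennreal (g t) * indicator {0..u} t \<partial>lborel))"
proof -
  obtain E where E: "E > 0" "\<And>w. norm w < 1 \<Longrightarrow> \<Phi> w \<le> E * g (1 - norm (1 - w) / 2)"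
    using \<Phi>_upper by blast
  \<comment> \<open>The exponent \<open>3\<close> comes from
    \<open>1 - u + \<bar>\<tau>\<bar> \<le> 4 * d = 2 ^ 3 * (d / 2)\<close>; in \<open>E2\<close>,
    \<open>19 / 20\<close> is \<open>1 - d / 2\<close> at \<open>d = 1 / 10\<close>.\<close>
  define E1 where "E1 = E * (1 ^ (N - 1) * C ^ 3) powr p"
  define E2 where "E2 = E * (1 / tail (19 / 20)) powr p"
  have E1: "E1 \<ge> 0" and E2: "E2 \<ge> 0" using E(1) by (auto simp: E1_def E2_def)
  have far: "\<Phi> w \<le> E2" if w: "norm w < 1" "1 / 10 \<le> norm (1 - w)" for w
  proof -
    have "norm (1 - w) < 2" using w norm_triangle_ineq4[of 1 w] by auto
    then have "g (1 - norm (1 - w) / 2) \<le> (1 / tail (19 / 20)) powr p"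
      using w by (intro g_bounded) auto
    then show ?thesis using E(2)[OF w(1)] E(1) unfolding E2_def
      by (meson mult_left_mono less_imp_le order_trans)
  qed
  show thesis
  proof (rule that[of "2 * E1 + 2 * E2 * pi + 1"])
    show "2 * E1 + 2 * E2 * pi + 1 > 0" using E1 E2 by (intro add_nonneg_pos add_nonneg_nonneg) auto
    fix u :: real assume u: "0 \<le> u" "u < 1"
    have n: "norm (of_real u * unit_dir \<tau>) < 1" "norm (- of_real u * unit_dir \<tau>) < 1" for \<tau>
      using u by (auto simp: norm_mult)
    have plus: "ennreal (\<Phi> (of_real u * unit_dir \<tau>)) \<le> ennreal E1 * (ennreal (g (u - \<bar>\<tau>\<bar>)) * indicator {-u..u} \<tau>) + ennreal E2" for \<tau>
    proof (cases "\<bar>\<tau>\<bar> \<le> u")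
      case True
      define d where "d = norm (1 - of_real u * unit_dir \<tau>)"
      have d: "1 - u + \<bar>\<tau>\<bar> \<le> 4 * d" "d \<le> 1 - u + \<bar>\<tau>\<bar>" "0 < d"
        using dist_unit_dir_lower[OF u True] dist_unit_dir_upper[OF u, of \<tau>] dist_unit_dir_ge[OF u, of \<tau>] u
        by (auto simp: d_def)
      have "g (1 - d / 2) \<le> (1 ^ (N - 1) * C ^ 3) powr p * g (u - \<bar>\<tau>\<bar>)"
        using d u by (intro g_comparable) auto
      then have "\<Phi> (of_real u * unit_dir \<tau>) \<le> E1 * g (u - \<bar>\<tau>\<bar>)"
        using E(2)[OF n(1)[of \<tau>]] E(1) unfolding E1_def d_def[symmetric]
        by (smt (verit) mult_left_mono mult.assoc)
      then have "ennreal (\<Phi> (of_real u * unit_dir \<tau>)) \<le> ennreal E1 * (ennreal (g (u - \<bar>\<tau>\<bar>)) * indicator {-u..u} \<tau>)"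
        using True E1 by (auto simp: abs_le_iff ennreal_mult[symmetric] intro!: ennreal_leI)
      then show ?thesis by (simp add: add_increasing2)
    next
      case False
      then have "\<Phi> (of_real u * unit_dir \<tau>) \<le> E2"
        by (intro far n dist_unit_dir_far[OF u]) auto
      then show ?thesis by (intro add_increasing ennreal_leI) auto
    qed
    have minus: "ennreal (\<Phi> (- of_real u * unit_dir \<tau>)) \<le> ennreal E2" for \<tau>
      by (intro ennreal_leI far n dist_unit_dir_opposite u)
    have "angular u \<le> (\<integral>\<^sup>+\<tau>. ennreal E1 * (ennreal (g (u - \<bar>\<tau>\<bar>)) * indicator {-u..u} \<tau>) + ennreal (2 * E2) * ennreal (1 / (1 + \<tau>\<^sup>2)) \<partial>lborel)"
      unfolding angular_def
    proof (rule nn_integral_mono)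
      fix \<tau> :: real
      define G where "G = ennreal E1 * (ennreal (g (u - \<bar>\<tau>\<bar>)) * indicator {-u..u} \<tau>)"
      define q where "q = ennreal (1 / (1 + \<tau>\<^sup>2))"
      \<comment> \<open>The density is discarded where the indicator confines \<tau>, but kept with
        the constant term, whose integral over the line would otherwise diverge.\<close>
      have "q \<le> 1" using one_plus_square_pos[of \<tau>] by (simp add: q_def)
      have "ennreal (\<Phi> (of_real u * unit_dir \<tau>)) + ennreal (\<Phi> (- of_real u * unit_dir \<tau>)) \<le> (G + ennreal E2) + ennreal E2"
        unfolding G_def by (intro add_mono plus minus)
      also have "\<dots> = G + ennreal (2 * E2)" using E2 by (simp add: add.assoc flip: ennreal_plus)
      finally have "q * (ennreal (\<Phi> (of_real u * unit_dir \<tau>)) + ennreal (\<Phi> (- of_real u * unit_dir \<tau>)))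
         \<le> q * (G + ennreal (2 * E2))" by (rule mult_left_mono) simp
      also have "\<dots> \<le> G + ennreal (2 * E2) * q"
        unfolding distrib_left using mult_right_mono[OF \<open>q \<le> 1\<close>, of G]
        by (intro add_mono) (auto simp: mult.commute)
      finally show "q * (ennreal (\<Phi> (of_real u * unit_dir \<tau>)) + ennreal (\<Phi> (- of_real u * unit_dir \<tau>)))
         \<le> G + ennreal (2 * E2) * q" .
    qed
    also have "\<dots> = ennreal E1 * (\<integral>\<^sup>+\<tau>. ennreal (g (u - \<bar>\<tau>\<bar>)) * indicator {-u..u} \<tau> \<partial>lborel) + ennreal (2 * E2) * ennreal pi"
      by (subst nn_integral_add) (auto simp: nn_integral_cmult nn_integral_inverse_one_plus_square)
    also have "\<dots> \<le> ennreal E1 * (2 * (\<integral>\<^sup>+t. ennreal (g t) * indicator {0..u} t \<partial>lborel)) + ennreal (2 * E2) * ennreal pi"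
      by (intro add_mono mult_left_mono nn_integral_abs_reflect) auto
    also have "\<dots> = ennreal (2 * E1) * (\<integral>\<^sup>+t. ennreal (g t) * indicator {0..u} t \<partial>lborel) + ennreal (2 * E2 * pi)"
      using E1 E2 by (simp add: ennreal_mult'' mult_ac)
    also have "\<dots> \<le> ennreal (2 * E1 + 2 * E2 * pi + 1) * (\<integral>\<^sup>+t. ennreal (g t) * indicator {0..u} t \<partial>lborel) + ennreal (2 * E1 + 2 * E2 * pi + 1)"
      using E1 E2 by (intro add_mono mult_right_mono ennreal_leI) auto
    also have "\<dots> = ennreal (2 * E1 + 2 * E2 * pi + 1) * (1 + (\<integral>\<^sup>+t. ennreal (g t) * indicator {0..u} t \<partial>lborel))"
      by (simp add: distrib_left add.commute)
    finally show "angular u \<le> ennreal (2 * E1 + 2 * E2 * pi + 1) * (1 + (\<integral>\<^sup>+t. ennreal (g t) * indicator {0..u} t \<partial>lborel))" .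
  qed
qed

text \<open>Slopes with \<open>\<bar>\<tau>\<bar> \<le> \<eta> * (1 - u)\<close> stay in the Stolz
  angle of \<open>kernel_lower\<close>. The density is at least \<open>1 / 2\<close> there and the
  window has length \<open>2 * h\<close>, which gives the factor \<open>1 - u\<close>.\<close>

lemma angular_lower:
  obtains c where "c > 0" "\<And>u. 0 \<le> u \<Longrightarrow> u < 1 \<Longrightarrow> ennreal (c * ((1 - u) * g u)) \<le> angular u"
proof -
  obtain c \<epsilon> where c: "c > 0" "\<epsilon> > 0"
    "\<And>u e. 0 \<le> u \<Longrightarrow> u < 1 \<Longrightarrow> norm e = 1 \<Longrightarrow> norm (e - 1) \<le> \<epsilon> * (1 - u) \<Longrightarrow>
      c / ((1 - u) * tail u) \<le> norm (kernel.series (of_real u * e))"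
    using kernel_lower by metis
  define \<eta> where "\<eta> = min \<epsilon> 1"
  have \<eta>: "0 < \<eta>" "\<eta> \<le> \<epsilon>" "\<eta> \<le> 1" using c by (auto simp: \<eta>_def)
  show thesis
  proof (rule that[of "\<eta> * c powr p"])
    show "\<eta> * c powr p > 0" using \<eta> c by simp
    fix u :: real assume u: "0 \<le> u" "u < 1"
    define h where "h = \<eta> * (1 - u)"
    have h: "0 < h" "h \<le> 1" using \<eta> u by (auto simp: h_def mult_le_one)
    have point: "c powr p * g u \<le> \<Phi> (of_real u * unit_dir \<tau>)" if "\<bar>\<tau>\<bar> \<le> h" for \<tau>
    proof -
      have "norm (unit_dir \<tau> - 1) \<le> \<eta> * (1 - u)" using norm_unit_dir_minus_one[of \<tau>] that by (simp add: h_def)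
      also have "\<dots> \<le> \<epsilon> * (1 - u)" using \<eta> u by (intro mult_right_mono) auto
      finally have "c / ((1 - u) * tail u) \<le> norm (kernel.series (of_real u * unit_dir \<tau>))"
        by (intro c(3) u) auto
      then have "(1 - u) ^ N * (c / ((1 - u) * tail u)) \<le> norm (1 - of_real u * unit_dir \<tau>) ^ N * norm (kernel.series (of_real u * unit_dir \<tau>))"
        using u dist_unit_dir_ge[OF u, of \<tau>] c by (intro mult_mono power_mono) auto
      moreover have "(1 - u) ^ N * (c / ((1 - u) * tail u)) = c * ((1 - u) ^ (N - 1) / tail u)"
      proof -
        obtain M where "N = Suc M" using N by (cases N) auto
        then show ?thesis using u by simp
      qed
      ultimately have "(c * ((1 - u) ^ (N - 1) / tail u)) powr p \<le> \<Phi> (of_real u * unit_dir \<tau>)"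
        unfolding \<Phi>_def norm_mult norm_power using p c u by (intro powr_mono2) auto
      moreover have "(c * ((1 - u) ^ (N - 1) / tail u)) powr p = c powr p * g u"
        unfolding g_def by (rule powr_mult)
      ultimately show ?thesis by simp
    qed
    have "ennreal (\<eta> * c powr p * ((1 - u) * g u)) \<le> ennreal (c powr p * g u / 2) * ennreal (2 * h)"
      using h u \<eta> by (subst ennreal_mult[symmetric]) (auto simp: h_def intro!: ennreal_leI mult_nonneg_nonneg)
    also have "\<dots> = (\<integral>\<^sup>+\<tau>. ennreal (c powr p * g u / 2) * indicator {-h..h} \<tau> \<partial>lborel)"
      using h by (subst nn_integral_cmult_indicator) auto
    also have "\<dots> \<le> angular u"
      unfolding angular_def
    proof (rule nn_integral_mono)
      fix \<tau> :: real
      show "ennreal (c powr p * g u / 2) * indicator {-h..h} \<tau> \<le> ennreal (1 / (1 + \<tau>\<^sup>2)) *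
         (ennreal (\<Phi> (of_real u * unit_dir \<tau>)) + ennreal (\<Phi> (- of_real u * unit_dir \<tau>)))"
      proof (cases "\<bar>\<tau>\<bar> \<le> h")
        case True
        then have "\<tau>\<^sup>2 \<le> 1" using h by (simp add: abs_square_le_1)
        then have "1 / 2 \<le> 1 / (1 + \<tau>\<^sup>2)" by (intro divide_left_mono) (auto intro: mult_pos_pos add_pos_nonneg)
        then have "1 / 2 * (c powr p * g u) \<le> 1 / (1 + \<tau>\<^sup>2) * \<Phi> (of_real u * unit_dir \<tau>)"
          using point[OF True] c by (intro mult_mono) auto
        then have "ennreal (c powr p * g u / 2) \<le> ennreal (1 / (1 + \<tau>\<^sup>2)) * ennreal (\<Phi> (of_real u * unit_dir \<tau>))"
          by (subst ennreal_mult[symmetric]) (auto intro!: ennreal_leI)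
        also have "\<dots> \<le> ennreal (1 / (1 + \<tau>\<^sup>2)) * (ennreal (\<Phi> (of_real u * unit_dir \<tau>)) + ennreal (\<Phi> (- of_real u * unit_dir \<tau>)))"
          by (intro mult_left_mono) auto
        finally show ?thesis using True by (auto split: split_indicator)
      qed (auto split: split_indicator)
    qed
    finally show "ennreal (\<eta> * c powr p * ((1 - u) * g u)) \<le> angular u" .
  qed
qed

end

section \<open>Integration against the second weight\<close>

text \<open>The moment condition is transferred to tails: \<open>moment_le_tail\<close> at
  \<open>x = 1 / (1 - t)\<close> and \<open>moment_ge_tail\<close> at \<open>K ^ j * x\<close> lose
  the factor \<open>D * exp 2\<close>, so the condition is first iterated until its gain exceeds
  twice that loss.\<close>

lemma (in doubling_measure) reverse_doubling:
  assumes "1 < C1" "1 < K" "\<And>x. 1 \<le> x \<Longrightarrow> C1 * moment (K * x) \<le> moment x"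
  obtains L where "1 < L" "\<And>t. 0 \<le> t \<Longrightarrow> t < 1 \<Longrightarrow> 2 * tail (1 - (1 - t) / L) \<le> tail t"
proof -
  obtain D where D: "D > 0" "\<And>x. 1 \<le> x \<Longrightarrow> moment x \<le> D * tail (1 - 1 / x)"
    using moment_le_tail by blast
  obtain i where i: "2 * D * exp 2 < C1 ^ i" using real_arch_pow[OF assms(1)] by blast
  \<comment> \<open>Ensures \<open>K ^ j * x \<ge> 2\<close>, as \<open>moment_ge_tail\<close>
    demands.\<close>
  obtain l where l: "2 < K ^ l" using real_arch_pow[OF assms(2)] by blast
  define j where "j = max i l"
  have "C1 ^ i \<le> C1 ^ j" "K ^ l \<le> K ^ j" using assms by (auto simp: j_def intro: power_increasing)
  then have j: "2 * D * exp 2 \<le> C1 ^ j" "2 \<le> K ^ j" using i l by linarith+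
  have iterate: "C1 ^ n * moment (K ^ n * x) \<le> moment x" if "1 \<le> x" for n x
  proof (induction n)
    case (Suc n)
    have "1 * 1 \<le> K ^ n * x" using that assms(2) by (intro mult_mono one_le_power) auto
    then have "C1 ^ n * (C1 * moment (K * (K ^ n * x))) \<le> C1 ^ n * moment (K ^ n * x)"
      using assms by (intro mult_left_mono) auto
    then show ?case using Suc by (simp add: mult_ac)
  qed simp
  show thesis
  proof (rule that[of "K ^ j"])
    show "1 < K ^ j" using j by linarith
    fix t :: real assume t: "0 \<le> t" "t < 1"
    define x where "x = 1 / (1 - t)"
    have x: "1 \<le> x" using t by (simp add: x_def)
    have Kx: "2 * 1 \<le> K ^ j * x" using j x by (intro mult_mono) auto
    have "1 - 1 / (K ^ j * x) = 1 - (1 - t) / K ^ j" by (simp add: x_def)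
    then have "exp (- 2) * tail (1 - (1 - t) / K ^ j) \<le> moment (K ^ j * x)"
      using moment_ge_tail[of "K ^ j * x"] Kx by simp
    then have "C1 ^ j * (exp (- 2) * tail (1 - (1 - t) / K ^ j)) \<le> C1 ^ j * moment (K ^ j * x)"
      using assms by (intro mult_left_mono) auto
    also have "\<dots> \<le> moment x" by (rule iterate[OF x])
    also have "\<dots> \<le> D * tail t" using D(2)[OF x] by (simp add: x_def)
    finally have 1: "C1 ^ j * (exp (- 2) * tail (1 - (1 - t) / K ^ j)) \<le> D * tail t" .
    have "2 * D * exp 2 * (exp (- 2) * tail (1 - (1 - t) / K ^ j)) \<le> C1 ^ j * (exp (- 2) * tail (1 - (1 - t) / K ^ j))"
      using j by (intro mult_right_mono) auto
    also note 1
    also have "2 * D * exp 2 * (exp (- 2) * tail (1 - (1 - t) / K ^ j)) = D * (2 * tail (1 - (1 - t) / K ^ j))"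
      by (simp add: exp_minus)
    finally show "2 * tail (1 - (1 - t) / K ^ j) \<le> tail t" using D(1) by simp
  qed
qed

locale weighted_kernel = kernel_setting \<mu> C p N + nu: radial_measure \<nu>
  for \<mu> C p N and \<nu> :: "real measure"
begin

text \<open>The area integral of the theorem for \<open>norm z = x\<close> in polar form, times
  \<open>pi\<close>; the factor \<open>r\<close> is the Jacobian. Correspondingly \<open>J\<close>
  is the integral on the right-hand side.\<close>

definition I :: "real \<Rightarrow> ennreal" where
  "I x = (\<integral>\<^sup>+r. ennreal r * angular (r * x) \<partial>\<nu>)"

definition J :: "real \<Rightarrow> ennreal" where
  "J x = (\<integral>\<^sup>+t. ennreal (nu.tail t * g t) * indicator {0..x} t \<partial>lborel)"

lemma nu_pair: "pair_sigma_finite \<nu> lborel" "pair_sigma_finite lborel \<nu>"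
  by (auto intro!: pair_sigma_finite.intro lborel.sigma_finite_measure_axioms nu.sigma_finite_measure_axioms)

lemma nu_tail_measurable [measurable]: "nu.tail \<in> borel_measurable borel"
proof -
  have "(\<lambda>t. - nu.tail t) \<in> borel_measurable borel"
    by (rule borel_measurable_mono) (auto simp: mono_def intro: nu.tail_antimono)
  then show ?thesis by simp
qed

text \<open>The triangle \<open>t \<le> r * x\<close> lies in the region \<open>t \<le> x\<close>,
  \<open>t \<le> r\<close>. Integrating first in \<open>r\<close> therefore produces the tail of
  \<nu> at \<open>t\<close>.\<close>

lemma I_le_J:
  obtains B where "B > 0" "\<And>x. 0 \<le> x \<Longrightarrow> x < 1 \<Longrightarrow> I x \<le> ennreal B * (J x + 1)"
proof -
  obtain B where B: "B > 0" "\<And>u. 0 \<le> u \<Longrightarrow> u < 1 \<Longrightarrow>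
    angular u \<le> ennreal B * (1 + (\<integral>\<^sup>+t. ennreal (g t) * indicator {0..u} t \<partial>lborel))"
    using angular_upper by blast
  \<comment> \<open>Absorbs the total mass of \<nu>, which multiplies the constant \<open>1\<close>
    of \<open>angular_upper\<close>.\<close>
  define T where "T = max 1 (nu.tail 0)"
  show thesis
  proof (rule that[of "B * T"])
    show "B * T > 0" using B by (simp add: T_def)
    fix x :: real assume x: "0 \<le> x" "x < 1"
    define F :: "real \<Rightarrow> real \<Rightarrow> ennreal" where "F r t = (if 0 \<le> t \<and> t \<le> r * x then ennreal (g t) else 0)" for r t
    have F[measurable]: "case_prod F \<in> borel_measurable (\<nu> \<Otimes>\<^sub>M lborel)"
      unfolding F_def by measurable
    have "I x \<le> (\<integral>\<^sup>+r. ennreal B * (1 + (\<integral>\<^sup>+t. F r t \<partial>lborel)) \<partial>\<nu>)"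
      unfolding I_def
    proof (rule nn_integral_mono_AE, rule nu.AE_unitI)
      fix r :: real assume r: "0 \<le> r" "r < 1"
      have "r * x \<le> r * 1" using r x by (intro mult_left_mono) auto
      then have rx: "0 \<le> r * x" "r * x < 1" using r x by auto
      have "ennreal r * angular (r * x) \<le> 1 * angular (r * x)"
        using r by (intro mult_right_mono) auto
      also have "\<dots> \<le> ennreal B * (1 + (\<integral>\<^sup>+t. ennreal (g t) * indicator {0..r * x} t \<partial>lborel))"
        using B(2)[OF rx] by simp
      also have "(\<integral>\<^sup>+t. ennreal (g t) * indicator {0..r * x} t \<partial>lborel) = (\<integral>\<^sup>+t. F r t \<partial>lborel)"
        by (intro nn_integral_cong) (auto simp: F_def split: split_indicator)
      finally show "ennreal r * angular (r * x) \<le> ennreal B * (1 + (\<integral>\<^sup>+t. F r t \<partial>lborel))" .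
    qed
    also have "\<dots> = ennreal B * (emeasure \<nu> UNIV + (\<integral>\<^sup>+r. \<integral>\<^sup>+t. F r t \<partial>lborel \<partial>\<nu>))"
      by (simp add: nn_integral_cmult nn_integral_add)
    also have "(\<integral>\<^sup>+r. \<integral>\<^sup>+t. F r t \<partial>lborel \<partial>\<nu>) = (\<integral>\<^sup>+t. \<integral>\<^sup>+r. F r t \<partial>\<nu> \<partial>lborel)"
      using pair_sigma_finite.Fubini'[OF nu_pair(1) F] by simp
    also have "\<dots> \<le> J x"
      unfolding J_def
    proof (rule nn_integral_mono)
      fix t :: real
      have "(\<integral>\<^sup>+r. F r t \<partial>\<nu>) \<le> (\<integral>\<^sup>+r. ennreal (g t) * indicator {0..x} t * indicator {t..} r \<partial>\<nu>)"
      proof (rule nn_integral_mono_AE, rule nu.AE_unitI)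
        fix r :: real assume r: "0 \<le> r" "r < 1"
        have "r * x \<le> r * 1" "r * x \<le> 1 * x" using r x by (intro mult_left_mono mult_right_mono; simp)+
        then show "F r t \<le> ennreal (g t) * indicator {0..x} t * indicator {t..} r"
          by (auto simp: F_def split: split_indicator)
      qed
      also have "\<dots> = ennreal (g t) * indicator {0..x} t * emeasure \<nu> {t..}"
        by (rule nn_integral_cmult_indicator) (simp add: nu.sets_eq)
      also have "\<dots> = ennreal (nu.tail t * g t) * indicator {0..x} t"
        by (simp add: nu.emeasure_eq_measure nu.tail_def ennreal_mult mult_ac)
      finally show "(\<integral>\<^sup>+r. F r t \<partial>\<nu>) \<le> ennreal (nu.tail t * g t) * indicator {0..x} t" .
    qed
    also have "emeasure \<nu> UNIV = ennreal (nu.tail 0)"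
    proof -
      have "emeasure \<nu> UNIV = emeasure \<nu> {0..}"
        by (rule emeasure_eq_AE, rule nu.AE_unitI) (auto simp: nu.sets_eq)
      then show ?thesis by (simp add: nu.emeasure_eq_measure nu.tail_def)
    qed
    also have "ennreal B * (ennreal (nu.tail 0) + J x) \<le> ennreal B * (ennreal T * (J x + 1))"
    proof (intro mult_left_mono)
      have "1 * J x \<le> ennreal T * J x" by (intro mult_right_mono) (auto simp: T_def)
      moreover have "ennreal (nu.tail 0) \<le> ennreal T" by (intro ennreal_leI) (simp add: T_def)
      ultimately show "ennreal (nu.tail 0) + J x \<le> ennreal T * (J x + 1)"
        by (simp add: distrib_left add.commute add_mono)
    qed simp
    also have "\<dots> = ennreal (B * T) * (J x + 1)"
      using B by (simp add: ennreal_mult T_def mult.assoc)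
    finally show "I x \<le> ennreal (B * T) * (J x + 1)" by (simp add: add_mono mult_left_mono)
  qed
qed

definition h :: "real \<Rightarrow> real" where "h u = (1 - u) * g u"

lemma h_measurable [measurable]: "h \<in> borel_measurable borel"
  unfolding h_def by measurable

text \<open>Reverse doubling replaces the tail at \<open>t\<close> by twice the mass of the layer
  from \<open>t\<close> to \<open>1 - (1 - t) / K\<close>. After the exchange of integrals,
  \<open>t\<close> runs through an interval of length \<open>(K - 1) * (1 - r)\<close> for given
  \<open>r\<close>.\<close>

lemma J_le_h:
  assumes "1 < K" "\<And>t. 0 \<le> t \<Longrightarrow> t < 1 \<Longrightarrow> 2 * nu.tail (1 - (1 - t) / K) \<le> nu.tail t"
  obtains B where "B > 0" "\<And>x. 0 \<le> x \<Longrightarrow> x < 1 \<Longrightarrow> J x \<le> ennreal B * (\<integral>\<^sup>+r. ennreal (h (r * x)) \<partial>\<nu>)"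
proof -
  define B where "B = (K ^ (N - 1) * C ^ 1) powr p"
  have B: "B > 0" using assms(1) C_ge_1 by (simp add: B_def)
  show thesis
  proof (rule that[of "2 * (B * K)"])
    show "2 * (B * K) > 0" using B assms(1) by simp
    fix x :: real assume x: "0 \<le> x" "x < 1"
    define F :: "real \<Rightarrow> real \<Rightarrow> ennreal" where
      "F t r = (if 0 \<le> t \<and> t \<le> x \<and> t \<le> r \<and> r < 1 - (1 - t) / K then ennreal (g t) else 0)" for t r
    have F[measurable]: "case_prod F \<in> borel_measurable (lborel \<Otimes>\<^sub>M \<nu>)"
      unfolding F_def by measurable
    have "J x \<le> (\<integral>\<^sup>+t. 2 * (\<integral>\<^sup>+r. F t r \<partial>\<nu>) \<partial>lborel)"
      unfolding J_def
    proof (rule nn_integral_mono)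
      fix t :: real
      show "ennreal (nu.tail t * g t) * indicator {0..x} t \<le> 2 * (\<integral>\<^sup>+r. F t r \<partial>\<nu>)"
      proof (cases "0 \<le> t \<and> t \<le> x")
        case True
        define s where "s = 1 - (1 - t) / K"
        have "(1 - t) * 1 \<le> (1 - t) * K" using True x assms(1) by (intro mult_left_mono) auto
        then have "t \<le> s" using assms(1) by (simp add: s_def field_simps)
        have "measure \<nu> {t..<s} = measure \<nu> ({t..} - {s..})" by (rule arg_cong[where f = "measure \<nu>"]) auto
        also have "\<dots> = nu.tail t - nu.tail s"
          unfolding nu.tail_def using \<open>t \<le> s\<close> by (intro nu.finite_measure_Diff) (auto simp: nu.sets_eq)
        finally have "nu.tail t \<le> 2 * measure \<nu> {t..<s}"
          using assms(2)[of t] True x by (simp add: s_def)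
        then have "ennreal (nu.tail t * g t) \<le> ennreal (2 * (g t * measure \<nu> {t..<s}))"
          by (intro ennreal_leI) (auto simp: mult_ac intro: order_trans[OF mult_right_mono])
        also have "\<dots> = 2 * (ennreal (g t) * emeasure \<nu> {t..<s})"
          by (simp add: nu.emeasure_eq_measure ennreal_mult)
        also have "ennreal (g t) * emeasure \<nu> {t..<s} = (\<integral>\<^sup>+r. ennreal (g t) * indicator {t..<s} r \<partial>\<nu>)"
          by (rule nn_integral_cmult_indicator[symmetric]) (simp add: nu.sets_eq)
        also have "\<dots> = (\<integral>\<^sup>+r. F t r \<partial>\<nu>)"
          using True by (intro nn_integral_cong) (auto simp: F_def s_def split: split_indicator)
        finally show ?thesis using True by simp
      qed simp
    qed
    also have "\<dots> = 2 * (\<integral>\<^sup>+t. \<integral>\<^sup>+r. F t r \<partial>\<nu> \<partial>lborel)"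
      by (rule nn_integral_cmult) (use nu.borel_measurable_nn_integral[OF F] in simp)
    also have "(\<integral>\<^sup>+t. \<integral>\<^sup>+r. F t r \<partial>\<nu> \<partial>lborel) = (\<integral>\<^sup>+r. \<integral>\<^sup>+t. F t r \<partial>lborel \<partial>\<nu>)"
      using pair_sigma_finite.Fubini'[OF nu_pair(2) F] by simp
    also have "\<dots> \<le> (\<integral>\<^sup>+r. ennreal (B * K) * ennreal (h (r * x)) \<partial>\<nu>)"
    proof (rule nn_integral_mono_AE, rule nu.AE_unitI)
      fix r :: real assume r: "0 \<le> r" "r < 1"
      define u where "u = r * x"
      have "r * x \<le> r * 1" using r x by (intro mult_left_mono) auto
      then have u: "0 \<le> u" "u < 1" "u \<le> r" using r x by (auto simp: u_def)
      \<comment> \<open>As \<open>t \<le> r\<close> and \<open>t \<le> x\<close>, this gives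
        \<open>1 - u \<le> 2 * (1 - t)\<close>: one doubling step, the exponent \<open>1\<close> in
        \<open>B\<close>.\<close>
      have ux: "1 - u \<le> (1 - r) + (1 - x)"
      proof -
        have "0 \<le> (1 - r) * (1 - x)" using r x by (intro mult_nonneg_nonneg) auto
        then show ?thesis by (simp add: u_def algebra_simps)
      qed
      have "(\<integral>\<^sup>+t. F t r \<partial>lborel) \<le> (\<integral>\<^sup>+t. ennreal (B * g u) * indicator {1 - K * (1 - r)..r} t \<partial>lborel)"
      proof (rule nn_integral_mono)
        fix t :: real
        show "F t r \<le> ennreal (B * g u) * indicator {1 - K * (1 - r)..r} t"
        proof (cases "0 \<le> t \<and> t \<le> x \<and> t \<le> r \<and> r < 1 - (1 - t) / K")
          case True
          then have Kt: "1 - t \<le> K * (1 - r)" using assms(1) by (simp add: field_simps)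
          also have "\<dots> \<le> K * (1 - u)" using u assms(1) by (intro mult_left_mono) auto
          finally have "g t \<le> B * g u"
            unfolding B_def using True ux u x assms(1) by (intro g_comparable) auto
          then show ?thesis using True Kt by (auto simp: F_def intro!: ennreal_leI split: split_indicator)
        qed (simp only: F_def if_False zero_le)
      qed
      also have "\<dots> = ennreal (B * g u) * ennreal (r - (1 - K * (1 - r)))"
      proof -
        have "1 * (1 - r) \<le> K * (1 - r)" using r assms(1) by (intro mult_right_mono) auto
        then show ?thesis by (subst nn_integral_cmult_indicator) auto
      qed
      also have "\<dots> \<le> ennreal (B * g u) * ennreal (K * (1 - u))"
      proof (intro mult_left_mono ennreal_leI)
        have "K * (1 - r) \<le> K * (1 - u)" using u assms(1) by (intro mult_left_mono) auto
        then show "r - (1 - K * (1 - r)) \<le> K * (1 - u)" using r by linarith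
      qed simp
      also have "\<dots> = ennreal (B * K) * ennreal (h u)"
        using B u assms(1) by (simp add: h_def mult_ac flip: ennreal_mult)
      finally show "(\<integral>\<^sup>+t. F t r \<partial>lborel) \<le> ennreal (B * K) * ennreal (h (r * x))" by (simp only: u_def)
    qed
    also have "\<dots> = ennreal (B * K) * (\<integral>\<^sup>+r. ennreal (h (r * x)) \<partial>\<nu>)"
      by (rule nn_integral_cmult) simp
    finally show "J x \<le> ennreal (2 * (B * K)) * (\<integral>\<^sup>+r. ennreal (h (r * x)) \<partial>\<nu>)"
      using B assms(1) by (simp add: ennreal_mult mult.assoc mult_left_mono)
  qed
qed

text \<open>The Jacobian \<open>r\<close> in \<open>I\<close> degenerates at \<open>0\<close>, so
  the comparison with \<open>h\<close> is made on \<open>r \<ge> 1 / 2\<close>. The bounded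
  contribution of smaller radii and the constant \<open>1\<close> are both absorbed by a positive
  lower bound uniform in \<open>x\<close>.\<close>

lemma J_le_I:
  assumes "1 < K" "\<And>t. 0 \<le> t \<Longrightarrow> t < 1 \<Longrightarrow> 2 * nu.tail (1 - (1 - t) / K) \<le> nu.tail t"
  obtains B where "B > 0" "\<And>x. 0 \<le> x \<Longrightarrow> x < 1 \<Longrightarrow> J x + 1 \<le> ennreal B * I x"
proof -
  obtain B where B: "B > 0" "\<And>x. 0 \<le> x \<Longrightarrow> x < 1 \<Longrightarrow> J x \<le> ennreal B * (\<integral>\<^sup>+r. ennreal (h (r * x)) \<partial>\<nu>)"
    using J_le_h[OF assms] by blast
  obtain c where c: "c > 0" "\<And>u. 0 \<le> u \<Longrightarrow> u < 1 \<Longrightarrow> ennreal (c * ((1 - u) * g u)) \<le> angular u"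
    using angular_lower by blast
  define X where "X x = (\<integral>\<^sup>+r. ennreal (h (r * x)) * indicator {1 / 2..} r \<partial>\<nu>)" for x
  \<comment> \<open>A minorant of \<open>h (r * x)\<close> free of \<open>x\<close>, obtained from
    \<open>r * x \<le> r\<close> and \<open>tail (r * x) \<le> tail 0\<close>.\<close>
  define k where "k r = (1 - r) * ((1 - r) ^ (N - 1) / tail 0) powr p" for r
  define X0 where "X0 = (\<integral>\<^sup>+r. ennreal (k r) * indicator {1 / 2..} r \<partial>\<nu>)"
  have k[measurable]: "k \<in> borel_measurable borel" unfolding k_def by measurable
  have "X0 \<noteq> 0"
  proof
    assume "X0 = 0"
    then have "AE r in \<nu>. ennreal (k r) * indicator {1 / 2..} r = 0"
      unfolding X0_def by (subst (asm) nn_integral_0_iff_AE) auto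
    with nu.AE_unit have "AE r in \<nu>. (r \<in> {1 / 2..}) = (r \<in> {})"
    proof eventually_elim
      fix r :: real
      assume r: "0 \<le> r \<and> r < 1" "ennreal (k r) * indicator {1 / 2..} r = 0"
      then have "0 < k r" using tail_pos[of 0] by (simp add: k_def)
      then show "(r \<in> {1 / 2..}) = (r \<in> {})" using r(2) by (auto split: split_indicator_asm)
    qed
    then have "measure \<nu> {1 / 2..} = measure \<nu> {}"
      by (rule nu.finite_measure_eq_AE) (auto simp: nu.sets_eq)
    then show False using nu.tail_pos[of "1 / 2"] by (simp add: nu.tail_def)
  qed
  then obtain b where b: "b > 0" "ennreal b \<le> X0"
    by (metis ennreal_cases ennreal_eq_0_iff ennreal_less_top less_imp_le not_le order_refl top_greatest zero_less_one)
  have X_ge: "ennreal b \<le> X x" if x: "0 \<le> x" "x < 1" for x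
  proof -
    have "X0 \<le> X x" unfolding X0_def X_def
    proof (rule nn_integral_mono_AE, rule nu.AE_unitI)
      fix r :: real assume r: "0 \<le> r" "r < 1"
      have rx: "r * x \<le> r * 1" using r x by (intro mult_left_mono) auto
      then have "((1 - r) ^ (N - 1) / tail 0) powr p \<le> g (r * x)"
        unfolding g_def using p r x
        by (intro powr_mono2 frac_le power_mono tail_pos tail_antimono) auto
      then have "k r \<le> h (r * x)"
        unfolding k_def h_def using rx r by (intro mult_mono) auto
      then show "ennreal (k r) * indicator {1 / 2..} r \<le> ennreal (h (r * x)) * indicator {1 / 2..} r"
        by (intro mult_right_mono ennreal_leI) auto
    qed
    then show ?thesis using b(2) by (rule order_trans[rotated])
  qed
  have X_le: "X x \<le> ennreal (2 / c) * I x" if x: "0 \<le> x" "x < 1" for x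
  proof -
    have "X x \<le> (\<integral>\<^sup>+r. ennreal (2 / c) * (ennreal r * angular (r * x)) \<partial>\<nu>)"
      unfolding X_def
    proof (rule nn_integral_mono_AE, rule nu.AE_unitI)
      fix r :: real assume r: "0 \<le> r" "r < 1"
      have "r * x \<le> r * 1" using r x by (intro mult_left_mono) auto
      then have rx: "0 \<le> r * x" "r * x < 1" using r x by auto
      show "ennreal (h (r * x)) * indicator {1 / 2..} r \<le> ennreal (2 / c) * (ennreal r * angular (r * x))"
      proof (cases "1 / 2 \<le> r")
        case True
        have "1 * h (r * x) \<le> (2 * r) * h (r * x)"
          using True rx by (intro mult_right_mono) (auto simp: h_def)
        also have "\<dots> = 2 / c * (r * (c * h (r * x)))" using c by simp
        finally have "ennreal (h (r * x)) \<le> ennreal (2 / c * (r * (c * h (r * x))))" by (intro ennreal_leI) simp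
        also have "\<dots> = ennreal (2 / c) * (ennreal r * ennreal (c * h (r * x)))"
          by (subst ennreal_mult', use c in simp, subst ennreal_mult', use r in simp, rule refl)
        also have "\<dots> \<le> ennreal (2 / c) * (ennreal r * angular (r * x))"
          unfolding h_def by (intro mult_left_mono c(2) rx) auto
        finally show ?thesis using True by simp
      qed simp
    qed
    also have "\<dots> = ennreal (2 / c) * I x"
      unfolding I_def by (rule nn_integral_cmult) simp
    finally show ?thesis .
  qed
  define G where "G = (1 / tail (1 / 2)) powr p * nu.tail 0"
  have G: "G \<ge> 0" by (simp add: G_def)
  have h_le: "(\<integral>\<^sup>+r. ennreal (h (r * x)) \<partial>\<nu>) \<le> ennreal G + X x" if x: "0 \<le> x" "x < 1" for x
  proof -
    have "(\<integral>\<^sup>+r. ennreal (h (r * x)) \<partial>\<nu>) \<le> (\<integral>\<^sup>+r. ennreal ((1 / tail (1 / 2)) powr p) * indicator {0..} r + ennreal (h (r * x)) * indicator {1 / 2..} r \<partial>\<nu>)"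
    proof (rule nn_integral_mono_AE, rule nu.AE_unitI)
      fix r :: real assume r: "0 \<le> r" "r < 1"
      have rx: "r * x \<le> r * 1" using r x by (intro mult_left_mono) auto
      show "ennreal (h (r * x)) \<le> ennreal ((1 / tail (1 / 2)) powr p) * indicator {0..} r + ennreal (h (r * x)) * indicator {1 / 2..} r"
      proof (cases "1 / 2 \<le> r")
        case False
        have "h (r * x) \<le> 1 * g (r * x)" unfolding h_def using r x by (intro mult_right_mono) auto
        also have "g (r * x) \<le> (1 / tail (1 / 2)) powr p" using False rx r x by (intro g_bounded) auto
        finally show ?thesis using r False by (simp add: ennreal_leI)
      qed (simp add: add_increasing)
    qed
    also have "\<dots> = ennreal ((1 / tail (1 / 2)) powr p) * emeasure \<nu> {0..} + X x"
      unfolding X_def by (subst nn_integral_add) (auto simp: nn_integral_cmult_indicator nu.sets_eq)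
    also have "ennreal ((1 / tail (1 / 2)) powr p) * emeasure \<nu> {0..} = ennreal G"
      by (simp add: G_def nu.emeasure_eq_measure nu.tail_def ennreal_mult)
    finally show ?thesis .
  qed
  \<comment> \<open>The constant \<open>B * G + 1\<close> is at most \<open>(B * G + 1) / b\<close>
    times \<open>X x\<close>, because \<open>X x\<close> is at least \<open>b\<close>.\<close>
  define A where "A = (B * G + 1) / b + B"
  have A: "A > 0" using B G b by (simp add: A_def add_nonneg_pos)
  show thesis
  proof (rule that[of "A * (2 / c)"])
    show "A * (2 / c) > 0" using A c by simp
    fix x :: real assume x: "0 \<le> x" "x < 1"
    have "J x + 1 \<le> ennreal B * (ennreal G + X x) + 1"
      by (intro add_right_mono order_trans[OF B(2)[OF x]] mult_left_mono h_le x) auto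
    also have "\<dots> = ennreal ((B * G + 1) / b) * ennreal b + ennreal B * X x"
    proof -
      have "ennreal ((B * G + 1) / b) * ennreal b = ennreal B * ennreal G + 1"
        using B G b by (simp add: ennreal_mult flip: ennreal_mult ennreal_plus ennreal_1)
      then show ?thesis by (simp add: distrib_left ac_simps)
    qed
    also have "\<dots> \<le> ennreal ((B * G + 1) / b) * X x + ennreal B * X x"
      by (intro add_right_mono mult_left_mono X_ge x) auto
    also have "\<dots> = ennreal A * X x"
      using B G b by (simp add: A_def ennreal_plus distrib_right)
    also have "\<dots> \<le> ennreal A * (ennreal (2 / c) * I x)"
      by (intro mult_left_mono X_le x) auto
    also have "\<dots> = ennreal (A * (2 / c)) * I x"
      by (subst ennreal_mult', use A in simp, simp only: mult.assoc)
    finally show "J x + 1 \<le> ennreal (A * (2 / c)) * I x" .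
  qed
qed

end

section \<open>From weights to measures\<close>

definition profile_measure :: "(real \<Rightarrow> real) \<Rightarrow> real measure" where
  "profile_measure v = density lborel (\<lambda>r. ennreal (v r))"

lemma sets_profile_measure [simp, measurable_cong]: "sets (profile_measure v) = sets borel"
  by (simp add: profile_measure_def)

text \<open>Weights are only Lebesgue measurable, which Fubini for \<open>lborel\<close> does not accept.\<close>

definition borel_version :: "(real \<Rightarrow> real) \<Rightarrow> (real \<Rightarrow> real) \<Rightarrow> bool" where
  "borel_version \<omega> v \<longleftrightarrow> v \<in> borel_measurable borel \<and> (\<forall>r. 0 \<le> v r) \<and> (\<forall>r. r \<notin> {0..<1} \<longrightarrow> v r = 0) \<and>
     (AE r in lborel. indicator {0..<1} r * \<omega> r = v r)"

lemma ex_borel_version: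
  assumes "radial_weight \<omega>"
  obtains v where "borel_version \<omega> v"
proof -
  define f where "f r = indicator {0..<1} r * \<omega> r" for r
  have "f \<in> borel_measurable lebesgue"
    using assms unfolding radial_weight_def set_integrable_def f_def by auto
  then obtain v0 where v0[measurable]: "v0 \<in> borel_measurable lborel" and ae: "AE r in lborel. f r = v0 r"
    using completion_ex_borel_measurable_real[of f lborel] by blast
  \<comment> \<open>Truncation makes sign and support hold everywhere; only a null set is affected,
    since the weight is already non-negative on the interval.\<close>
  define v where "v r = indicator {0..<1} r * max 0 (v0 r)" for r
  have "v \<in> borel_measurable borel" unfolding v_def by measurable
  moreover have "AE r in lborel. indicator {0..<1} r * \<omega> r = v r"
    using ae
  proof eventually_elim
    fix r assume "f r = v0 r"
    moreover have "r \<in> {0..<1} \<Longrightarrow> 0 \<le> \<omega> r" using assms unfolding radial_weight_def by blast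
    ultimately show "indicator {0..<1} r * \<omega> r = v r" unfolding f_def v_def by (cases "r \<in> {0..<1}") auto
  qed
  ultimately have "borel_version \<omega> v" by (simp add: borel_version_def v_def)
  then show thesis by (rule that)
qed

context
  fixes \<omega> v :: "real \<Rightarrow> real"
  assumes \<omega>: "radial_weight \<omega>" and v: "borel_version \<omega> v"
begin

private lemma v_measurable [measurable]: "v \<in> borel_measurable borel" and v_nonneg: "0 \<le> v r"
  and v_out: "r \<notin> {0..<1} \<Longrightarrow> v r = 0" and v_AE: "AE r in lborel. indicator {0..<1} r * \<omega> r = v r"
  using v by (auto simp: borel_version_def)

private lemma f_integrable: "integrable lebesgue (\<lambda>r. indicator {0..<1} r * \<omega> r)"
  using \<omega> unfolding radial_weight_def set_integrable_def by simp

lemma integral_profile_measure: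
  fixes k :: "real \<Rightarrow> real"
  assumes [measurable]: "k \<in> borel_measurable borel"
  shows "(\<integral>r. k r \<partial>profile_measure v) = (LINT r:{0..<1}|lebesgue. k r * \<omega> r)"
proof -
  have "(\<integral>r. k r \<partial>profile_measure v) = (\<integral>r. v r *\<^sub>R k r \<partial>lborel)"
    unfolding profile_measure_def by (rule integral_density) (auto simp: v_nonneg)
  also have "\<dots> = (\<integral>r. v r *\<^sub>R k r \<partial>lebesgue)" by (rule integral_completion[symmetric]) simp
  also have "\<dots> = (\<integral>r. (indicator {0..<1} r * \<omega> r) *\<^sub>R k r \<partial>lebesgue)"
  proof (rule integral_cong_AE)
    show "AE r in lebesgue. v r *\<^sub>R k r = (indicator {0..<1} r * \<omega> r) *\<^sub>R k r"
      by (rule AE_completion) (use v_AE in \<open>auto elim: eventually_mono\<close>)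
    have [measurable]: "(\<lambda>r. indicator {0..<1} r * \<omega> r) \<in> borel_measurable lebesgue" using f_integrable by simp
    have [measurable]: "k \<in> borel_measurable lebesgue" "v \<in> borel_measurable lebesgue"
      by (auto intro: measurable_completion)
    show "(\<lambda>r. v r *\<^sub>R k r) \<in> borel_measurable lebesgue"
      "(\<lambda>r. (indicator {0..<1} r * \<omega> r) *\<^sub>R k r) \<in> borel_measurable lebesgue"
      by measurable
  qed
  also have "\<dots> = (LINT r:{0..<1}|lebesgue. k r * \<omega> r)"
    unfolding set_lebesgue_integral_def by (intro Bochner_Integration.integral_cong) auto
  finally show ?thesis .
qed

lemma weight_moment_eq: "weight_moment \<omega> x = (\<integral>r. r powr x \<partial>profile_measure v)"
  by (simp add: integral_profile_measure weight_moment_def)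

lemma weight_tail_eq:
  assumes "0 \<le> t"
  shows "weight_tail \<omega> t = measure (profile_measure v) {t..}"
proof -
  have "measure (profile_measure v) {t..} = (\<integral>r. indicator {t..} r \<partial>profile_measure v)" by simp
  also have "\<dots> = (LINT r:{0..<1}|lebesgue. indicator {t..} r * \<omega> r)" by (rule integral_profile_measure) simp
  also have "\<dots> = weight_tail \<omega> t"
    unfolding weight_tail_def set_lebesgue_integral_def using assms
    by (intro Bochner_Integration.integral_cong) (auto split: split_indicator)
  finally show ?thesis by simp
qed

lemma radial_measure_profile: "radial_measure (profile_measure v)"
proof (intro radial_measure.intro radial_measure_axioms.intro finite_measureI)
  have "integrable lebesgue v"
    by (rule integrable_cong_AE_imp[OF f_integrable]) (use v_AE in \<open>auto intro: AE_completion measurable_completion\<close>)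
  then have "integrable lborel v" by (simp add: integrable_completion)
  have "emeasure (profile_measure v) UNIV = (\<integral>\<^sup>+r. ennreal (v r) \<partial>lborel)"
    unfolding profile_measure_def by (simp add: emeasure_density)
  also have "\<dots> < \<infinity>" using \<open>integrable lborel v\<close> v_nonneg by (simp add: nn_integral_eq_integral)
  finally show "emeasure (profile_measure v) (space (profile_measure v)) \<noteq> \<infinity>" by (simp add: profile_measure_def)
  show "AE r in profile_measure v. 0 \<le> r \<and> r < 1"
    unfolding profile_measure_def by (subst AE_density) (use v_out in force)+
  fix t :: real assume t: "0 \<le> t" "t < 1"
  then have "t \<in> {0..<1}" by simp
  then have "0 < weight_tail \<omega> t" using \<omega> unfolding radial_weight_def by blast
  then show "0 < measure (profile_measure v) {t..}" using weight_tail_eq[OF t(1)] by simp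
qed simp

end

text \<open>By polar coordinates a null set of radii sweeps out a planar null set. This lets a
  weight be replaced by its Borel version inside an area integral.\<close>

lemma AE_radial:
  assumes "AE r in lborel. P (r :: real)"
  shows "AE \<zeta> in (lborel :: complex measure). P (norm \<zeta>)"
proof -
  obtain S where S: "{r. \<not> P r} \<subseteq> S" "emeasure lborel S = 0" "S \<in> sets borel"
    using AE_E[OF assms] by auto
  have "AE r in lborel. r \<notin> S"
    by (rule AE_not_in) (use S in \<open>auto simp: null_sets_def\<close>)
  then have ae: "AE r in lborel. (\<integral>\<^sup>+\<tau>. ennreal (r / (1 + \<tau>\<^sup>2)) *
      (indicator S (norm (of_real r * unit_dir \<tau>)) + indicator S (norm (- of_real r * unit_dir \<tau>))) \<partial>lborel) * indicator {0<..} r = (0 :: ennreal)"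
    by eventually_elim (auto simp: norm_mult split: split_indicator)
  have [measurable]: "S \<in> sets borel" by fact
  have "(\<integral>\<^sup>+\<zeta>. indicator S (norm \<zeta>) \<partial>(lborel :: complex measure)) = 0"
    by (subst nn_integral_polar, simp) (subst nn_integral_cong_AE[OF ae], simp)
  then have "AE \<zeta> in (lborel :: complex measure). indicator S (norm \<zeta>) = (0 :: ennreal)"
    by (subst (asm) nn_integral_0_iff_AE) auto
  then show ?thesis
    by eventually_elim (use S in \<open>auto split: split_indicator_asm\<close>)
qed

text \<open>No measurability of \<open>G\<close> is required: almost everywhere equality with the
  Borel function \<open>F\<close> determines the integral.\<close>

lemma nn_integral_area_measure:
  assumes [measurable]: "F \<in> borel_measurable borel" and "AE \<zeta> in lborel. G \<zeta> = F \<zeta>"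
  shows "(\<integral>\<^sup>+\<zeta>. G \<zeta> \<partial>area_measure) = ennreal (1 / pi) * (\<integral>\<^sup>+\<zeta>. F \<zeta> \<partial>lborel)"
proof -
  have ae: "AE \<zeta> in lebesgue. G \<zeta> = F \<zeta>" by (rule AE_completion) (rule assms)
  have F: "F \<in> borel_measurable lebesgue" by (rule measurable_completion) simp
  have "AE \<zeta> in area_measure. G \<zeta> = F \<zeta>"
  proof -
    obtain S where S: "{\<zeta> \<in> space lebesgue. \<not> G \<zeta> = F \<zeta>} \<subseteq> S" "emeasure lebesgue S = 0" "S \<in> sets lebesgue"
      using AE_E[OF ae] by blast
    show ?thesis
      by (rule AE_I[where N = S]) (use S in \<open>auto simp: area_measure_def space_scale_measure\<close>)
  qed
  then have "(\<integral>\<^sup>+\<zeta>. G \<zeta> \<partial>area_measure) = (\<integral>\<^sup>+\<zeta>. F \<zeta> \<partial>area_measure)"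
    by (rule nn_integral_cong_AE)
  also have "\<dots> = ennreal (1 / pi) * (\<integral>\<^sup>+\<zeta>. F \<zeta> \<partial>lebesgue)"
    unfolding area_measure_def by (rule nn_integral_scale_measure[OF F])
  also have "(\<integral>\<^sup>+\<zeta>. F \<zeta> \<partial>lebesgue) = (\<integral>\<^sup>+\<zeta>. F \<zeta> \<partial>lborel)" by (rule nn_integral_completion)
  finally show ?thesis .
qed

theorem lemma5:
  fixes p :: real and N :: nat and \<omega> \<nu> :: "real \<Rightarrow> real"
  assumes "2 \<le> p" and "1 \<le> N" and "\<omega> \<in> class_D_hat" and "radial_weight \<nu>"
  shows
    "(\<exists>C::real>0. \<forall>z\<in>ball 0 1.
        (\<integral>\<^sup>+\<zeta>\<in>ball 0 1.
            ennreal (cmod ((1 - cnj z * \<zeta>) ^ N * bergman_kernel \<omega> z \<zeta>) powr p * \<nu> (cmod \<zeta>))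
          \<partial>area_measure)
        \<le> ennreal C *
           ((\<integral>\<^sup>+t\<in>{0..cmod z}.
                ennreal (weight_tail \<nu> t /
                  (weight_tail \<omega> t powr p * (1 - t) powr (p * (1 - real N))))
              \<partial>lebesgue) + 1))
     \<and>
     (\<nu> \<in> class_D \<longrightarrow>
        comparable_on (ball 0 1)
          (\<lambda>z. \<integral>\<^sup>+\<zeta>\<in>ball 0 1.
            ennreal (cmod ((1 - cnj z * \<zeta>) ^ N * bergman_kernel \<omega> z \<zeta>) powr p * \<nu> (cmod \<zeta>))
          \<partial>area_measure)
          (\<lambda>z. (\<integral>\<^sup>+t\<in>{0..cmod z}.
                ennreal (weight_tail \<nu> t /
                  (weight_tail \<omega> t powr p * (1 - t) powr (p * (1 - real N))))
              \<partial>lebesgue) + 1))"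
    (is "(\<exists>C>0. \<forall>z\<in>ball 0 1. ?L z \<le> ennreal C * ?R z) \<and> _")
proof -
  have \<omega>: "radial_weight \<omega>" using assms(3) by (simp add: class_D_hat_def)
  obtain C where C: "\<forall>r\<in>{0..<1}. weight_tail \<omega> r \<le> C * weight_tail \<omega> ((1 + r) / 2)"
    using assms(3) by (auto simp: class_D_hat_def)
  obtain w where w: "borel_version \<omega> w" using ex_borel_version[OF \<omega>] .
  obtain v where v: "borel_version \<nu> v" using ex_borel_version[OF assms(4)] .
  interpret \<mu>: radial_measure "profile_measure w" by (rule radial_measure_profile[OF \<omega> w])
  interpret V: radial_measure "profile_measure v" by (rule radial_measure_profile[OF assms(4) v])
  have [measurable]: "v \<in> borel_measurable borel" and v_nonneg: "0 \<le> v r"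
    and v_AE: "AE r in lborel. indicator {0..<1} r * \<nu> r = v r" for r
    using v by (auto simp: borel_version_def)
  have w_tail: "weight_tail \<omega> t = \<mu>.tail t" if "0 \<le> t" for t
    unfolding \<mu>.tail_def by (rule weight_tail_eq[OF \<omega> w that])
  have v_tail: "weight_tail \<nu> t = V.tail t" if "0 \<le> t" for t
    unfolding V.tail_def by (rule weight_tail_eq[OF assms(4) v that])
  interpret weighted_kernel "profile_measure w" C p N "profile_measure v"
  proof unfold_locales
    show "\<mu>.tail t \<le> C * \<mu>.tail ((1 + t) / 2)" if "0 \<le> t" "t < 1" for t
      using bspec[OF C, of t] that by (simp add: w_tail)
  qed (use assms in auto)
  \<comment> \<open>The two series agree term by term, so convergence is irrelevant to the
    equality.\<close>
  have kernel_eq: "bergman_kernel \<omega> z \<zeta> = kernel.series (cnj z * \<zeta>)" for z \<zeta>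
    unfolding bergman_kernel_def kernel.series_def
    unfolding \<mu>.odd_moment_eq \<mu>.moment_def weight_moment_eq[OF \<omega> w]
    by (intro arg_cong[where f = suminf]) (auto simp: field_simps)
  have L: "?L z = ennreal (1 / pi) * I (norm z)" if z: "z \<in> ball 0 1" for z
  proof -
    define F where "F \<zeta> = ennreal (\<Phi> (of_real (norm z) * \<zeta>)) * ennreal (v (norm \<zeta>))" for \<zeta>
    have [measurable]: "F \<in> borel_measurable borel" unfolding F_def by measurable
    \<comment> \<open>Rotating by \<open>e\<close> replaces \<open>cnj z\<close> by
      \<open>norm z\<close>; at \<open>z = 0\<close> any unimodular number would do.\<close>
    define e where "e = (if z = 0 then 1 else cnj z / of_real (norm z))"
    have e: "norm e = 1" "cnj z = of_real (norm z) * e"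
      by (auto simp: e_def norm_divide)
    have "?L z = ennreal (1 / pi) * (\<integral>\<^sup>+\<zeta>. F (e * \<zeta>) \<partial>lborel)"
    proof (rule nn_integral_area_measure)
      show "AE \<zeta> in lborel. ennreal (cmod ((1 - cnj z * \<zeta>) ^ N * bergman_kernel \<omega> z \<zeta>) powr p * \<nu> (cmod \<zeta>)) * indicator (ball 0 1) \<zeta> = F (e * \<zeta>)"
        using AE_radial[OF v_AE]
      proof eventually_elim
        fix \<zeta> :: complex
        assume \<zeta>: "indicator {0..<1} (norm \<zeta>) * \<nu> (norm \<zeta>) = v (norm \<zeta>)"
        have eq: "of_real (norm z) * (e * \<zeta>) = cnj z * \<zeta>" by (simp add: e(2))
        have "F (e * \<zeta>) = ennreal (\<Phi> (cnj z * \<zeta>)) * ennreal (v (norm \<zeta>))"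
          by (simp only: F_def norm_mult e(1) mult_1_left eq)
        then show "ennreal (cmod ((1 - cnj z * \<zeta>) ^ N * bergman_kernel \<omega> z \<zeta>) powr p * \<nu> (cmod \<zeta>)) * indicator (ball 0 1) \<zeta> = F (e * \<zeta>)"
          using \<zeta> v_nonneg[of "norm \<zeta>"]
          by (auto simp: kernel_eq \<Phi>_def ennreal_mult split: split_indicator)
      qed
    qed simp
    also have "(\<integral>\<^sup>+\<zeta>. F (e * \<zeta>) \<partial>lborel) = (\<integral>\<^sup>+\<zeta>. F \<zeta> \<partial>lborel)"
      by (rule nn_integral_complex_rotate) (auto simp: e)
    also have "\<dots> = (\<integral>\<^sup>+r. (\<integral>\<^sup>+\<tau>. ennreal (r / (1 + \<tau>\<^sup>2)) * (F (of_real r * unit_dir \<tau>) + F (- of_real r * unit_dir \<tau>)) \<partial>lborel)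
       * indicator {0<..} r \<partial>lborel)"
      by (rule nn_integral_polar) simp
    also have "\<dots> = (\<integral>\<^sup>+r. ennreal (v r) * (ennreal r * angular (r * norm z)) \<partial>lborel)"
    proof (rule nn_integral_cong)
      fix r :: real
      show "(\<integral>\<^sup>+\<tau>. ennreal (r / (1 + \<tau>\<^sup>2)) * (F (of_real r * unit_dir \<tau>) + F (- of_real r * unit_dir \<tau>)) \<partial>lborel) * indicator {0<..} r
        = ennreal (v r) * (ennreal r * angular (r * norm z))"
      proof (cases "0 < r")
        case True
        have "(\<integral>\<^sup>+\<tau>. ennreal (r / (1 + \<tau>\<^sup>2)) * (F (of_real r * unit_dir \<tau>) + F (- of_real r * unit_dir \<tau>)) \<partial>lborel)
          = (\<integral>\<^sup>+\<tau>. ennreal (v r) * ennreal r * (ennreal (1 / (1 + \<tau>\<^sup>2)) *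
               (ennreal (\<Phi> (of_real (r * norm z) * unit_dir \<tau>)) + ennreal (\<Phi> (- of_real (r * norm z) * unit_dir \<tau>)))) \<partial>lborel)"
        proof (rule nn_integral_cong)
          fix \<tau> :: real
          have "ennreal (r / (1 + \<tau>\<^sup>2)) = ennreal r * ennreal (1 / (1 + \<tau>\<^sup>2))"
            using True one_plus_square_pos[of \<tau>] by (simp flip: ennreal_mult)
          then show "ennreal (r / (1 + \<tau>\<^sup>2)) * (F (of_real r * unit_dir \<tau>) + F (- of_real r * unit_dir \<tau>))
            = ennreal (v r) * ennreal r * (ennreal (1 / (1 + \<tau>\<^sup>2)) *
               (ennreal (\<Phi> (of_real (r * norm z) * unit_dir \<tau>)) + ennreal (\<Phi> (- of_real (r * norm z) * unit_dir \<tau>))))"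
            using True by (simp add: F_def norm_mult distrib_left distrib_right mult_ac)
        qed
        also have "\<dots> = ennreal (v r) * ennreal r * angular (r * norm z)"
          unfolding angular_def by (rule nn_integral_cmult) simp
        finally show ?thesis using True by (simp add: mult.assoc)
      next
        case False
        then show ?thesis by (simp add: ennreal_neg)
      qed
    qed
    also have "\<dots> = I (norm z)"
      unfolding I_def by (subst profile_measure_def[of v], subst nn_integral_density) simp_all
    finally show ?thesis .
  qed
  have R: "?R z = J (norm z) + 1" if z: "z \<in> ball 0 1" for z
  proof -
    have "(\<integral>\<^sup>+t\<in>{0..cmod z}. ennreal (weight_tail \<nu> t / (weight_tail \<omega> t powr p * (1 - t) powr (p * (1 - real N)))) \<partial>lebesgue)
      = (\<integral>\<^sup>+t. ennreal (V.tail t * g t) * indicator {0..cmod z} t \<partial>lebesgue)"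
    proof (rule nn_integral_cong)
      fix t :: real
      show "ennreal (weight_tail \<nu> t / (weight_tail \<omega> t powr p * (1 - t) powr (p * (1 - real N)))) * indicator {0..cmod z} t
        = ennreal (V.tail t * g t) * indicator {0..cmod z} t"
      proof (cases "t \<in> {0..cmod z}")
        case True
        then have t: "0 \<le> t" "t < 1" using z by auto
        \<comment> \<open>From natural to real powers: \<open>t < 1\<close> makes the base positive,
          and \<open>1 \<le> N\<close> turns \<open>real (N - 1)\<close> into
          \<open>real N - 1\<close>.\<close>
        have "((1 - t) ^ (N - 1)) powr p = (1 - t) powr (real (N - 1) * p)"
          using t by (simp add: powr_powr flip: powr_realpow)
        also have "\<dots> = 1 / (1 - t) powr (p * (1 - real N))"
          using \<open>1 \<le> N\<close> by (simp add: of_nat_diff algebra_simps flip: powr_minus_divide)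
        finally have "g t = 1 / (1 - t) powr (p * (1 - real N)) / \<mu>.tail t powr p"
          unfolding g_def using t by (simp add: powr_divide)
        then show ?thesis using t by (simp add: w_tail v_tail mult.commute)
      qed simp
    qed
    also have "\<dots> = J (norm z)" unfolding J_def by (rule nn_integral_completion)
    finally show ?thesis by simp
  qed
  obtain B where B: "B > 0" "\<And>x. 0 \<le> x \<Longrightarrow> x < 1 \<Longrightarrow> I x \<le> ennreal B * (J x + 1)"
    using I_le_J by blast
  have upper: "\<exists>C>0. \<forall>z\<in>ball 0 1. ?L z \<le> ennreal C * ?R z"
  proof (intro exI[of _ "1 / pi * B"] conjI ballI)
    fix z :: complex assume z: "z \<in> ball 0 1"
    then have "ennreal (1 / pi) * I (norm z) \<le> ennreal (1 / pi) * (ennreal B * (J (norm z) + 1))"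
      by (intro mult_left_mono B) auto
    then show "?L z \<le> ennreal (1 / pi * B) * ?R z"
      unfolding L[OF z] R[OF z] using B(1) by (subst ennreal_mult) (auto simp: mult.assoc)
  qed (use B in simp)
  have lower: "\<exists>C>0. \<forall>z\<in>ball 0 1. ?R z \<le> ennreal C * ?L z" if \<nu>: "\<nu> \<in> class_D"
  proof -
    obtain C' where C': "\<forall>r\<in>{0..<1}. weight_tail \<nu> r \<le> C' * weight_tail \<nu> ((1 + r) / 2)"
      using \<nu> by (auto simp: class_D_def class_D_hat_def)
    \<comment> \<open>Doubling of \<nu> itself enters through \<open>moment_le_tail\<close>, when
      the moment condition is converted into reverse doubling.\<close>
    interpret Vd: doubling_measure "profile_measure v" C'
    proof unfold_locales
      show "V.tail t \<le> C' * V.tail ((1 + t) / 2)" if "0 \<le> t" "t < 1" for t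
        using bspec[OF C', of t] that by (simp add: v_tail)
    qed
    obtain C1 K where CK: "C1 > 1" "K > 1" "\<forall>x\<ge>1. weight_moment \<nu> x \<ge> C1 * weight_moment \<nu> (K * x)"
      using \<nu> by (auto simp: class_D_def class_M_def)
    have "C1 * V.moment (K * x) \<le> V.moment x" if "1 \<le> x" for x
      using CK(3) that by (simp add: V.moment_def weight_moment_eq[OF assms(4) v])
    then obtain L where L': "1 < L" "\<And>t. 0 \<le> t \<Longrightarrow> t < 1 \<Longrightarrow> 2 * V.tail (1 - (1 - t) / L) \<le> V.tail t"
      using Vd.reverse_doubling[OF CK(1,2)] by blast
    obtain A where A: "A > 0" "\<And>x. 0 \<le> x \<Longrightarrow> x < 1 \<Longrightarrow> J x + 1 \<le> ennreal A * I x"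
      using J_le_I[OF L'] by blast
    show ?thesis
    proof (intro exI[of _ "A * pi"] conjI ballI)
      fix z :: complex assume z: "z \<in> ball 0 1"
      have "ennreal (A * pi) * (ennreal (1 / pi) * I (norm z)) = ennreal (A * pi * (1 / pi)) * I (norm z)"
        using A(1) by (subst ennreal_mult[of "A * pi"]) (auto simp: mult.assoc)
      then show "?R z \<le> ennreal (A * pi) * ?L z"
        unfolding L[OF z] R[OF z] using A(2)[of "norm z"] z by simp
    qed (use A in simp)
  qed
  show ?thesis
    using upper lower by (auto simp: comparable_on_def)
qed

end
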